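(* Let $0 \leq \beta \leq 1$, let $N\geq 1$, and let $\rho_{AB_0 \cdots B_{N-1}}$ be any multiparty quantum state of arbitrary (finite) local dimensions such that $$E_a\left(\rho_{A|B_i}\right)\geq \sum_{j=i+1}^{N-1}E_a\left(\rho_{A|B_{j}}\right)\quad\text{for all } i=0,\ldots,N-2.$$ Then $$\left(E_a\left(\rho_{A|B_0 \cdots B_{N-1}}\right)\right)^{\beta} \leq \sum_{j=0}^{N-1}\beta^{j}\left(E_a\left(\rho_{A|B_j}\right)\right)^{\beta},$$ where $E_a$ denotes the entanglement of assistance and $\rho_{AB_j}$ is the reduced density matrix on subsystems $A$ and $B_j$.
   Context: A quantum state (density matrix) is a positive semidefinite operator of trace one on a tensor product of finite-dimensional complex Hilbert spaces, one tensor factor for each party. Reduced density matrices are obtained by partial trace over the remaining parties. Entropy of entanglement: for a bipartite pure state $|\psi\rangle_{XY}$ with reduced density matrix $\rho_X=\mathrm{tr}_Y|\psi\rangle\langle\psi|$, set $E(|\psi\rangle_{X|Y})=S(\rho_X)$, where $S(\rho)=-\mathrm{tr}\,\rho\log\rho$ is the von Neumann entropy (logarithm to base 2). Entanglement of assistance (EoA): for a bipartite state $\rho_{XY}$, $$E_a(\rho_{X|Y})=\max \sum_{i}p_i E\left(|\psi_i\rangle_{X|Y}\right),$$ where the maximum is over all pure-state decompositions $\rho_{XY}=\sum_i p_i|\psi_i\rangle_{XY}\langle\psi_i|$ (with $p_i\ge 0$, $\sum_i p_i=1$, and unit vectors $|\psi_i\rangle$). The quantity $E_a(\rho_{A|B_0\cdots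 B_{N-1}})$ is the EoA of the whole state across the bipartition into $X=A$ and $Y=B_0\cdots B_{N-1}$, and $E_a(\rho_{A|B_j})$ is the EoA of $\rho_{AB_j}$ across $A$ and $B_j$. Convention: $0^0=1$ (relevant only when $\beta=0$). *)

theory Defs
  imports Complex_Main "Jordan_Normal_Form.Schur_Decomposition"
begin

text \<open>
  A finite-dimensional Hilbert space is \<open>\<complex>\<^sup>n\<close>, with operators given by matrices in a fixed
  orthonormal basis. On a tensor product of spaces of dimensions \<open>d\<^sub>0, \<dots>, d\<^sub>m\<close> the product basis
  is numbered lexicographically, as for Kronecker products; so in dimension \<open>dX * dY\<close> the basis
  vector \<open>|x\<rangle>|y\<rangle>\<close> has number \<open>x * dY + y\<close>.
\<close>

definition mat_trace :: "complex mat \<Rightarrow> complex" where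
  "mat_trace A = (\<Sum>i<dim_row A. A $$ (i, i))"

definition unitary_mat :: "nat \<Rightarrow> complex mat \<Rightarrow> bool" where
  "unitary_mat n U \<longleftrightarrow>
     U \<in> carrier_mat n n \<and> U * mat_adjoint U = 1\<^sub>m n \<and> mat_adjoint U * U = 1\<^sub>m n"

definition positive_semidefinite :: "nat \<Rightarrow> complex mat \<Rightarrow> bool" where
  "positive_semidefinite n A \<longleftrightarrow>
     A \<in> carrier_mat n n \<and> mat_adjoint A = A \<and>
     (\<forall>v \<in> carrier_vec n. 0 \<le> Re ((A *\<^sub>v v) \<bullet>c v))"

definition density_operator :: "nat \<Rightarrow> complex mat \<Rightarrow> bool" where
  "density_operator n \<rho> \<longleftrightarrow> positive_semidefinite n \<rho> \<and> mat_trace \<rho> = 1"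

text \<open>
  Functional calculus \<open>f(A)\<close> for a Hermitian matrix \<open>A\<close>: apply \<open>f\<close> to the eigenvalues in a unitary
  diagonalization. The result does not depend on which diagonalization is used.
\<close>
definition mat_fun :: "(real \<Rightarrow> real) \<Rightarrow> complex mat \<Rightarrow> complex mat" where
  "mat_fun f A = (SOME B. \<exists>U \<mu>.
     unitary_mat (dim_row A) U \<and>
     A = U * mat_diag (dim_row A) (\<lambda>i. complex_of_real (\<mu> i)) * mat_adjoint U \<and>
     B = U * mat_diag (dim_row A) (\<lambda>i. complex_of_real (f (\<mu> i))) * mat_adjoint U)"

text \<open>
  The value of \<open>log 2\<close> at \<open>0\<close> is immaterial here: in the product it is multiplied by the
  eigenvalue \<open>0\<close>, which is the usual convention \<open>0 log 0 = 0\<close>.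
\<close>
definition von_neumann_entropy :: "complex mat \<Rightarrow> real" where
  "von_neumann_entropy \<rho> = - Re (mat_trace (\<rho> * mat_fun (log 2) \<rho>))"

definition ketbra :: "complex vec \<Rightarrow> complex mat" where
  "ketbra \<psi> = mat (dim_vec \<psi>) (dim_vec \<psi>) (\<lambda>(r, c). \<psi> $ r * cnj (\<psi> $ c))"

definition partial_trace_snd :: "nat \<Rightarrow> nat \<Rightarrow> complex mat \<Rightarrow> complex mat" where
  "partial_trace_snd dX dY \<rho> =
     mat dX dX (\<lambda>(x, x'). \<Sum>y<dY. \<rho> $$ (x * dY + y, x' * dY + y))"

definition entanglement_entropy :: "nat \<Rightarrow> nat \<Rightarrow> complex vec \<Rightarrow> real" where
  "entanglement_entropy dX dY \<psi> = von_neumann_entropy (partial_trace_snd dX dY (ketbra \<psi>))"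

definition pure_decomposition ::
  "nat \<Rightarrow> complex mat \<Rightarrow> nat \<Rightarrow> (nat \<Rightarrow> real) \<Rightarrow> (nat \<Rightarrow> complex vec) \<Rightarrow> bool" where
  "pure_decomposition n \<rho> m p \<psi> \<longleftrightarrow>
     (\<forall>i<m. 0 \<le> p i) \<and> (\<Sum>i<m. p i) = 1 \<and>
     (\<forall>i<m. \<psi> i \<in> carrier_vec n \<and> \<psi> i \<bullet>c \<psi> i = 1) \<and>
     \<rho> = mat n n (\<lambda>(r, c). \<Sum>i<m. complex_of_real (p i) * ketbra (\<psi> i) $$ (r, c))"

text \<open>
  For a density operator the set below is nonempty and bounded by \<open>log 2 dX\<close>, and its
  supremum is attained, so \<open>Sup\<close> is the maximum over all pure-state decompositions.
\<close>
definition entanglement_of_assistance :: "nat \<Rightarrow> nat \<Rightarrow> complex mat \<Rightarrow> real" where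
  "entanglement_of_assistance dX dY \<rho> =
     Sup {(\<Sum>i<m. p i * entanglement_entropy dX dY (\<psi> i)) | m p \<psi>.
            pure_decomposition (dX * dY) \<rho> m p \<psi>}"

text \<open>
  The number of \<open>|a\<rangle>|b\<^sub>0\<rangle>\<dots>|b\<^bsub>N-1\<^esub>\<rangle>\<close>, where \<open>r = a * dB j + b\<^sub>j\<close> encodes the pair \<open>(a, b\<^sub>j)\<close>,
  \<open>l\<close> encodes \<open>(b\<^sub>0, \<dots>, b\<^bsub>j-1\<^esub>)\<close> and \<open>s\<close> encodes \<open>(b\<^bsub>j+1\<^esub>, \<dots>, b\<^bsub>N-1\<^esub>)\<close>.
\<close>
definition joint_index :: "nat \<Rightarrow> (nat \<Rightarrow> nat) \<Rightarrow> nat \<Rightarrow> nat \<Rightarrow> nat \<Rightarrow> nat \<Rightarrow> nat" where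
  "joint_index N dB j r l s =
     ((r div dB j * (\<Prod>k<j. dB k) + l) * dB j + r mod dB j) * (\<Prod>k\<in>{j<..<N}. dB k) + s"

definition reduced_AB ::
  "nat \<Rightarrow> nat \<Rightarrow> (nat \<Rightarrow> nat) \<Rightarrow> complex mat \<Rightarrow> nat \<Rightarrow> complex mat" where
  "reduced_AB N dA dB \<rho> j =
     mat (dA * dB j) (dA * dB j) (\<lambda>(r, c).
       \<Sum>l<(\<Prod>k<j. dB k). \<Sum>s<(\<Prod>k\<in>{j<..<N}. dB k).
         \<rho> $$ (joint_index N dB j r l s, joint_index N dB j c l s))"

text \<open>Real powers with \<open>0\<^sup>0 = 1\<close>, whereas \<open>0 powr 0 = 0\<close>.\<close>
definition rpow :: "real \<Rightarrow> real \<Rightarrow> real" where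
  "rpow x b = (if b = 0 then 1 else x powr b)"

end

theory Submission
  imports Defs "Jordan_Normal_Form.Spectral_Radius"
begin

text \<open>
  The heart is the polygamy inequality \<open>E\<^sub>a(A|BC) \<le> E\<^sub>a(A|B) + E\<^sub>a(A|C)\<close>. For a pure state of \<open>ABC\<close>,
  measuring \<open>B\<close> in its Schmidt basis, and in a Fourier basis unbiased to it, yields two pure-state
  decompositions of the state of \<open>AC\<close>. Monotonicity of the relative entropy under pinching shows
  that their average entanglement entropies add up to at least \<open>S(A) + S(C) - S(B)\<close>, so
  \<open>2 E\<^sub>a(A|C) \<ge> S(A) + S(C) - S(B)\<close>; adding the same bound with \<open>B\<close> and \<open>C\<close> exchanged gives
  \<open>E\<^sub>a(A|B) + E\<^sub>a(A|C) \<ge> S(A)\<close>. Mixed states follow by concatenating decompositions, and several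
  parties by induction.

  Monotonicity of the relative entropy is obtained from its integral representation: the integrand
  is a supremum, over matrices \<open>Z\<close>, of \<open>2 Re tr (Z\<^sup>* \<rho>) - tr (Z\<^sup>* \<sigma> Z) - t tr (Z \<rho> Z\<^sup>*)\<close>, and
  restricting to block-diagonal \<open>Z\<close> can only decrease it.

  The \<open>\<beta>\<close>-th powers are handled by \<open>(1 + t) powr \<beta> \<le> 1 + \<beta> t \<le> 1 + \<beta> (t powr \<beta>)\<close> for
  \<open>0 \<le> t \<le> 1\<close>.
\<close>

section \<open>Orthonormal bases and spectral decompositions\<close>

text \<open>Why two bases: the average entanglement left after measuring B is the sum of the
  unnormalized entropies plus the sum of p ln p over the outcome probabilities. In the Schmidt basis
  these are the spectrum of the state of B, which gives -S(B). In an unbiased basis they all equal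
  1/d, and the resulting -ln d cancels the +ln d from the pinched blocks, each of which is the state
  of A divided by d. The unnormalized entropies are controlled by the relative entropy of the state
  of AB to its pinching in one basis of B, before and after pinching both in the other basis; S(AB)
  = S(C) by purity.

  The obstacle is the logarithm of noncommuting operators. Entropies are therefore only evaluated as
  sums over eigenvalues and squared overlaps of eigenvectors, which turns operator inequalities into
  real-variable ones. Operators are kernels on arbitrary finite sets, so that a product set serves
  as a tensor product. Vectors stay unnormalized; normalization is postponed to the passage back to
  \<open>pure_decomposition\<close>.\<close>

definition ip :: "'a set \<Rightarrow> ('a \<Rightarrow> complex) \<Rightarrow> ('a \<Rightarrow> complex) \<Rightarrow> complex" where
  "ip V u v = (\<Sum>a\<in>V. cnj (u a) * v a)"

text \<open>Orthonormality and completeness are both required, so that no cardinalities need to be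
  compared when \<open>I\<close> and \<open>V\<close> differ, as for a basis indexed by
  \<open>B \<times> A\<close> of the functions on \<open>K \<times> A\<close>.\<close>

definition onb :: "'i set \<Rightarrow> 'a set \<Rightarrow> ('i \<Rightarrow> 'a \<Rightarrow> complex) \<Rightarrow> bool" where
  "onb I V e \<longleftrightarrow> finite I \<and> finite V \<and>
     (\<forall>i\<in>I. \<forall>j\<in>I. ip V (e i) (e j) = (if i = j then 1 else 0)) \<and>
     (\<forall>a\<in>V. \<forall>b\<in>V. (\<Sum>i\<in>I. e i a * cnj (e i b)) = (if a = b then 1 else 0))"

definition spec ::
  "'i set \<Rightarrow> 'a set \<Rightarrow> ('a \<Rightarrow> 'a \<Rightarrow> complex) \<Rightarrow> ('i \<Rightarrow> 'a \<Rightarrow> complex) \<Rightarrow> ('i \<Rightarrow> real) \<Rightarrow> bool" where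
  "spec I V X e \<mu> \<longleftrightarrow> onb I V e \<and>
     (\<forall>a\<in>V. \<forall>b\<in>V. X a b = (\<Sum>i\<in>I. complex_of_real (\<mu> i) * e i a * cnj (e i b)))"

definition sesq :: "'a set \<Rightarrow> ('a \<Rightarrow> 'a \<Rightarrow> complex) \<Rightarrow> ('a \<Rightarrow> complex) \<Rightarrow> ('a \<Rightarrow> complex) \<Rightarrow> complex" where
  "sesq V X u v = (\<Sum>a\<in>V. \<Sum>b\<in>V. cnj (u a) * X a b * v b)"

lemma onbD:
  assumes "onb I V e"
  shows "finite I" "finite V"
    "\<And>i j. i \<in> I \<Longrightarrow> j \<in> I \<Longrightarrow> ip V (e i) (e j) = (if i = j then 1 else 0)"
    "\<And>a b. a \<in> V \<Longrightarrow> b \<in> V \<Longrightarrow> (\<Sum>i\<in>I. e i a * cnj (e i b)) = (if a = b then 1 else 0)"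
  using assms unfolding onb_def by blast+

lemma specD:
  assumes "spec I V X e \<mu>"
  shows "onb I V e"
    "\<And>a b. a \<in> V \<Longrightarrow> b \<in> V \<Longrightarrow> X a b = (\<Sum>i\<in>I. complex_of_real (\<mu> i) * e i a * cnj (e i b))"
  using assms unfolding spec_def by blast+

lemma cnj_ip: "cnj (ip V u v) = ip V v u"
  by (simp add: ip_def mult.commute)

lemma ip_self: "ip V u u = complex_of_real (\<Sum>a\<in>V. (cmod (u a))\<^sup>2)"
  unfolding ip_def of_real_sum complex_norm_square by (simp add: mult.commute)

lemma ip_sum_right: "ip V u (\<lambda>a. \<Sum>j\<in>J. c j * f j a) = (\<Sum>j\<in>J. c j * ip V u (f j))"
  unfolding ip_def sum_distrib_left
  by (subst sum.swap) (simp add: mult_ac)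

lemma ip_sum_left: "ip V (\<lambda>a. \<Sum>j\<in>J. c j * f j a) v = (\<Sum>j\<in>J. cnj (c j) * ip V (f j) v)"
  unfolding ip_def sum_distrib_left cnj_sum sum_distrib_right
  by (subst sum.swap) (simp add: mult_ac)

lemma onb_cnj: "onb I V e \<Longrightarrow> onb I V (\<lambda>i a. cnj (e i a))"
proof -
  assume o: "onb I V e"
  have 1: "ip V (\<lambda>a. cnj (e i a)) (\<lambda>a. cnj (e j a)) = cnj (ip V (e i) (e j))" for i j
    by (simp add: ip_def)
  have 2: "(\<Sum>i\<in>I. cnj (e i a) * cnj (cnj (e i b))) = cnj (\<Sum>i\<in>I. e i a * cnj (e i b))" for a b
    by simp
  show ?thesis using onbD[OF o] unfolding onb_def 1 2 by simp
qed

text \<open>Conjugation exchanges the two halves of \<open>onb\<close>. Through this lemma,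
  completeness is used as orthonormality in the index set.\<close>

lemma onb_transpose: "onb I V e \<Longrightarrow> onb V I (\<lambda>a i. e i a)"
proof -
  assume o: "onb I V e"
  have 1: "ip I (\<lambda>i. e i a) (\<lambda>i. e i b) = cnj (\<Sum>i\<in>I. e i a * cnj (e i b))" for a b
    by (simp add: ip_def)
  have 2: "(\<Sum>a\<in>V. e i a * cnj (e j a)) = cnj (ip V (e i) (e j))" for i j
    by (simp add: ip_def)
  show ?thesis using onbD[OF o] unfolding onb_def 1 2 by simp
qed

lemma parseval:
  assumes "onb I V e"
  shows "(\<Sum>i\<in>I. cnj (ip V (e i) u) * ip V (e i) v) = ip V u v"
proof -
  note o = onbD[OF assms]
  have "(\<Sum>i\<in>I. cnj (ip V (e i) u) * ip V (e i) v)
      = (\<Sum>i\<in>I. \<Sum>a\<in>V. \<Sum>b\<in>V. cnj (u a) * v b * (e i a * cnj (e i b)))"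
    unfolding ip_def cnj_sum sum_product by (simp add: mult_ac)
  also have "\<dots> = (\<Sum>a\<in>V. \<Sum>i\<in>I. \<Sum>b\<in>V. cnj (u a) * v b * (e i a * cnj (e i b)))"
    by (rule sum.swap)
  also have "\<dots> = (\<Sum>a\<in>V. \<Sum>b\<in>V. \<Sum>i\<in>I. cnj (u a) * v b * (e i a * cnj (e i b)))"
    by (intro sum.cong refl sum.swap)
  also have "\<dots> = (\<Sum>a\<in>V. \<Sum>b\<in>V. cnj (u a) * v b * (\<Sum>i\<in>I. e i a * cnj (e i b)))"
    by (simp add: sum_distrib_left)
  also have "\<dots> = (\<Sum>a\<in>V. \<Sum>b\<in>V. if a = b then cnj (u a) * v b else 0)"
    by (intro sum.cong refl) (simp add: o)
  also have "\<dots> = ip V u v"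
    unfolding ip_def using o(2) by (simp add: sum.delta)
  finally show ?thesis .
qed

lemma parseval_norm:
  assumes "onb I V e"
  shows "(\<Sum>i\<in>I. (cmod (ip V (e i) u))\<^sup>2) = (\<Sum>a\<in>V. (cmod (u a))\<^sup>2)"
proof -
  have "complex_of_real (\<Sum>i\<in>I. (cmod (ip V (e i) u))\<^sup>2) = complex_of_real (\<Sum>a\<in>V. (cmod (u a))\<^sup>2)"
    using parseval[OF assms, of u u] unfolding ip_self[of V u]
    unfolding of_real_sum complex_norm_square by (simp add: mult.commute)
  then show ?thesis unfolding of_real_eq_iff .
qed

lemma onb_expand:
  assumes "onb I V e" "a \<in> V"
  shows "(\<Sum>i\<in>I. ip V (e i) u * e i a) = u a"
proof -
  note o = onbD[OF assms(1)]
  have "(\<Sum>i\<in>I. ip V (e i) u * e i a) = (\<Sum>i\<in>I. \<Sum>b\<in>V. u b * (e i a * cnj (e i b)))"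
    unfolding ip_def sum_distrib_right by (simp add: mult_ac)
  also have "\<dots> = (\<Sum>b\<in>V. u b * (\<Sum>i\<in>I. e i a * cnj (e i b)))"
    by (subst sum.swap) (simp add: sum_distrib_left)
  also have "\<dots> = (\<Sum>b\<in>V. if a = b then u b else 0)"
    by (intro sum.cong refl) (simp add: o assms)
  also have "\<dots> = u a" using o(2) assms(2) by simp
  finally show ?thesis .
qed

lemma sesq_spec:
  assumes "spec I V X e \<mu>"
  shows "sesq V X u v = (\<Sum>i\<in>I. of_real (\<mu> i) * (cnj (ip V (e i) u) * ip V (e i) v))"
proof -
  have "sesq V X u v = (\<Sum>a\<in>V. \<Sum>b\<in>V. \<Sum>i\<in>I. of_real (\<mu> i) * ((cnj (u a) * e i a) * (cnj (e i b) * v b)))"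
    unfolding sesq_def
    by (intro sum.cong refl) (simp add: specD(2)[OF assms] sum_distrib_left sum_distrib_right mult_ac)
  also have "\<dots> = (\<Sum>a\<in>V. \<Sum>i\<in>I. \<Sum>b\<in>V. of_real (\<mu> i) * ((cnj (u a) * e i a) * (cnj (e i b) * v b)))"
    by (intro sum.cong refl sum.swap)
  also have "\<dots> = (\<Sum>i\<in>I. \<Sum>a\<in>V. \<Sum>b\<in>V. of_real (\<mu> i) * ((cnj (u a) * e i a) * (cnj (e i b) * v b)))"
    by (rule sum.swap)
  also have "\<dots> = (\<Sum>i\<in>I. of_real (\<mu> i) * (cnj (ip V (e i) u) * ip V (e i) v))"
    unfolding ip_def cnj_sum sum_product by (simp add: sum_distrib_left mult_ac)
  finally show ?thesis .
qed

lemma sesq_spec_norm: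
  assumes "spec I V X e \<mu>"
  shows "sesq V X u u = of_real (\<Sum>i\<in>I. \<mu> i * (cmod (ip V (e i) u))\<^sup>2)"
  unfolding sesq_spec[OF assms] of_real_sum of_real_mult complex_norm_square
  by (simp add: mult.commute)

lemma sesq_eigen:
  assumes "spec I V X e \<mu>" "i \<in> I" "j \<in> I"
  shows "sesq V X (e i) (e j) = (if i = j then of_real (\<mu> i) else 0)"
proof -
  note o = onbD[OF specD(1)[OF assms(1)]]
  have "sesq V X (e i) (e j) = (\<Sum>k\<in>I. of_real (\<mu> k) * (cnj (if k = i then 1 else 0) * (if k = j then 1 else 0)))"
    unfolding sesq_spec[OF assms(1)] by (intro sum.cong refl) (simp add: o assms)
  also have "\<dots> = (\<Sum>k\<in>I. if k = i then (if i = j then of_real (\<mu> i) else 0) else 0)"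
    by (intro sum.cong refl) auto
  also have "\<dots> = (if i = j then of_real (\<mu> i) else 0)"
    using o(1) assms(2) by (simp add: sum.delta)
  finally show ?thesis .
qed

lemma spec_cong:
  assumes "\<And>a b. a \<in> V \<Longrightarrow> b \<in> V \<Longrightarrow> X a b = Y a b"
  shows "spec I V X e \<mu> = spec I V Y e \<mu>"
  unfolding spec_def using assms by auto

lemma trace_spec:
  assumes "spec I V X e \<mu>"
  shows "(\<Sum>a\<in>V. X a a) = of_real (\<Sum>i\<in>I. \<mu> i)"
proof -
  note o = onbD[OF specD(1)[OF assms]]
  have "(\<Sum>a\<in>V. X a a) = (\<Sum>a\<in>V. \<Sum>i\<in>I. of_real (\<mu> i) * (cnj (e i a) * e i a))"
    by (intro sum.cong refl) (simp add: specD(2)[OF assms] mult_ac)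
  also have "\<dots> = (\<Sum>i\<in>I. of_real (\<mu> i) * ip V (e i) (e i))"
    unfolding ip_def by (subst sum.swap) (simp add: sum_distrib_left)
  also have "\<dots> = of_real (\<Sum>i\<in>I. \<mu> i)" by (simp add: o)
  finally show ?thesis .
qed

lemma spec_nonneg:
  assumes "spec I V X e \<mu>" "\<And>u. 0 \<le> Re (sesq V X u u)" "i \<in> I"
  shows "0 \<le> \<mu> i"
  using assms(2)[of "e i"] sesq_eigen[OF assms(1,3,3)] by simp

lemma sum_swap22:
  "(\<Sum>x\<in>A. \<Sum>y\<in>B. \<Sum>i\<in>C. \<Sum>j\<in>D. g x y i j) = (\<Sum>i\<in>C. \<Sum>j\<in>D. \<Sum>x\<in>A. \<Sum>y\<in>B. g x y i j)"
proof -
  have "(\<Sum>x\<in>A. \<Sum>y\<in>B. \<Sum>i\<in>C. \<Sum>j\<in>D. g x y i j) = (\<Sum>x\<in>A. \<Sum>i\<in>C. \<Sum>j\<in>D. \<Sum>y\<in>B. g x y i j)"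
    by (intro sum.cong refl, subst sum.swap, intro sum.cong refl sum.swap)
  also have "\<dots> = (\<Sum>i\<in>C. \<Sum>j\<in>D. \<Sum>x\<in>A. \<Sum>y\<in>B. g x y i j)"
    by (subst sum.swap, intro sum.cong refl sum.swap)
  finally show ?thesis .
qed

lemma onb_change:
  assumes "onb J V e" "onb I J f"
  shows "onb I V (\<lambda>i a. \<Sum>j\<in>J. f i j * e j a)"
proof -
  note oe = onbD[OF assms(1)] and of = onbD[OF assms(2)]
  have ip1: "ip V (\<lambda>a. \<Sum>j\<in>J. f i j * e j a) (\<lambda>a. \<Sum>j\<in>J. f i' j * e j a) = (if i = i' then 1 else 0)"
    if "i \<in> I" "i' \<in> I" for i i'
  proof -
    have "ip V (\<lambda>a. \<Sum>j\<in>J. f i j * e j a) (\<lambda>a. \<Sum>j\<in>J. f i' j * e j a)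
        = (\<Sum>j\<in>J. cnj (f i j) * (\<Sum>j'\<in>J. f i' j' * ip V (e j) (e j')))"
      unfolding ip_sum_left ip_sum_right ..
    also have "\<dots> = (\<Sum>j\<in>J. cnj (f i j) * (\<Sum>j'\<in>J. if j = j' then f i' j' else 0))"
      by (intro sum.cong refl arg_cong2[where f="(*)"]) (simp add: oe)
    also have "\<dots> = ip J (f i) (f i')" unfolding ip_def using oe(1) by simp
    finally show ?thesis using of(3) that by simp
  qed
  have "(\<Sum>i\<in>I. (\<Sum>j\<in>J. f i j * e j a) * cnj (\<Sum>j\<in>J. f i j * e j b)) = (if a = b then 1 else 0)"
    if "a \<in> V" "b \<in> V" for a b
  proof -
    have "(\<Sum>i\<in>I. (\<Sum>j\<in>J. f i j * e j a) * cnj (\<Sum>j\<in>J. f i j * e j b))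
        = (\<Sum>i\<in>I. cnj (ip J (\<lambda>j. cnj (f i j)) (\<lambda>j. e j b)) * ip J (\<lambda>j. cnj (f i j)) (\<lambda>j. e j a))"
      by (simp add: ip_def mult.commute)
    also have "\<dots> = ip J (\<lambda>j. e j b) (\<lambda>j. e j a)"
      by (rule parseval[OF onb_cnj[OF assms(2)]])
    also have "\<dots> = (if a = b then 1 else 0)"
      using onbD(3)[OF onb_transpose[OF assms(1)]] that by auto
    finally show ?thesis .
  qed
  with ip1 show ?thesis unfolding onb_def using oe of by blast
qed

text \<open>Expanding in \<open>e\<close> the vectors that diagonalize the matrix of
  \<open>X\<close> in the basis \<open>e\<close> gives eigenvectors of \<open>X\<close> itself. This
  carries the deflation step of the spectral theorem.\<close>

lemma spec_change:
  assumes e: "onb J V e" and s: "spec I J (\<lambda>i j. sesq V X (e i) (e j)) f \<mu>"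
  shows "spec I V X (\<lambda>i a. \<Sum>j\<in>J. f i j * e j a) \<mu>"
proof -
  have X: "X a b = (\<Sum>i\<in>I. of_real (\<mu> i) * (\<Sum>j\<in>J. f i j * e j a) * cnj (\<Sum>j\<in>J. f i j * e j b))"
    if ab: "a \<in> V" "b \<in> V" for a b
  proof -
    \<comment> \<open>An entry of \<open>X\<close> is the form on two point masses, whose
      coefficients in the basis \<open>e\<close> are conjugated values of \<open>e\<close>.\<close>
    let ?da = "\<lambda>x. if x = a then 1 else (0::complex)" and ?db = "\<lambda>x. if x = b then 1 else (0::complex)"
    have "X a b = sesq V X ?da ?db"
    proof -
      have "sesq V X ?da ?db = (\<Sum>a'\<in>V. if a' = a then (\<Sum>b'\<in>V. if b' = b then X a' b' else 0) else 0)"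
        unfolding sesq_def by (intro sum.cong refl) (auto intro!: sum.cong)
      then show ?thesis using ab onbD(2)[OF e] by simp
    qed
    also have "\<dots> = sesq V X (\<lambda>a. \<Sum>j\<in>J. ip V (e j) ?da * e j a) (\<lambda>a. \<Sum>j\<in>J. ip V (e j) ?db * e j a)"
      unfolding sesq_def by (intro sum.cong refl) (simp add: onb_expand[OF e])
    also have "\<dots> = sesq V X (\<lambda>a'. \<Sum>j\<in>J. cnj (e j a) * e j a') (\<lambda>a'. \<Sum>j\<in>J. cnj (e j b) * e j a')"
    proof -
      have "ip V (e j) (\<lambda>x. if x = c then 1 else 0) = cnj (e j c)" if "c \<in> V" for j c
      proof -
        have "ip V (e j) (\<lambda>x. if x = c then 1 else 0) = (\<Sum>x\<in>V. if x = c then cnj (e j x) else 0)"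
          unfolding ip_def by (intro sum.cong) auto
        then show ?thesis using that onbD(2)[OF e] by simp
      qed
      then show ?thesis using ab by simp
    qed
    also have "\<dots> = (\<Sum>x\<in>V. \<Sum>y\<in>V. \<Sum>i\<in>J. \<Sum>j\<in>J. e i a * cnj (e j b) * (cnj (e i x) * X x y * e j y))"
      unfolding sesq_def
      by (simp add: cnj_sum sum_distrib_left sum_distrib_right mult_ac)
    also have "\<dots> = (\<Sum>i\<in>J. \<Sum>j\<in>J. \<Sum>x\<in>V. \<Sum>y\<in>V. e i a * cnj (e j b) * (cnj (e i x) * X x y * e j y))"
      by (rule sum_swap22)
    also have "\<dots> = (\<Sum>i\<in>J. \<Sum>j\<in>J. e i a * cnj (e j b) * sesq V X (e i) (e j))"
      unfolding sesq_def by (simp add: sum_distrib_left)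
    also have "\<dots> = sesq J (\<lambda>i j. sesq V X (e i) (e j)) (\<lambda>i. cnj (e i a)) (\<lambda>i. cnj (e i b))"
      unfolding sesq_def[of J] by (simp add: mult_ac)
    also have "\<dots> = (\<Sum>i\<in>I. of_real (\<mu> i) * (cnj (ip J (f i) (\<lambda>i. cnj (e i a))) * ip J (f i) (\<lambda>i. cnj (e i b))))"
      by (rule sesq_spec[OF s])
    also have "\<dots> = (\<Sum>i\<in>I. of_real (\<mu> i) * (\<Sum>j\<in>J. f i j * e j a) * cnj (\<Sum>j\<in>J. f i j * e j b))"
      unfolding ip_def by (simp add: mult.assoc)
    finally show ?thesis .
  qed
  then show ?thesis unfolding spec_def using onb_change[OF e specD(1)[OF s]] by blast
qed

section \<open>The spectral theorem\<close>

text \<open>A numbering of \<open>V\<close> turns \<open>X\<close> into a complex matrix, whose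
  spectrum is nonempty; the eigenvector is carried back along the numbering.\<close>

lemma eigenvector_exists:
  fixes X :: "'a \<Rightarrow> 'a \<Rightarrow> complex"
  assumes "finite V" "V \<noteq> {}"
  obtains v c where "\<exists>a\<in>V. v a \<noteq> 0" "\<And>a. a \<in> V \<Longrightarrow> (\<Sum>b\<in>V. X a b * v b) = c * v a"
proof -
  define n where "n = card V"
  have n: "n \<noteq> 0" using assms by (simp add: n_def)
  obtain h where h: "bij_betw h {..<n} V"
    using ex_bij_betw_nat_finite[OF assms(1)] unfolding n_def atLeast0LessThan by blast
  define A where "A = mat n n (\<lambda>(i,j). X (h i) (h j))"
  have A: "A \<in> carrier_mat n n" by (simp add: A_def)
  obtain c v where v: "eigenvector A v c"
    using spectrum_non_empty[OF A] n unfolding spectrum_def eigenvalue_def by auto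
  then have vc: "v \<in> carrier_vec n" "v \<noteq> 0\<^sub>v n" "A *\<^sub>v v = c \<cdot>\<^sub>v v"
    using A unfolding eigenvector_def by auto
  define g where "g = the_inv_into {..<n} h"
  have gh: "g (h i) = i" if "i < n" for i
    using that h unfolding g_def bij_betw_def by (simp add: the_inv_into_f_f)
  have surj: "\<exists>i<n. a = h i" if "a \<in> V" for a
    using that h unfolding bij_betw_def by auto
  obtain i where i: "i < n" "v $ i \<noteq> 0" using vc(1,2) by fastforce
  have 1: "\<exists>a\<in>V. v $ g a \<noteq> 0"
    using i h gh by (intro bexI[of _ "h i"]) (auto simp: bij_betw_def)
  have 2: "(\<Sum>b\<in>V. X a b * v $ g b) = c * v $ g a" if a: "a \<in> V" for a
  proof -
    obtain i where i: "i < n" "a = h i" using surj[OF a] by blast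
    have "(\<Sum>b\<in>V. X a b * v $ g b) = (\<Sum>j<n. X a (h j) * v $ g (h j))"
      using sum.reindex_bij_betw[OF h, of "\<lambda>b. X a b * v $ g b"] by simp
    also have "\<dots> = (\<Sum>j<n. X (h i) (h j) * v $ j)" using gh i by simp
    also have "\<dots> = (A *\<^sub>v v) $ i"
      using i vc(1) by (simp add: A_def scalar_prod_def atLeast0LessThan)
    also have "\<dots> = c * v $ g a" using i vc gh by simp
    finally show ?thesis .
  qed
  show thesis by (rule that[OF 1 2])
qed

lemma onb_delta: "finite V \<Longrightarrow> onb V V (\<lambda>y a. if y = a then 1 else 0)"
  unfolding onb_def ip_def by (auto simp: if_distrib[of cnj] if_distrib[of "\<lambda>x. x * _"] if_distrib[of "\<lambda>x. _ * x"] sum.delta cong: if_cong)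

text \<open>The extension is a Householder reflection, which needs the entry \<open>v x\<close> to be real.\<close>
lemma onb_extend:
  fixes x :: 'a
  assumes V: "finite V" "x \<in> V" and v: "ip V v v = 1" "Im (v x) = 0"
  obtains e where "onb V V e" "\<And>a. a \<in> V \<Longrightarrow> e x a = v a"
proof (cases "v x = 1")
  case True
  define d where "d = (\<lambda>(y::'a) a. if y = a then 1 else (0::complex))"
  have "(\<Sum>a\<in>V. (cmod (v a))\<^sup>2) = 1"
    using v(1) unfolding ip_self by (metis of_real_eq_1_iff)
  then have "(\<Sum>a\<in>V - {x}. (cmod (v a))\<^sup>2) = 0"
    using V True by (simp add: sum.remove)
  then have "\<forall>a\<in>V - {x}. v a = 0" using V by (simp add: sum_nonneg_eq_0_iff)
  then have "d x a = v a" if "a \<in> V" for a using that True by (auto simp: d_def)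
  with that[of d] onb_delta[OF V(1)] show ?thesis unfolding d_def by blast
next
  case False
  define d where "d = (\<lambda>(y::'a) a. if y = a then 1 else (0::complex))"
  define w where "w = (\<lambda>a. v a - d x a)"
  \<comment> \<open>The squared norm of \<open>w\<close>, the vector along which the reflection
    acts. It vanishes only if \<open>v x = 1\<close>, the case treated above, where \<open>v\<close>
    is already the point mass at \<open>x\<close>.\<close>
  define s where "s = 2 - 2 * v x"
  have rx: "cnj (v x) = v x" using v(2) by (simp add: complex_eq_iff)
  have s0: "s \<noteq> 0" using False unfolding s_def by simp
  have cs: "cnj s = s" unfolding s_def using rx by simp
  have dl: "ip V (d y) u = u y" "ip V u (d y) = cnj (u y)" if "y \<in> V" for y u
    using that V unfolding ip_def d_def
    by (auto simp: if_distrib[of cnj] if_distrib[of "\<lambda>x. x * _"] if_distrib[of "\<lambda>x. _ * x"] sum.delta cong: if_cong)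
  have "ip V w w = ip V v v - ip V v (d x) - ip V (d x) v + ip V (d x) (d x)"
    unfolding w_def ip_def by (simp add: algebra_simps sum.distrib sum_subtractf)
  also have "\<dots> = s" using V by (simp add: dl v rx s_def) (simp add: d_def)
  finally have ws: "ip V w w = s" .
  define e where "e = (\<lambda>y a. d y a - 2 * w a * cnj (w y) / s)"
  have e_ip: "ip V (e y) (e z) = (if y = z then 1 else 0)" if "y \<in> V" "z \<in> V" for y z
  proof -
    have "ip V (e y) (e z) = ip V (d y) (d z) - 2 * cnj (w z) / s * ip V (d y) w
        - 2 * w y / s * ip V w (d z) + (2 * w y / s) * (2 * cnj (w z) / s) * ip V w w"
      unfolding e_def ip_def
      by (simp add: cs algebra_simps sum.distrib sum_subtractf sum_distrib_left sum_divide_distrib)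
    also have "\<dots> = d z y"
      using that s0 by (simp add: dl ws field_simps) (simp add: d_def)
    finally show ?thesis by (auto simp: d_def)
  qed
  \<comment> \<open>The reflection is self-adjoint, so completeness is the orthonormality just
    proved.\<close>
  have sym: "e y a = cnj (e a y)" for y a
    unfolding e_def d_def by (auto simp: cs mult_ac)
  have "(\<Sum>i\<in>V. e i a * cnj (e i b)) = ip V (e a) (e b)" for a b
    unfolding ip_def by (intro sum.cong refl) (metis sym complex_cnj_cnj)
  then have "onb V V e" unfolding onb_def using V e_ip by simp
  moreover have "e x a = v a" if "a \<in> V" for a
  proof -
    have "2 * cnj (w x) / s = -1" using s0 by (simp add: w_def d_def rx s_def field_simps)
    then have "e x a = d x a + w a" unfolding e_def
      by (metis (no_types, lifting) diff_minus_eq_add mult.commute mult.left_commute mult_minus1_right times_divide_eq_right)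
    then show ?thesis by (simp add: w_def)
  qed
  ultimately show ?thesis by (rule that)
qed

text \<open>Deflation: a unit eigenvector becomes the \<open>x\<close>-th member of a basis. By
  hermiticity the row of \<open>x\<close> then vanishes off the diagonal together with its column,
  which leaves a Hermitian kernel on the smaller set.\<close>

theorem spectral_theorem:
  assumes "finite V" "\<And>a b. a \<in> V \<Longrightarrow> b \<in> V \<Longrightarrow> X b a = cnj (X a b)"
  obtains e \<mu> where "spec V V X e \<mu>"
proof -
  have "\<exists>e \<mu>. spec V V X e \<mu>" using assms
  proof (induction V arbitrary: X rule: finite_induct)
    case empty
    then show ?case unfolding spec_def onb_def by auto
  next
    case (insert x F)
    let ?V = "insert x F"
    have fV: "finite ?V" using insert by simp
    obtain u c where u: "\<exists>a\<in>?V. u a \<noteq> 0" "\<And>a. a \<in> ?V \<Longrightarrow> (\<Sum>b\<in>?V. X a b * u b) = c * u a"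
      using eigenvector_exists[OF fV, of X] by blast
    define r where "r = sqrt (\<Sum>a\<in>?V. (cmod (u a))\<^sup>2)"
    have "0 < (\<Sum>a\<in>?V. (cmod (u a))\<^sup>2)"
      using u(1) fV by (meson sum_pos2 zero_le_power2 zero_less_norm_iff zero_less_power)
    then have r: "r > 0" "r\<^sup>2 = (\<Sum>a\<in>?V. (cmod (u a))\<^sup>2)" by (auto simp: r_def)
    \<comment> \<open>The phase \<open>p\<close> makes the entry at \<open>x\<close> real, as the
      reflection requires; the value 1 covers a zero entry.\<close>
    define p where "p = (if u x = 0 then 1 else cnj (u x) / cmod (u x))"
    have p: "cmod p = 1" "Im (p * u x) = 0"
      by (auto simp: p_def norm_divide mult.commute complex_mult_cnj)
    define v where "v = (\<lambda>a. p / r * u a)"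
    have "(\<Sum>a\<in>?V. (cmod (v a))\<^sup>2) = (\<Sum>a\<in>?V. (cmod (u a))\<^sup>2 / r\<^sup>2)"
      unfolding v_def using r by (intro sum.cong refl) (simp add: norm_mult norm_divide p power_divide)
    also have "\<dots> = (\<Sum>a\<in>?V. (cmod (u a))\<^sup>2) / r\<^sup>2" by (rule sum_divide_distrib[symmetric])
    also have "\<dots> = 1" using r(1) unfolding r(2)[symmetric] by simp
    finally have v1: "ip ?V v v = 1" unfolding ip_self by simp
    have vx: "Im (v x) = 0" using p(2) by (simp add: v_def Im_divide_of_real)
    have Xv: "(\<Sum>b\<in>?V. X a b * v b) = c * v a" if "a \<in> ?V" for a
    proof -
      have "(\<Sum>b\<in>?V. X a b * v b) = p / r * (\<Sum>b\<in>?V. X a b * u b)"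
        unfolding v_def sum_distrib_left by (simp add: mult_ac)
      then show ?thesis unfolding u(2)[OF that] v_def by simp
    qed
    obtain e where e: "onb ?V ?V e" "\<And>a. a \<in> ?V \<Longrightarrow> e x a = v a"
      using onb_extend[OF fV _ v1 vx] by blast
    define Y where "Y = (\<lambda>i j. sesq ?V X (e i) (e j))"
    have herm: "Y j i = cnj (Y i j)" for i j
    proof -
      have "cnj (Y i j) = (\<Sum>a\<in>?V. \<Sum>b\<in>?V. cnj (e j b) * X b a * e i a)"
        unfolding Y_def sesq_def cnj_sum
        by (intro sum.cong refl) (metis (no_types, lifting) complex_cnj_mult complex_cnj_cnj insert.prems mult.commute mult.left_commute)
      then show ?thesis unfolding Y_def sesq_def by (subst (asm) sum.swap) simp
    qed
    have Yx: "Y j x = (if j = x then c else 0)" if "j \<in> ?V" for j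
    proof -
      have "Y j x = (\<Sum>a\<in>?V. cnj (e j a) * (\<Sum>b\<in>?V. X a b * v b))"
        unfolding Y_def sesq_def sum_distrib_left
        by (intro sum.cong refl) (simp add: e(2) mult.assoc)
      also have "\<dots> = (\<Sum>a\<in>?V. c * (cnj (e j a) * e x a))"
        by (intro sum.cong refl) (simp add: Xv e(2))
      also have "\<dots> = c * ip ?V (e j) (e x)" by (simp add: ip_def sum_distrib_left)
      also have "\<dots> = (if j = x then c else 0)" using onbD(3)[OF e(1)] that by simp
      finally show ?thesis .
    qed
    have xY: "Y x j = (if j = x then c else 0)" if "j \<in> ?V" for j
      using herm[of x j] Yx[OF that] herm[of x x] Yx[of x] by auto
    have cr: "of_real (Re c) = c" using herm[of x x] Yx[of x] by (simp add: complex_eq_iff)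
    obtain f \<nu> where f: "spec F F Y f \<nu>" using insert.IH[of Y] herm by blast
    note of = onbD[OF specD(1)[OF f]]
    \<comment> \<open>Basis adapted to the block form: the point mass at \<open>x\<close>, and the
      vectors of \<open>f\<close> extended by zero.\<close>
    define g where "g = (\<lambda>i j. if i = x then (if j = x then 1 else 0) else if j = x then 0 else f i j)"
    define \<mu> where "\<mu> = \<nu>(x := Re c)"
    have ne: "i \<in> F \<Longrightarrow> i \<noteq> x" for i using insert.hyps by auto
    have g1: "ip ?V (g i) (g j) = cnj (g i x) * g j x + (\<Sum>a\<in>F. cnj (g i a) * g j a)" for i j
      unfolding ip_def using insert.hyps by simp
    have g1': "(\<Sum>a\<in>F. cnj (g i a) * g j a) = (if i = x \<or> j = x then 0 else ip F (f i) (f j))" for i j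
      unfolding ip_def g_def using ne by (auto intro!: sum.neutral sum.cong)
    have g2: "(\<Sum>i\<in>F. k i * (g i a * cnj (g i b))) = (if a = x \<or> b = x then 0 else (\<Sum>i\<in>F. k i * (f i a * cnj (f i b))))" for k :: "_ \<Rightarrow> complex" and a b
      unfolding g_def using ne by (auto intro!: sum.neutral sum.cong)
    have "onb ?V ?V g"
      unfolding onb_def g1 g1'
      using fV insert.hyps ne of g2[of "\<lambda>_. 1"] by (auto simp: g_def)
    moreover have "Y a b = (\<Sum>i\<in>?V. complex_of_real (\<mu> i) * g i a * cnj (g i b))" if ab: "a \<in> ?V" "b \<in> ?V" for a b
    proof -
      have "(\<Sum>i\<in>?V. complex_of_real (\<mu> i) * g i a * cnj (g i b))
          = c * (g x a * cnj (g x b)) + (\<Sum>i\<in>F. complex_of_real (\<nu> i) * (g i a * cnj (g i b)))"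
        using insert.hyps ne by (simp add: \<mu>_def cr mult.assoc)
      also have "\<dots> = Y a b"
        unfolding g2 using ab Yx xY ne specD(2)[OF f, of a b]
        by (cases "a = x"; cases "b = x") (simp_all add: g_def mult.assoc)
      finally show ?thesis by simp
    qed
    ultimately have "spec ?V ?V Y g \<mu>" unfolding spec_def by blast
    then show ?case using spec_change[OF e(1)] unfolding Y_def by blast
  qed
  then show ?thesis using that by blast
qed

section \<open>Resolvent form of the relative entropy\<close>

definition res_form ::
  "'a set \<Rightarrow> ('a \<Rightarrow> 'a \<Rightarrow> complex) \<Rightarrow> ('a \<Rightarrow> 'a \<Rightarrow> complex) \<Rightarrow> real \<Rightarrow> ('a \<Rightarrow> 'a \<Rightarrow> complex) \<Rightarrow> real" where
  "res_form V \<rho> \<sigma> t Z = 2 * Re (\<Sum>a\<in>V. \<Sum>b\<in>V. cnj (Z a b) * \<rho> a b)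
     - Re (\<Sum>b\<in>V. sesq V \<sigma> (\<lambda>a. Z a b) (\<lambda>a. Z a b))
     - t * Re (\<Sum>a\<in>V. sesq V \<rho> (\<lambda>b. cnj (Z a b)) (\<lambda>b. cnj (Z a b)))"

text \<open>The Hilbert-Schmidt inner product of \<open>\<rho>\<close> with (L + t R)^-1
  \<open>\<rho>\<close>, where L is left multiplication by \<open>\<sigma>\<close> and R is right
  multiplication by \<open>\<rho>\<close>: the operators |r_j><w_i| are joint eigenvectors of L and
  R, with eigenvalues \<open>\<mu> j\<close> and \<open>\<nu> i\<close>. For nonnegative eigenvalues
  and t > 0, a zero denominator forces a zero numerator, and the HOL quotient 0 is the right
  value.\<close>

definition res_sum ::
  "'j set \<Rightarrow> 'i set \<Rightarrow> 'a set \<Rightarrow> ('j \<Rightarrow> 'a \<Rightarrow> complex) \<Rightarrow> ('i \<Rightarrow> 'a \<Rightarrow> complex) \<Rightarrow> ('j \<Rightarrow> real) \<Rightarrow> ('i \<Rightarrow> real) \<Rightarrow> real \<Rightarrow> real" where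
  "res_sum J I V r w \<mu> \<nu> t =
     (\<Sum>j\<in>J. \<Sum>i\<in>I. (\<nu> i)\<^sup>2 * (cmod (ip V (r j) (w i)))\<^sup>2 / (\<mu> j + t * \<nu> i))"

text \<open>The quadratic form is diagonal in the operator basis |r_j><w_i|, in which
  \<open>z j i\<close> is the coefficient of \<open>Z\<close>. Each term is brought to this basis by
  expanding its operator spectrally and applying Parseval in the other index.\<close>

lemma res_form_expand:
  fixes Z :: "'a \<Rightarrow> 'a \<Rightarrow> complex"
  assumes w: "spec I V \<rho> w \<nu>" and r: "spec J V \<sigma> r \<mu>"
  defines "z \<equiv> \<lambda>j i. ip V (r j) (\<lambda>a. \<Sum>b\<in>V. Z a b * w i b)"
  shows "res_form V \<rho> \<sigma> t Z =
    (\<Sum>j\<in>J. \<Sum>i\<in>I. 2 * \<nu> i * Re (cnj (z j i) * ip V (r j) (w i)) - (\<mu> j + t * \<nu> i) * (cmod (z j i))\<^sup>2)"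
proof -
  define Zw where "Zw = (\<lambda>i a. \<Sum>b\<in>V. Z a b * w i b)"
  have z: "z j i = ip V (r j) (Zw i)" for j i unfolding z_def Zw_def ..
  note onb_w = specD(1)[OF w] and onb_r = specD(1)[OF r]
  have "(\<Sum>a\<in>V. \<Sum>b\<in>V. cnj (Z a b) * \<rho> a b)
      = (\<Sum>a\<in>V. \<Sum>b\<in>V. \<Sum>i\<in>I. of_real (\<nu> i) * (w i a * cnj (Z a b * w i b)))"
    by (intro sum.cong refl) (simp add: specD(2)[OF w] sum_distrib_left mult_ac)
  also have "\<dots> = (\<Sum>a\<in>V. \<Sum>i\<in>I. \<Sum>b\<in>V. of_real (\<nu> i) * (w i a * cnj (Z a b * w i b)))"
    by (intro sum.cong refl sum.swap)
  also have "\<dots> = (\<Sum>i\<in>I. \<Sum>a\<in>V. \<Sum>b\<in>V. of_real (\<nu> i) * (w i a * cnj (Z a b * w i b)))"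
    by (rule sum.swap)
  also have "\<dots> = (\<Sum>i\<in>I. of_real (\<nu> i) * ip V (Zw i) (w i))"
    unfolding ip_def Zw_def by (simp add: sum_distrib_left mult_ac)
  also have "\<dots> = (\<Sum>i\<in>I. of_real (\<nu> i) * (\<Sum>j\<in>J. cnj (z j i) * ip V (r j) (w i)))"
    unfolding z parseval[OF onb_r] ..
  also have "\<dots> = (\<Sum>j\<in>J. \<Sum>i\<in>I. of_real (\<nu> i) * (cnj (z j i) * ip V (r j) (w i)))"
    unfolding sum_distrib_left by (rule sum.swap)
  finally have T1: "2 * Re (\<Sum>a\<in>V. \<Sum>b\<in>V. cnj (Z a b) * \<rho> a b)
      = (\<Sum>j\<in>J. \<Sum>i\<in>I. 2 * \<nu> i * Re (cnj (z j i) * ip V (r j) (w i)))"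
    by (simp only: Re_sum Re_complex_of_real Re_divide_of_real sum_distrib_left)
      (simp add: mult.assoc)
  have 2: "(\<Sum>b\<in>V. (cmod (ip V (r j) (\<lambda>a. Z a b)))\<^sup>2) = (\<Sum>i\<in>I. (cmod (z j i))\<^sup>2)" for j
  proof -
    have "ip V (\<lambda>b. cnj (w i b)) (\<lambda>b. ip V (r j) (\<lambda>a. Z a b)) = z j i" for i
      unfolding z Zw_def ip_def sum_distrib_left
      by (subst sum.swap) (simp add: mult_ac)
    then show ?thesis
      using parseval_norm[OF onb_cnj[OF onb_w], of "\<lambda>b. ip V (r j) (\<lambda>a. Z a b)"] by simp
  qed
  have "Re (\<Sum>b\<in>V. sesq V \<sigma> (\<lambda>a. Z a b) (\<lambda>a. Z a b))
      = (\<Sum>b\<in>V. \<Sum>j\<in>J. \<mu> j * (cmod (ip V (r j) (\<lambda>a. Z a b)))\<^sup>2)"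
    unfolding sesq_spec_norm[OF r] by simp
  also have "\<dots> = (\<Sum>j\<in>J. \<mu> j * (\<Sum>b\<in>V. (cmod (ip V (r j) (\<lambda>a. Z a b)))\<^sup>2))"
    by (subst sum.swap) (simp add: sum_distrib_left)
  finally have T2: "Re (\<Sum>b\<in>V. sesq V \<sigma> (\<lambda>a. Z a b) (\<lambda>a. Z a b))
      = (\<Sum>j\<in>J. \<Sum>i\<in>I. \<mu> j * (cmod (z j i))\<^sup>2)"
    unfolding 2 by (simp add: sum_distrib_left)
  have 3: "cmod (ip V (w i) (\<lambda>b. cnj (Z a b))) = cmod (Zw i a)" for i a
  proof -
    have "ip V (w i) (\<lambda>b. cnj (Z a b)) = cnj (Zw i a)"
      by (simp add: ip_def Zw_def mult.commute)
    then show ?thesis by simp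
  qed
  have "Re (\<Sum>a\<in>V. sesq V \<rho> (\<lambda>b. cnj (Z a b)) (\<lambda>b. cnj (Z a b)))
      = (\<Sum>a\<in>V. \<Sum>i\<in>I. \<nu> i * (cmod (Zw i a))\<^sup>2)"
    unfolding sesq_spec_norm[OF w] 3 by simp
  also have "\<dots> = (\<Sum>i\<in>I. \<nu> i * (\<Sum>a\<in>V. (cmod (Zw i a))\<^sup>2))"
    by (subst sum.swap) (simp add: sum_distrib_left)
  also have "\<dots> = (\<Sum>i\<in>I. \<nu> i * (\<Sum>j\<in>J. (cmod (z j i))\<^sup>2))"
    unfolding z parseval_norm[OF onb_r] ..
  also have "\<dots> = (\<Sum>j\<in>J. \<Sum>i\<in>I. \<nu> i * (cmod (z j i))\<^sup>2)"
    unfolding sum_distrib_left by (rule sum.swap)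
  finally have T3: "Re (\<Sum>a\<in>V. sesq V \<rho> (\<lambda>b. cnj (Z a b)) (\<lambda>b. cnj (Z a b)))
      = (\<Sum>j\<in>J. \<Sum>i\<in>I. \<nu> i * (cmod (z j i))\<^sup>2)" .
  show ?thesis unfolding res_form_def T1 T2 T3
    by (simp add: sum_distrib_left sum_subtractf sum.distrib algebra_simps)
qed

lemma res_form_le_sum:
  assumes w: "spec I V \<rho> w \<nu>" and r: "spec J V \<sigma> r \<mu>" and t: "t > 0"
    and nn: "\<And>i. i \<in> I \<Longrightarrow> 0 \<le> \<nu> i" "\<And>j. j \<in> J \<Longrightarrow> 0 \<le> \<mu> j"
  shows "res_form V \<rho> \<sigma> t Z \<le> res_sum J I V r w \<mu> \<nu> t"
  unfolding res_form_expand[OF w r] res_sum_def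
proof (intro sum_mono)
  fix j i assume ji: "j \<in> J" "i \<in> I"
  define z where "z = ip V (r j) (\<lambda>a. \<Sum>b\<in>V. Z a b * w i b)"
  define x where "x = ip V (r j) (w i)"
  define s where "s = \<mu> j + t * \<nu> i"
  have "Re (cnj z * x) \<le> cmod z * cmod x"
    using complex_Re_le_cmod[of "cnj z * x"] by (simp add: norm_mult)
  then have le: "2 * \<nu> i * Re (cnj z * x) \<le> 2 * \<nu> i * (cmod z * cmod x)"
    using nn(1)[OF ji(2)] by (intro mult_left_mono) auto
  have "s \<ge> 0" using nn ji t by (simp add: s_def)
  moreover have "2 * \<nu> i * Re (cnj z * x) - s * (cmod z)\<^sup>2 \<le> (\<nu> i)\<^sup>2 * (cmod x)\<^sup>2 / s"
  proof (cases "s = 0")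
    case True
    then have "\<nu> i = 0" using nn ji t unfolding s_def
      by (smt (verit) mult_nonneg_nonneg mult_eq_0_iff)
    then show ?thesis using True by simp
  next
    case False
    then have s: "s > 0" using \<open>s \<ge> 0\<close> by simp
    have "0 \<le> (\<nu> i * cmod x - s * cmod z)\<^sup>2" by simp
    also have "\<dots> = s * ((\<nu> i)\<^sup>2 * (cmod x)\<^sup>2 / s - (2 * \<nu> i * (cmod z * cmod x) - s * (cmod z)\<^sup>2))"
      using s by (simp add: power2_eq_square field_simps)
    finally have "0 \<le> (\<nu> i)\<^sup>2 * (cmod x)\<^sup>2 / s - (2 * \<nu> i * (cmod z * cmod x) - s * (cmod z)\<^sup>2)"
      using s zero_le_mult_iff[of s] by (meson less_le_not_le)
    with le show ?thesis by linarith
  qed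
  ultimately show "2 * \<nu> i * Re (cnj (ip V (r j) (\<lambda>a. \<Sum>b\<in>V. Z a b * w i b)) * ip V (r j) (w i)) -
      (\<mu> j + t * \<nu> i) * (cmod (ip V (r j) (\<lambda>a. \<Sum>b\<in>V. Z a b * w i b)))\<^sup>2
      \<le> (\<nu> i)\<^sup>2 * (cmod (ip V (r j) (w i)))\<^sup>2 / (\<mu> j + t * \<nu> i)"
    unfolding z_def x_def s_def by blast
qed

lemma res_form_attained:
  assumes w: "spec I V \<rho> w \<nu>" and r: "spec J V \<sigma> r \<mu>"
  obtains Z where "res_form V \<rho> \<sigma> t Z = res_sum J I V r w \<mu> \<nu> t"
proof -
  note ow = onbD[OF specD(1)[OF w]] and or = onbD[OF specD(1)[OF r]]
  \<comment> \<open>These coefficients give equality in the completed square, and \<open>Z\<close>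
    is the operator having them in the basis |r_j><w_i|. At a zero denominator both the coefficient
    and the target summand are 0.\<close>
  define c where "c = (\<lambda>j i. of_real (\<nu> i / (\<mu> j + t * \<nu> i)) * ip V (r j) (w i))"
  define Z where "Z = (\<lambda>a b. \<Sum>j\<in>J. (\<Sum>i\<in>I. c j i * cnj (w i b)) * r j a)"
  have z: "ip V (r j) (\<lambda>a. \<Sum>b\<in>V. Z a b * w i b) = c j i" if ji: "j \<in> J" "i \<in> I" for j i
  proof -
    have "(\<Sum>b\<in>V. (\<Sum>i\<in>I. c j i * cnj (w i b)) * w i b) = c j i" for j
    proof -
      have "(\<Sum>b\<in>V. (\<Sum>k\<in>I. c j k * cnj (w k b)) * w i b) = (\<Sum>k\<in>I. c j k * ip V (w k) (w i))"
        unfolding ip_def sum_distrib_left sum_distrib_right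
        by (subst sum.swap) (simp add: mult_ac)
      also have "\<dots> = (\<Sum>k\<in>I. if k = i then c j i else 0)"
        by (intro sum.cong refl) (simp add: ow ji)
      finally show ?thesis using ji ow by simp
    qed
    moreover have "(\<Sum>b\<in>V. Z a b * w i b) = (\<Sum>j\<in>J. (\<Sum>b\<in>V. (\<Sum>i\<in>I. c j i * cnj (w i b)) * w i b) * r j a)" for a
      unfolding Z_def sum_distrib_right by (subst sum.swap) (simp add: mult_ac sum_distrib_left)
    ultimately have "(\<Sum>b\<in>V. Z a b * w i b) = (\<Sum>j\<in>J. c j i * r j a)" for a by simp
    then have "ip V (r j) (\<lambda>a. \<Sum>b\<in>V. Z a b * w i b) = (\<Sum>k\<in>J. c k i * ip V (r j) (r k))"
      by (simp add: ip_sum_right)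
    also have "\<dots> = (\<Sum>k\<in>J. if j = k then c k i else 0)"
      by (intro sum.cong refl) (simp add: or ji)
    finally show ?thesis using ji or by simp
  qed
  have "res_form V \<rho> \<sigma> t Z = res_sum J I V r w \<mu> \<nu> t"
    unfolding res_form_expand[OF w r] res_sum_def
  proof (intro sum.cong refl)
    fix j i assume ji: "j \<in> J" "i \<in> I"
    define x where "x = ip V (r j) (w i)"
    define s where "s = \<mu> j + t * \<nu> i"
    have "cnj (c j i) * x = of_real (\<nu> i / s * (cmod x)\<^sup>2)"
      unfolding c_def x_def[symmetric] s_def[symmetric] of_real_mult complex_norm_square by simp
    then have 1: "Re (cnj (c j i) * x) = \<nu> i / s * (cmod x)\<^sup>2" by (metis Re_complex_of_real)
    have 2: "(cmod (c j i))\<^sup>2 = (\<nu> i / s)\<^sup>2 * (cmod x)\<^sup>2"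
      unfolding c_def x_def[symmetric] s_def[symmetric] by (simp add: norm_mult power_mult_distrib norm_divide power_divide)
    have "2 * \<nu> i * Re (cnj (c j i) * x) - s * (cmod (c j i))\<^sup>2 = (\<nu> i)\<^sup>2 * (cmod x)\<^sup>2 / s"
      unfolding 1 2 by (cases "s = 0") (simp_all add: power2_eq_square field_simps)
    then show "2 * \<nu> i * Re (cnj (ip V (r j) (\<lambda>a. \<Sum>b\<in>V. Z a b * w i b)) * ip V (r j) (w i)) -
        (\<mu> j + t * \<nu> i) * (cmod (ip V (r j) (\<lambda>a. \<Sum>b\<in>V. Z a b * w i b)))\<^sup>2
        = (\<nu> i)\<^sup>2 * (cmod (ip V (r j) (w i)))\<^sup>2 / (\<mu> j + t * \<nu> i)"
      unfolding z[OF ji] x_def s_def .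
  qed
  then show thesis by (rule that)
qed

text \<open>A block-diagonal \<open>Z\<close> pairs only equal block labels, so none of the three
  terms reads an off-diagonal block of \<open>\<rho>\<close> or \<open>\<sigma>\<close>.\<close>

lemma res_form_block:
  fixes Z :: "'k \<Rightarrow> 'a \<Rightarrow> 'a \<Rightarrow> complex"
  assumes "finite K" "finite A"
  shows "res_form (K \<times> A) \<rho> \<sigma> t (\<lambda>x y. if fst x = fst y then Z (fst x) (snd x) (snd y) else 0)
    = (\<Sum>k\<in>K. res_form A (\<lambda>a b. \<rho> (k,a) (k,b)) (\<lambda>a b. \<sigma> (k,a) (k,b)) t (Z k))"
proof -
  have cp: "(\<Sum>x\<in>K \<times> A. g x) = (\<Sum>k\<in>K. \<Sum>a\<in>A. g (k, a))" for g :: "_ \<Rightarrow> complex"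
    by (simp add: sum.cartesian_product split_def)
  have dl: "(\<Sum>l\<in>K. \<Sum>b\<in>A. if k = l then g l b else 0) = (\<Sum>b\<in>A. g k b)"
    if "k \<in> K" for k and g :: "'k \<Rightarrow> 'a \<Rightarrow> complex"
    using assms that by (subst sum.swap) simp
  have dl': "(\<Sum>l\<in>K. \<Sum>b\<in>A. if l = k then g l b else 0) = (\<Sum>b\<in>A. g k b)"
    if "k \<in> K" for k and g :: "'k \<Rightarrow> 'a \<Rightarrow> complex"
    using assms that by (subst sum.swap) simp
  have dl3: "(\<Sum>l\<in>K. \<Sum>a\<in>A. \<Sum>b\<in>A. if l = k then g l a b else 0) = (\<Sum>a\<in>A. \<Sum>b\<in>A. g k a b)"
    if "k \<in> K" for k and g :: "'k \<Rightarrow> 'a \<Rightarrow> 'a \<Rightarrow> complex"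
  proof -
    have "(\<Sum>l\<in>K. \<Sum>a\<in>A. \<Sum>b\<in>A. if l = k then g l a b else 0)
        = (\<Sum>l\<in>K. \<Sum>a\<in>A. if l = k then \<Sum>b\<in>A. g l a b else 0)"
      by (intro sum.cong refl) auto
    then show ?thesis using dl'[OF that, of "\<lambda>l a. \<Sum>b\<in>A. g l a b"] by simp
  qed
  have 1: "(\<Sum>x\<in>K \<times> A. \<Sum>y\<in>K \<times> A. cnj (if fst x = fst y then Z (fst x) (snd x) (snd y) else 0) * \<rho> x y)
    = (\<Sum>k\<in>K. \<Sum>a\<in>A. \<Sum>b\<in>A. cnj (Z k a b) * \<rho> (k,a) (k,b))"
    unfolding cp
    by (intro sum.cong refl) (simp add: dl if_distrib[of cnj] if_distrib[of "\<lambda>x. x * _"] cong: if_cong)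
  have 2: "sesq (K \<times> A) X (\<lambda>x. if fst x = k then u (fst x) (snd x) else 0) (\<lambda>x. if fst x = k then u (fst x) (snd x) else 0)
      = sesq A (\<lambda>a b. X (k,a) (k,b)) (u k) (u k)" if "k \<in> K" for k X and u :: "'k \<Rightarrow> 'a \<Rightarrow> complex"
    unfolding sesq_def cp
    using that by (simp add: dl' dl3 if_distrib[of cnj] if_distrib[of "\<lambda>x. x * _"] if_distrib[of "\<lambda>x. _ * x"] cong: if_cong)
  have 3: "(\<Sum>y\<in>K \<times> A. sesq (K \<times> A) \<sigma> (\<lambda>x. if fst x = fst y then Z (fst x) (snd x) (snd y) else 0)
       (\<lambda>x. if fst x = fst y then Z (fst x) (snd x) (snd y) else 0))
    = (\<Sum>k\<in>K. \<Sum>b\<in>A. sesq A (\<lambda>a b. \<sigma> (k,a) (k,b)) (\<lambda>a. Z k a b) (\<lambda>a. Z k a b))"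
    unfolding cp using 2[of _ \<sigma> "\<lambda>k a. Z k a _"] by simp
  have 4: "(\<Sum>x\<in>K \<times> A. sesq (K \<times> A) \<rho> (\<lambda>y. cnj (if fst x = fst y then Z (fst x) (snd x) (snd y) else 0))
       (\<lambda>y. cnj (if fst x = fst y then Z (fst x) (snd x) (snd y) else 0)))
    = (\<Sum>k\<in>K. \<Sum>a\<in>A. sesq A (\<lambda>a b. \<rho> (k,a) (k,b)) (\<lambda>b. cnj (Z k a b)) (\<lambda>b. cnj (Z k a b)))"
  proof -
    have "(\<lambda>y. cnj (if k = fst y then Z k a (snd y) else 0)) = (\<lambda>y. if fst y = k then cnj (Z (fst y) a (snd y)) else 0)" for k a
      by auto
    then show ?thesis unfolding cp fst_conv snd_conv using 2[of _ \<rho> "\<lambda>k b. cnj (Z k _ b)"] by simp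
  qed
  show ?thesis unfolding res_form_def 1 3 4
    by (simp add: sum_subtractf sum_distrib_left)
qed

text \<open>\<open>res_sum\<close> is the maximum of \<open>res_form\<close> over \<open>Z\<close>, and on block-diagonal \<open>Z\<close> the form splits
  into its restrictions to the blocks.\<close>
lemma res_sum_block:
  fixes w :: "'i \<Rightarrow> 'k \<times> 'a \<Rightarrow> complex"
  assumes K: "finite K" "finite A" and t: "t > 0"
    and w: "spec I (K \<times> A) \<rho> w \<nu>" and r: "spec J (K \<times> A) \<sigma> r \<mu>"
    and nn: "\<And>i. i \<in> I \<Longrightarrow> 0 \<le> \<nu> i" "\<And>j. j \<in> J \<Longrightarrow> 0 \<le> \<mu> j"
    and wk: "\<And>k. k \<in> K \<Longrightarrow> spec I' A (\<lambda>a b. \<rho> (k,a) (k,b)) (w' k) (\<nu>' k)"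
    and rk: "\<And>k. k \<in> K \<Longrightarrow> spec J' A (\<lambda>a b. \<sigma> (k,a) (k,b)) (r' k) (\<mu>' k)"
  shows "(\<Sum>k\<in>K. res_sum J' I' A (r' k) (w' k) (\<mu>' k) (\<nu>' k) t) \<le> res_sum J I (K \<times> A) r w \<mu> \<nu> t"
proof -
  have "\<exists>Z. res_form A (\<lambda>a b. \<rho> (k,a) (k,b)) (\<lambda>a b. \<sigma> (k,a) (k,b)) t Z
      = res_sum J' I' A (r' k) (w' k) (\<mu>' k) (\<nu>' k) t" if "k \<in> K" for k
    using res_form_attained[OF wk[OF that] rk[OF that]] by metis
  then obtain Z where Z: "\<And>k. k \<in> K \<Longrightarrow> res_form A (\<lambda>a b. \<rho> (k,a) (k,b)) (\<lambda>a b. \<sigma> (k,a) (k,b)) t (Z k)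
      = res_sum J' I' A (r' k) (w' k) (\<mu>' k) (\<nu>' k) t" by metis
  have "(\<Sum>k\<in>K. res_sum J' I' A (r' k) (w' k) (\<mu>' k) (\<nu>' k) t)
      = res_form (K \<times> A) \<rho> \<sigma> t (\<lambda>x y. if fst x = fst y then Z (fst x) (snd x) (snd y) else 0)"
    unfolding res_form_block[OF K] using Z by simp
  also have "\<dots> \<le> res_sum J I (K \<times> A) r w \<mu> \<nu> t"
    by (rule res_form_le_sum[OF w r t nn])
  finally show ?thesis .
qed

section \<open>Monotonicity of the relative entropy\<close>

text \<open>The improper integral is replaced by an antiderivative: \<open>g\<close> vanishes at 0
  and has nonnegative derivative by \<open>le\<close>, hence is nonnegative at every T > 0. As T
  grows, each logarithm diverges like ln T; \<open>eq\<close> cancels this divergence, and the limit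
  of the remainder is the claim.\<close>

lemma ln_sum_mono_of_resolvent_aux:
  fixes u a b :: "'p \<Rightarrow> real" and v c d :: "'q \<Rightarrow> real"
  assumes fin: "finite P" "finite Q"
    and P: "\<And>p. p \<in> P \<Longrightarrow> 0 < a p \<and> 0 < b p" and Q: "\<And>q. q \<in> Q \<Longrightarrow> 0 < c q \<and> 0 < d q"
    and le: "\<And>t. t > 0 \<Longrightarrow> (\<Sum>q\<in>Q. v q * c q / (d q + t * c q)) \<le> (\<Sum>p\<in>P. u p * a p / (b p + t * a p))"
    and eq: "(\<Sum>q\<in>Q. v q) = (\<Sum>p\<in>P. u p)"
  shows "(\<Sum>q\<in>Q. v q * (ln (c q) - ln (d q))) \<le> (\<Sum>p\<in>P. u p * (ln (a p) - ln (b p)))"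
proof -
  define g where "g = (\<lambda>t. (\<Sum>p\<in>P. u p * (ln (b p + t * a p) - ln (b p))) - (\<Sum>q\<in>Q. v q * (ln (d q + t * c q) - ln (d q))))"
  define g' where "g' = (\<lambda>t. (\<Sum>p\<in>P. u p * (a p / (b p + t * a p))) - (\<Sum>q\<in>Q. v q * (c q / (d q + t * c q))))"
  have posP: "0 < b p + t * a p" if "p \<in> P" "t \<ge> 0" for p t
    using P[OF that(1)] that(2) by (simp add: add_pos_nonneg)
  have posQ: "0 < d q + t * c q" if "q \<in> Q" "t \<ge> 0" for q t
    using Q[OF that(1)] that(2) by (simp add: add_pos_nonneg)
  have der: "(g has_real_derivative g' t) (at t)" if "t \<ge> 0" for t
    unfolding g_def g'_def
    by (rule derivative_eq_intros refl
        | (drule posP[OF _ that] posQ[OF _ that], simp; fail))+ (simp add: posP posQ that mult.commute)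
  have gT: "0 \<le> g T" if "T > 0" for T
  proof -
    have "g 0 \<le> g T"
    proof (rule DERIV_nonneg_imp_increasing_open[where f = g and a = 0 and b = T])
      show "0 \<le> T" using that by simp
      show "\<exists>y. (g has_real_derivative y) (at x) \<and> 0 \<le> y" if "0 < x" "x < T" for x
      proof -
        have "0 \<le> g' x" using le[OF that(1)] by (simp add: g'_def)
        then show ?thesis using der[of x] that by auto
      qed
      show "continuous_on {0..T} g"
        by (rule continuous_at_imp_continuous_on) (meson der DERIV_isCont atLeastAtMost_iff)
    qed
    then show ?thesis by (simp add: g_def)
  qed
  \<comment> \<open>\<open>h\<close> is \<open>g\<close> with T factored out of each logarithm, so
    that only terms with a limit remain.\<close>
  define h where "h = (\<lambda>t. (\<Sum>p\<in>P. u p * (ln (b p / t + a p) - ln (b p))) - (\<Sum>q\<in>Q. v q * (ln (d q / t + c q) - ln (d q))))"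
  have gh: "g T = h T" if T: "T > 0" for T
  proof -
    have lnT: "ln (x + T * y) = ln T + ln (x / T + y)" if "0 < x" "0 < y" for x y :: real
    proof -
      have "x + T * y = T * (x / T + y)" using T by (simp add: field_simps)
      moreover have "x / T + y > 0" using T that by (simp add: add_pos_pos)
      ultimately show ?thesis using T by (simp add: ln_mult)
    qed
    have "(\<Sum>p\<in>P. u p * (ln (b p + T * a p) - ln (b p))) = (\<Sum>p\<in>P. u p * ln T + u p * (ln (b p / T + a p) - ln (b p)))"
      and "(\<Sum>q\<in>Q. v q * (ln (d q + T * c q) - ln (d q))) = (\<Sum>q\<in>Q. v q * ln T + v q * (ln (d q / T + c q) - ln (d q)))"
      by (rule sum.cong[OF refl], simp add: lnT P ring_distribs,
          rule sum.cong[OF refl], simp add: lnT Q ring_distribs)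
    then show ?thesis unfolding g_def h_def sum.distrib
      using eq by (simp flip: sum_distrib_right)
  qed
  have tz: "((\<lambda>t::real. x / t + y) \<longlongrightarrow> y) at_top" for x y :: real
    using tendsto_add[OF tendsto_divide_0[OF tendsto_const filterlim_at_top_imp_at_infinity[OF filterlim_ident]] tendsto_const, of x y] by simp
  have "(h \<longlongrightarrow> (\<Sum>p\<in>P. u p * (ln (a p) - ln (b p))) - (\<Sum>q\<in>Q. v q * (ln (c q) - ln (d q)))) at_top"
    unfolding h_def
    by (intro tendsto_diff tendsto_sum tendsto_mult tendsto_const tendsto_ln tz) (use P Q in force)+
  moreover have "eventually (\<lambda>t. 0 \<le> h t) at_top"
    using eventually_gt_at_top[of 0] by eventually_elim (use gT gh in auto)
  ultimately have "0 \<le> (\<Sum>p\<in>P. u p * (ln (a p) - ln (b p))) - (\<Sum>q\<in>Q. v q * (ln (c q) - ln (d q)))"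
    by (intro tendsto_lowerbound) auto
  then show ?thesis by simp
qed

text \<open>Integration in \<open>t\<close> of the hypothesis, using
  \<open>\<integral> (a / (b + t a) - 1 / (1 + t)) dt = ln a - ln b\<close> over \<open>t \<ge> 0\<close>.\<close>
lemma ln_sum_mono_of_resolvent:
  fixes u a b :: "'p \<Rightarrow> real" and v c d :: "'q \<Rightarrow> real"
  assumes fin: "finite P" "finite Q"
    and P: "\<And>p. p \<in> P \<Longrightarrow> u p \<noteq> 0 \<Longrightarrow> 0 < a p \<and> 0 < b p"
    and Q: "\<And>q. q \<in> Q \<Longrightarrow> v q \<noteq> 0 \<Longrightarrow> 0 < c q \<and> 0 < d q"
    and le: "\<And>t. t > 0 \<Longrightarrow> (\<Sum>q\<in>Q. v q * c q / (d q + t * c q)) \<le> (\<Sum>p\<in>P. u p * a p / (b p + t * a p))"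
    and eq: "(\<Sum>q\<in>Q. v q) = (\<Sum>p\<in>P. u p)"
  shows "(\<Sum>q\<in>Q. v q * (ln (c q) - ln (d q))) \<le> (\<Sum>p\<in>P. u p * (ln (a p) - ln (b p)))"
proof -
  \<comment> \<open>Positivity is known only where the weight is nonzero; terms of weight zero drop
    out of every sum.\<close>
  let ?P = "{p\<in>P. u p \<noteq> 0}" and ?Q = "{q\<in>Q. v q \<noteq> 0}"
  have rP: "(\<Sum>p\<in>P. u p * f p) = (\<Sum>p\<in>?P. u p * f p)" "(\<Sum>p\<in>P. u p) = (\<Sum>p\<in>?P. u p)" for f
    by (rule sum.mono_neutral_right; use fin in auto)+
  have rQ: "(\<Sum>q\<in>Q. v q * f q) = (\<Sum>q\<in>?Q. v q * f q)" "(\<Sum>q\<in>Q. v q) = (\<Sum>q\<in>?Q. v q)" for f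
    by (rule sum.mono_neutral_right; use fin in auto)+
  show ?thesis unfolding rP rQ
  proof (rule ln_sum_mono_of_resolvent_aux)
    show "(\<Sum>q\<in>?Q. v q * c q / (d q + t * c q)) \<le> (\<Sum>p\<in>?P. u p * a p / (b p + t * a p))" if "t > 0" for t
      using le[OF that] rP(1)[of "\<lambda>p. a p / (b p + t * a p)"] rQ(1)[of "\<lambda>q. c q / (d q + t * c q)"] by simp
    show "sum v ?Q = sum u ?P" using eq rP(2) rQ(2) by simp
  qed (use fin P Q in auto)
qed

lemma onb_unit:
  assumes "onb I V e" "i \<in> I"
  shows "(\<Sum>a\<in>V. (cmod (e i a))\<^sup>2) = 1"
  using onbD(3)[OF assms(1,2,2)] unfolding ip_self by (metis of_real_eq_1_iff)

text \<open>If \<open>r\<close> and \<open>\<mu>\<close> diagonalize \<sigma>, this is the relative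
  entropy tr \<rho> (ln \<rho> - ln \<sigma>). The weights form a measure on pairs: summing over
  \<open>j\<close> returns \<open>\<nu> i\<close> by Parseval, summing over \<open>i\<close> returns
  the expectation of \<open>\<rho>\<close> in \<open>r j\<close>.\<close>

lemma rel_entropy_eval:
  assumes w: "spec I V \<rho> w \<nu>" and r: "onb J V r"
  shows "(\<Sum>j\<in>J. \<Sum>i\<in>I. \<nu> i * (cmod (ip V (r j) (w i)))\<^sup>2 * (ln (\<nu> i) - ln (\<mu> j)))
    = (\<Sum>i\<in>I. \<nu> i * ln (\<nu> i)) - (\<Sum>j\<in>J. Re (sesq V \<rho> (r j) (r j)) * ln (\<mu> j))"
proof -
  have "(\<Sum>j\<in>J. \<Sum>i\<in>I. \<nu> i * (cmod (ip V (r j) (w i)))\<^sup>2 * ln (\<nu> i))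
      = (\<Sum>i\<in>I. \<nu> i * ln (\<nu> i) * (\<Sum>j\<in>J. (cmod (ip V (r j) (w i)))\<^sup>2))"
    by (subst sum.swap) (simp add: sum_distrib_left mult_ac)
  also have "\<dots> = (\<Sum>i\<in>I. \<nu> i * ln (\<nu> i))"
    by (intro sum.cong refl) (simp add: parseval_norm[OF r] onb_unit[OF specD(1)[OF w]])
  finally have 1: "(\<Sum>j\<in>J. \<Sum>i\<in>I. \<nu> i * (cmod (ip V (r j) (w i)))\<^sup>2 * ln (\<nu> i)) = (\<Sum>i\<in>I. \<nu> i * ln (\<nu> i))" .
  have sw: "cmod (ip V (r j) (w i)) = cmod (ip V (w i) (r j))" for i j
    by (metis cnj_ip complex_mod_cnj)
  have 2: "(\<Sum>i\<in>I. \<nu> i * (cmod (ip V (r j) (w i)))\<^sup>2) = Re (sesq V \<rho> (r j) (r j))" for j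
    unfolding sesq_spec_norm[OF w] sw by simp
  show ?thesis using 1
    by (simp add: right_diff_distrib sum_subtractf flip: 2)
      (simp add: sum_distrib_right)
qed

text \<open>Monotonicity of the relative entropy when both arguments are pinched to their diagonal
  blocks. The assumptions \<open>supp\<close> and \<open>supp'\<close> put the support of
  \<open>\<rho>\<close> inside that of \<open>\<sigma>\<close>, before and after pinching; otherwise
  the HOL value of \<open>ln\<close> at 0 would stand in for an infinite relative entropy.\<close>

lemma rel_entropy_block:
  fixes w :: "'i \<Rightarrow> 'k \<times> 'a \<Rightarrow> complex"
  assumes K: "finite K" "finite A"
    and w: "spec I (K \<times> A) \<rho> w \<nu>" and r: "spec J (K \<times> A) \<sigma> r \<mu>"
    and nn: "\<And>i. i \<in> I \<Longrightarrow> 0 \<le> \<nu> i" "\<And>j. j \<in> J \<Longrightarrow> 0 \<le> \<mu> j"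
    and wk: "\<And>k. k \<in> K \<Longrightarrow> spec I' A (\<lambda>a b. \<rho> (k,a) (k,b)) (w' k) (\<nu>' k)"
    and rk: "\<And>k. k \<in> K \<Longrightarrow> spec J' A (\<lambda>a b. \<sigma> (k,a) (k,b)) (r' k) (\<mu>' k)"
    and nn': "\<And>k i. k \<in> K \<Longrightarrow> i \<in> I' \<Longrightarrow> 0 \<le> \<nu>' k i" "\<And>k j. k \<in> K \<Longrightarrow> j \<in> J' \<Longrightarrow> 0 \<le> \<mu>' k j"
    and supp: "\<And>j. j \<in> J \<Longrightarrow> \<mu> j = 0 \<Longrightarrow> Re (sesq (K \<times> A) \<rho> (r j) (r j)) = 0"
    and supp': "\<And>k j. k \<in> K \<Longrightarrow> j \<in> J' \<Longrightarrow> \<mu>' k j = 0 \<Longrightarrow>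
        Re (sesq A (\<lambda>a b. \<rho> (k,a) (k,b)) (r' k j) (r' k j)) = 0"
  shows "(\<Sum>k\<in>K. (\<Sum>i\<in>I'. \<nu>' k i * ln (\<nu>' k i)) -
           (\<Sum>j\<in>J'. Re (sesq A (\<lambda>a b. \<rho> (k,a) (k,b)) (r' k j) (r' k j)) * ln (\<mu>' k j)))
    \<le> (\<Sum>i\<in>I. \<nu> i * ln (\<nu> i)) - (\<Sum>j\<in>J. Re (sesq (K \<times> A) \<rho> (r j) (r j)) * ln (\<mu> j))"
proof (cases "K = {}")
  case True
  then have "J = {} \<and> I = {}"
    using onb_unit[OF specD(1)[OF w]] onb_unit[OF specD(1)[OF r]] by auto
  then show ?thesis using True by simp
next
  case False
  then obtain k0 where k0: "k0 \<in> K" by blast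
  have fI: "finite I" "finite J" "finite I'" "finite J'"
    using onbD(1)[OF specD(1)[OF w]] onbD(1)[OF specD(1)[OF r]]
      onbD(1)[OF specD(1)[OF wk[OF k0]]] onbD(1)[OF specD(1)[OF rk[OF k0]]] by auto
  \<comment> \<open>Of the square of \<open>\<nu> i\<close> in \<open>res_sum\<close>, one factor
    belongs to the weight and the other is the numerator of the resolvent.\<close>
  define u where "u = (\<lambda>(j,i). \<nu> i * (cmod (ip (K \<times> A) (r j) (w i)))\<^sup>2)"
  define v where "v = (\<lambda>(k,j,i). \<nu>' k i * (cmod (ip A (r' k j) (w' k i)))\<^sup>2)"
  \<comment> \<open>A pair of nonzero weight gives \<open>g j\<close> a positive expectation in
    \<open>X\<close>, so the support condition excludes \<open>m j = 0\<close>.\<close>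
  have pos: "0 < n \<and> 0 < m j"
    if s: "spec S V X f n'" "onb T V g" and i: "i \<in> S" "j \<in> T" and nz: "n' i * (cmod (ip V (g j) (f i)))\<^sup>2 \<noteq> 0"
      and n: "n = n' i" "\<And>i. i \<in> S \<Longrightarrow> 0 \<le> n' i"
      and m: "0 \<le> m j" "m j = 0 \<Longrightarrow> Re (sesq V X (g j) (g j)) = 0"
    for S V X f n' T g i j n and m :: "_ \<Rightarrow> real"
  proof -
    have sw: "cmod (ip V (f i) (g j)) = cmod (ip V (g j) (f i))" for i j
      by (metis cnj_ip complex_mod_cnj)
    have "0 < n' i * (cmod (ip V (g j) (f i)))\<^sup>2"
      using nz n(2)[OF i(1)] by (simp add: less_le)
    also have "\<dots> \<le> (\<Sum>i\<in>S. n' i * (cmod (ip V (g j) (f i)))\<^sup>2)"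
      using i n(2) onbD(1)[OF specD(1)[OF s(1)]] by (intro member_le_sum) auto
    also have "\<dots> = Re (sesq V X (g j) (g j))"
      unfolding sesq_spec_norm[OF s(1)] sw by simp
    finally have "m j \<noteq> 0" using m by auto
    moreover have "n' i \<noteq> 0" using nz by auto
    ultimately show ?thesis using n(1) n(2)[OF i(1)] m(1) by simp
  qed
  \<comment> \<open>The total weight is the trace, which is also the sum of the traces of the
    diagonal blocks. This supplies the equality of weights that cancels the divergence.\<close>
  have tot: "(\<Sum>j\<in>T. \<Sum>i\<in>S. n' i * (cmod (ip V (g j) (f i)))\<^sup>2) = Re (\<Sum>a\<in>V. X a a)"
    if s: "spec S V X f n'" "onb T V g" for S V X f n' T g
  proof -
    have "(\<Sum>j\<in>T. \<Sum>i\<in>S. n' i * (cmod (ip V (g j) (f i)))\<^sup>2) = (\<Sum>i\<in>S. n' i * (\<Sum>j\<in>T. (cmod (ip V (g j) (f i)))\<^sup>2))"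
      by (subst sum.swap) (simp add: sum_distrib_left)
    also have "\<dots> = (\<Sum>i\<in>S. n' i)"
      by (intro sum.cong refl) (simp add: parseval_norm[OF s(2)] onb_unit[OF specD(1)[OF s(1)]])
    finally show ?thesis unfolding trace_spec[OF s(1)] by simp
  qed
  have "(\<Sum>q\<in>K \<times> J' \<times> I'. v q * (ln (case q of (k,j,i) \<Rightarrow> \<nu>' k i) - ln (case q of (k,j,i) \<Rightarrow> \<mu>' k j)))
      \<le> (\<Sum>p\<in>J \<times> I. u p * (ln (case p of (j,i) \<Rightarrow> \<nu> i) - ln (case p of (j,i) \<Rightarrow> \<mu> j)))"
  proof (rule ln_sum_mono_of_resolvent)
    show "finite (J \<times> I)" "finite (K \<times> J' \<times> I')" using K fI by auto
    show "0 < (case p of (j,i) \<Rightarrow> \<nu> i) \<and> 0 < (case p of (j,i) \<Rightarrow> \<mu> j)" if p: "p \<in> J \<times> I" "u p \<noteq> 0" for p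
    proof -
      obtain j i where ji: "p = (j, i)" "j \<in> J" "i \<in> I" using p by auto
      have "0 < \<nu> i \<and> 0 < \<mu> j"
        by (rule pos[OF w specD(1)[OF r] ji(3,2) _ refl nn(1)])
          (use p ji nn supp in \<open>auto simp: u_def\<close>)
      then show ?thesis using ji by simp
    qed
    show "0 < (case q of (k,j,i) \<Rightarrow> \<nu>' k i) \<and> 0 < (case q of (k,j,i) \<Rightarrow> \<mu>' k j)"
      if q: "q \<in> K \<times> J' \<times> I'" "v q \<noteq> 0" for q
    proof -
      obtain k j i where ji: "q = (k, j, i)" "k \<in> K" "j \<in> J'" "i \<in> I'" using q by auto
      have "0 < \<nu>' k i \<and> 0 < \<mu>' k j"
        by (rule pos[OF wk[OF ji(2)] specD(1)[OF rk[OF ji(2)]] ji(4,3) _ refl nn'(1)])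
          (use q ji nn' supp' in \<open>auto simp: v_def\<close>)
      then show ?thesis using ji by simp
    qed
    show "sum v (K \<times> J' \<times> I') = sum u (J \<times> I)"
    proof -
      have "sum v (K \<times> J' \<times> I') = (\<Sum>k\<in>K. \<Sum>j\<in>J'. \<Sum>i\<in>I'. \<nu>' k i * (cmod (ip A (r' k j) (w' k i)))\<^sup>2)"
        unfolding v_def by (simp add: sum.cartesian_product split_def)
      also have "\<dots> = (\<Sum>k\<in>K. Re (\<Sum>a\<in>A. \<rho> (k,a) (k,a)))"
        using tot[OF wk specD(1)[OF rk]] by simp
      also have "\<dots> = Re (\<Sum>x\<in>K \<times> A. \<rho> x x)"
        by (simp add: sum.cartesian_product split_def)
      also have "\<dots> = sum u (J \<times> I)"
        unfolding u_def tot[OF w specD(1)[OF r], symmetric] by (simp add: sum.cartesian_product split_def)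
      finally show ?thesis .
    qed
    fix t :: real assume t: "t > 0"
    have "(\<Sum>q\<in>K \<times> J' \<times> I'. v q * (case q of (k,j,i) \<Rightarrow> \<nu>' k i) / ((case q of (k,j,i) \<Rightarrow> \<mu>' k j) + t * (case q of (k,j,i) \<Rightarrow> \<nu>' k i)))
        = (\<Sum>k\<in>K. res_sum J' I' A (r' k) (w' k) (\<mu>' k) (\<nu>' k) t)"
      unfolding v_def res_sum_def by (simp add: sum.cartesian_product split_def power2_eq_square mult_ac)
    also have "\<dots> \<le> res_sum J I (K \<times> A) r w \<mu> \<nu> t"
      by (rule res_sum_block[OF K t w r nn wk rk])
    also have "\<dots> = (\<Sum>p\<in>J \<times> I. u p * (case p of (j,i) \<Rightarrow> \<nu> i) / ((case p of (j,i) \<Rightarrow> \<mu> j) + t * (case p of (j,i) \<Rightarrow> \<nu> i)))"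
      unfolding u_def res_sum_def by (simp add: sum.cartesian_product split_def power2_eq_square mult_ac)
    finally show "(\<Sum>q\<in>K \<times> J' \<times> I'. v q * (case q of (k,j,i) \<Rightarrow> \<nu>' k i) / ((case q of (k,j,i) \<Rightarrow> \<mu>' k j) + t * (case q of (k,j,i) \<Rightarrow> \<nu>' k i)))
      \<le> (\<Sum>p\<in>J \<times> I. u p * (case p of (j,i) \<Rightarrow> \<nu> i) / ((case p of (j,i) \<Rightarrow> \<mu> j) + t * (case p of (j,i) \<Rightarrow> \<nu> i)))" .
  qed
  also have "\<dots> = (\<Sum>i\<in>I. \<nu> i * ln (\<nu> i)) - (\<Sum>j\<in>J. Re (sesq (K \<times> A) \<rho> (r j) (r j)) * ln (\<mu> j))"
    unfolding rel_entropy_eval[OF w specD(1)[OF r], symmetric] u_def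
    by (simp add: sum.cartesian_product split_def)
  also have "(\<Sum>q\<in>K \<times> J' \<times> I'. v q * (ln (case q of (k,j,i) \<Rightarrow> \<nu>' k i) - ln (case q of (k,j,i) \<Rightarrow> \<mu>' k j)))
     = (\<Sum>k\<in>K. \<Sum>j\<in>J'. \<Sum>i\<in>I'. \<nu>' k i * (cmod (ip A (r' k j) (w' k i)))\<^sup>2 * (ln (\<nu>' k i) - ln (\<mu>' k j)))"
    unfolding v_def by (simp add: sum.cartesian_product split_def)
  also have "\<dots> = (\<Sum>k\<in>K. (\<Sum>i\<in>I'. \<nu>' k i * ln (\<nu>' k i)) -
           (\<Sum>j\<in>J'. Re (sesq A (\<lambda>a b. \<rho> (k,a) (k,b)) (r' k j) (r' k j)) * ln (\<mu>' k j)))"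
    by (intro sum.cong refl rel_entropy_eval[OF wk specD(1)[OF rk]])
  finally show ?thesis .
qed

section \<open>Entropy of reduced states\<close>

text \<open>The partial trace over \<open>Y\<close> of the projector-like operator of the vector
  \<open>\<phi>\<close>, without normalization.\<close>

definition gram :: "'a set \<Rightarrow> 'y set \<Rightarrow> ('a \<Rightarrow> 'y \<Rightarrow> complex) \<Rightarrow> 'a \<Rightarrow> 'a \<Rightarrow> complex" where
  "gram V Y \<phi> a a' = (\<Sum>y\<in>Y. \<phi> a y * cnj (\<phi> a' y))"

text \<open>The entropy, in natural units, of the reduced state on \<open>V\<close> of the bipartite vector \<open>\<phi>\<close>, which
  need not be normalized; the value does not depend on the chosen spectral decomposition
  (\<open>ent_eq\<close>).\<close>
definition ent :: "'a set \<Rightarrow> 'y set \<Rightarrow> ('a \<Rightarrow> 'y \<Rightarrow> complex) \<Rightarrow> real" where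
  "ent V Y \<phi> = (SOME s. \<exists>e \<mu>. spec V V (gram V Y \<phi>) e \<mu> \<and> s = - (\<Sum>i\<in>V. \<mu> i * ln (\<mu> i)))"

lemma sesq_gram:
  "sesq V (gram V Y \<phi>) u u = of_real (\<Sum>y\<in>Y. (cmod (ip V u (\<lambda>a. \<phi> a y)))\<^sup>2)"
proof -
  have "sesq V (gram V Y \<phi>) u u = (\<Sum>a\<in>V. \<Sum>b\<in>V. \<Sum>y\<in>Y. (cnj (u a) * \<phi> a y) * cnj (cnj (u b) * \<phi> b y))"
    unfolding sesq_def gram_def by (simp add: sum_distrib_left sum_distrib_right mult_ac)
  also have "\<dots> = (\<Sum>a\<in>V. \<Sum>y\<in>Y. \<Sum>b\<in>V. (cnj (u a) * \<phi> a y) * cnj (cnj (u b) * \<phi> b y))"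
    by (intro sum.cong refl sum.swap)
  also have "\<dots> = (\<Sum>y\<in>Y. \<Sum>a\<in>V. \<Sum>b\<in>V. (cnj (u a) * \<phi> a y) * cnj (cnj (u b) * \<phi> b y))"
    by (rule sum.swap)
  also have "\<dots> = (\<Sum>y\<in>Y. ip V u (\<lambda>a. \<phi> a y) * cnj (ip V u (\<lambda>a. \<phi> a y)))"
    unfolding ip_def cnj_sum sum_product ..
  finally show ?thesis unfolding of_real_sum complex_norm_square .
qed

lemma gram_hermitian: "gram V Y \<phi> b a = cnj (gram V Y \<phi> a b)"
  by (simp add: gram_def mult.commute)

lemma gram_spec_exists:
  assumes "finite V"
  obtains e \<mu> where "spec V V (gram V Y \<phi>) e \<mu>"
  using spectral_theorem[OF assms, of "gram V Y \<phi>"] gram_hermitian by metis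

lemma gram_spec_nonneg: "spec I V (gram V Y \<phi>) e \<mu> \<Longrightarrow> i \<in> I \<Longrightarrow> 0 \<le> \<mu> i"
  using spec_nonneg[of I V "gram V Y \<phi>" e \<mu> i] by (simp add: sesq_gram sum_nonneg)

lemma spec_left_eigen:
  assumes "spec I V X e \<mu>" "i \<in> I" "b \<in> V"
  shows "(\<Sum>a\<in>V. cnj (e i a) * X a b) = of_real (\<mu> i) * cnj (e i b)"
proof -
  note o = onbD[OF specD(1)[OF assms(1)]]
  have "(\<Sum>a\<in>V. cnj (e i a) * X a b) = (\<Sum>a\<in>V. \<Sum>j\<in>I. of_real (\<mu> j) * cnj (e j b) * (cnj (e i a) * e j a))"
    by (intro sum.cong refl) (simp add: specD(2)[OF assms(1)] assms sum_distrib_left mult_ac)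
  also have "\<dots> = (\<Sum>j\<in>I. of_real (\<mu> j) * cnj (e j b) * ip V (e i) (e j))"
    unfolding ip_def sum_distrib_left by (rule sum.swap)
  also have "\<dots> = (\<Sum>j\<in>I. if i = j then of_real (\<mu> j) * cnj (e j b) else 0)"
    by (intro sum.cong refl) (simp add: o assms)
  finally show ?thesis using o assms by simp
qed

text \<open>The Schmidt argument, in a form that allows arbitrary eigenbases in degenerate
  eigenspaces. The weights |x i j|^2 have marginals \<open>\<mu>\<close> and \<open>\<nu>\<close>
  and are nonzero only where \<open>\<mu> i = \<nu> j\<close>, so one logarithm may be exchanged for
  the other.\<close>

lemma gram_spec_swap:
  assumes fin: "finite Y"
    and e: "spec I V (gram V Y \<phi>) e \<mu>" and f: "spec J Y (gram Y V (\<lambda>y a. \<phi> a y)) f \<nu>"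
  shows "(\<Sum>i\<in>I. \<mu> i * ln (\<mu> i)) = (\<Sum>j\<in>J. \<nu> j * ln (\<nu> j))"
proof -
  note oe = onbD[OF specD(1)[OF e]] and of = onbD[OF specD(1)[OF f]]
  define x where "x = (\<lambda>i j. \<Sum>a\<in>V. \<Sum>y\<in>Y. cnj (e i a) * cnj (f j y) * \<phi> a y)"
  have x1: "x i j = ip Y (f j) (\<lambda>y. ip V (e i) (\<lambda>a. \<phi> a y))" for i j
    unfolding x_def ip_def sum_distrib_left by (subst sum.swap) (simp add: mult_ac)
  have x2: "x i j = ip V (e i) (\<lambda>a. ip Y (f j) (\<lambda>y. \<phi> a y))" for i j
    unfolding x_def ip_def sum_distrib_left by (simp add: mult_ac)
  have s1: "(\<Sum>j\<in>J. (cmod (x i j))\<^sup>2) = \<mu> i" if "i \<in> I" for i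
  proof -
    have "complex_of_real (\<Sum>j\<in>J. (cmod (x i j))\<^sup>2) = sesq V (gram V Y \<phi>) (e i) (e i)"
      unfolding x1 parseval_norm[OF specD(1)[OF f]] sesq_gram ..
    then show ?thesis unfolding sesq_eigen[OF e that that] by (simp only: of_real_eq_iff simp_thms if_True)
  qed
  have s2: "(\<Sum>i\<in>I. (cmod (x i j))\<^sup>2) = \<nu> j" if "j \<in> J" for j
  proof -
    have "complex_of_real (\<Sum>i\<in>I. (cmod (x i j))\<^sup>2) = sesq Y (gram Y V (\<lambda>y a. \<phi> a y)) (f j) (f j)"
      unfolding x2 parseval_norm[OF specD(1)[OF e]] sesq_gram ..
    then show ?thesis unfolding sesq_eigen[OF f that that] by (simp only: of_real_eq_iff simp_thms if_True)
  qed
  \<comment> \<open>Both sides are the matrix element, between \<open>e i\<close> and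
    \<open>f j\<close>, of the product of \<open>\<phi>\<close>, its adjoint and
    \<open>\<phi>\<close>, bracketed in the two possible ways.\<close>
  have eqv: "of_real (\<mu> i) * x i j = of_real (\<nu> j) * x i j" if ij: "i \<in> I" "j \<in> J" for i j
  proof -
    have "of_real (\<mu> i) * x i j = (\<Sum>b\<in>V. \<Sum>y\<in>Y. (of_real (\<mu> i) * cnj (e i b)) * (cnj (f j y) * \<phi> b y))"
      unfolding x_def by (simp add: sum_distrib_left mult_ac)
    also have "\<dots> = (\<Sum>b\<in>V. \<Sum>y\<in>Y. (\<Sum>a\<in>V. cnj (e i a) * gram V Y \<phi> a b) * (cnj (f j y) * \<phi> b y))"
      by (intro sum.cong refl) (simp add: spec_left_eigen[OF e] ij)
    also have "\<dots> = (\<Sum>b\<in>V. \<Sum>y\<in>Y. \<Sum>a\<in>V. \<Sum>y'\<in>Y. cnj (e i a) * \<phi> a y' * cnj (\<phi> b y') * cnj (f j y) * \<phi> b y)"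
      unfolding gram_def sum_distrib_left sum_distrib_right by (simp add: mult_ac)
    also have "\<dots> = (\<Sum>a\<in>V. \<Sum>y'\<in>Y. \<Sum>b\<in>V. \<Sum>y\<in>Y. cnj (e i a) * \<phi> a y' * cnj (\<phi> b y') * cnj (f j y) * \<phi> b y)"
      by (rule sum_swap22)
    also have "\<dots> = (\<Sum>a\<in>V. \<Sum>y'\<in>Y. \<Sum>y\<in>Y. \<Sum>b\<in>V. cnj (e i a) * \<phi> a y' * cnj (\<phi> b y') * cnj (f j y) * \<phi> b y)"
      by (intro sum.cong refl sum.swap)
    also have "\<dots> = (\<Sum>a\<in>V. \<Sum>y'\<in>Y. cnj (e i a) * \<phi> a y' * (\<Sum>y\<in>Y. cnj (f j y) * gram Y V (\<lambda>y a. \<phi> a y) y y'))"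
      unfolding gram_def sum_distrib_left sum_distrib_right by (simp add: mult_ac)
    also have "\<dots> = (\<Sum>a\<in>V. \<Sum>y'\<in>Y. cnj (e i a) * \<phi> a y' * (of_real (\<nu> j) * cnj (f j y')))"
      by (intro sum.cong refl) (simp add: spec_left_eigen[OF f] ij)
    also have "\<dots> = of_real (\<nu> j) * x i j"
      unfolding x_def by (simp add: sum_distrib_left mult_ac)
    finally show ?thesis .
  qed
  have "(\<Sum>i\<in>I. \<mu> i * ln (\<mu> i)) = (\<Sum>i\<in>I. \<Sum>j\<in>J. (cmod (x i j))\<^sup>2 * ln (\<mu> i))"
    by (intro sum.cong refl) (metis s1 sum_distrib_right)
  also have "\<dots> = (\<Sum>i\<in>I. \<Sum>j\<in>J. (cmod (x i j))\<^sup>2 * ln (\<nu> j))"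
  proof (intro sum.cong refl)
    fix i j assume "i \<in> I" "j \<in> J"
    from eqv[OF this] show "(cmod (x i j))\<^sup>2 * ln (\<mu> i) = (cmod (x i j))\<^sup>2 * ln (\<nu> j)"
      by (cases "x i j = 0") auto
  qed
  also have "\<dots> = (\<Sum>j\<in>J. \<nu> j * ln (\<nu> j))"
    by (subst sum.swap, intro sum.cong refl) (metis s2 sum_distrib_right)
  finally show ?thesis .
qed

lemma ent_eq:
  assumes "finite Y" and e: "spec I V (gram V Y \<phi>) e \<mu>"
  shows "ent V Y \<phi> = - (\<Sum>i\<in>I. \<mu> i * ln (\<mu> i))"
proof -
  have fV: "finite V" using onbD(2)[OF specD(1)[OF e]] .
  obtain f \<nu> where f: "spec Y Y (gram Y V (\<lambda>y a. \<phi> a y)) f \<nu>"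
    using gram_spec_exists[OF assms(1), of V "\<lambda>y a. \<phi> a y"] by blast
  obtain e0 \<mu>0 where e0: "spec V V (gram V Y \<phi>) e0 \<mu>0"
    using gram_spec_exists[OF fV, of Y \<phi>] by blast
  have "\<exists>e \<mu>. spec V V (gram V Y \<phi>) e \<mu> \<and> ent V Y \<phi> = - (\<Sum>i\<in>V. \<mu> i * ln (\<mu> i))"
    unfolding ent_def by (rule someI_ex) (use e0 in blast)
  then obtain e1 \<mu>1 where e1: "spec V V (gram V Y \<phi>) e1 \<mu>1" "ent V Y \<phi> = - (\<Sum>i\<in>V. \<mu>1 i * ln (\<mu>1 i))"
    by blast
  \<comment> \<open>Both decompositions are compared with the same decomposition \<open>f\<close> of
    the opposite reduced state, so the choice made in \<open>ent\<close> does not matter.\<close>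
  show ?thesis unfolding e1(2) gram_spec_swap[OF assms(1) e1(1) f] gram_spec_swap[OF assms(1) e f] ..
qed

lemma ent_swap:
  assumes "finite Y" "finite V"
  shows "ent V Y \<phi> = ent Y V (\<lambda>y a. \<phi> a y)"
proof -
  obtain f \<nu> where f: "spec Y Y (gram Y V (\<lambda>y a. \<phi> a y)) f \<nu>"
    using gram_spec_exists[OF assms(1), of V "\<lambda>y a. \<phi> a y"] by blast
  obtain e \<mu> where e: "spec V V (gram V Y \<phi>) e \<mu>"
    using gram_spec_exists[OF assms(2), of Y \<phi>] by blast
  show ?thesis using ent_eq[OF assms(1) e] ent_eq[OF assms(2) f] gram_spec_swap[OF assms(1) e f] by simp
qed

lemma ent_cong_gram:
  assumes "finite V" "finite Y" "finite Y'"
    "\<And>a b. a \<in> V \<Longrightarrow> b \<in> V \<Longrightarrow> gram V Y \<phi> a b = gram V Y' \<phi>' a b"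
  shows "ent V Y \<phi> = ent V Y' \<phi>'"
proof -
  obtain e \<mu> where e: "spec V V (gram V Y \<phi>) e \<mu>"
    using gram_spec_exists[OF assms(1), of Y \<phi>] by blast
  then have e': "spec V V (gram V Y' \<phi>') e \<mu>" using spec_cong[of V "gram V Y \<phi>"] assms(4) by metis
  show ?thesis unfolding ent_eq[OF assms(2) e] ent_eq[OF assms(3) e'] ..
qed

section \<open>An uncertainty relation for complementary bases\<close>

lemma sum_Times: "(\<Sum>x\<in>A \<times> B. g x) = (\<Sum>a\<in>A. \<Sum>b\<in>B. g (a, b))"
  by (simp add: sum.cartesian_product split_def)

text \<open>A product basis whose second factor may depend on the label \<open>b\<close> of the
  first. It diagonalizes an operator that is block diagonal in \<open>b\<close>, written in the
  coordinates \<open>k\<close>.\<close>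

lemma onb_sum_products:
  assumes f: "onb K B f" and m: "\<And>b. b \<in> B \<Longrightarrow> onb J A (m b)"
  shows "onb (B \<times> J) (K \<times> A) (\<lambda>x y. f (fst y) (fst x) * m (fst x) (snd x) (snd y))"
proof (cases "B = {}")
  case True
  then have "K = {}" using onb_unit[OF f] by auto
  then show ?thesis using True by (simp add: onb_def)
next
  case False
  then obtain b0 where b0: "b0 \<in> B" by blast
  note of = onbD[OF f] and om = onbD[OF m]
  have fin: "finite J" "finite A" using om[OF b0] by auto
  have "ip (K \<times> A) (\<lambda>y. f (fst y) b * m b j (snd y)) (\<lambda>y. f (fst y) b' * m b' j' (snd y))
      = (if (b, j) = (b', j') then 1 else 0)"
    if "b \<in> B" "b' \<in> B" "j \<in> J" "j' \<in> J" for b b' j j'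
  proof -
    have "ip (K \<times> A) (\<lambda>y. f (fst y) b * m b j (snd y)) (\<lambda>y. f (fst y) b' * m b' j' (snd y))
        = ip K (\<lambda>k. f k b) (\<lambda>k. f k b') * ip A (m b j) (m b' j')"
      unfolding ip_def sum_Times sum_product by (simp add: mult_ac)
    then show ?thesis using onbD(3)[OF onb_transpose[OF f], of b b'] om(3)[of b j j'] that by auto
  qed
  moreover have "(\<Sum>x\<in>B \<times> J. f k (fst x) * m (fst x) (snd x) a * cnj (f l (fst x) * m (fst x) (snd x) a'))
      = (if (k, a) = (l, a') then 1 else 0)"
    if "k \<in> K" "l \<in> K" "a \<in> A" "a' \<in> A" for k l a a'
  proof -
    have "(\<Sum>x\<in>B \<times> J. f k (fst x) * m (fst x) (snd x) a * cnj (f l (fst x) * m (fst x) (snd x) a'))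
        = (\<Sum>b\<in>B. f k b * cnj (f l b) * (\<Sum>j\<in>J. m b j a * cnj (m b j a')))"
      unfolding sum_Times sum_distrib_left by (simp add: mult_ac)
    also have "\<dots> = (\<Sum>b\<in>B. f k b * cnj (f l b) * (if a = a' then 1 else 0))"
      by (intro sum.cong refl) (simp add: om that)
    also have "\<dots> = cnj (ip B (f k) (f l)) * (if a = a' then 1 else 0)"
      by (simp add: ip_def)
    finally show ?thesis using of(3)[of k l] that by auto
  qed
  ultimately show ?thesis unfolding onb_def using of(1,2) fin by auto
qed

text \<open>With respect to the basis \<open>f\<close> of \<open>B\<close>, the state of \<open>AB\<close> has diagonal blocks
  \<open>gram A C (N k)\<close>; its pinching in the standard basis has all diagonal blocks equal, because
  \<open>f\<close> is unbiased.\<close>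
lemma complementary_entropy:
  fixes \<psi> :: "'a \<Rightarrow> 'b \<Rightarrow> 'c \<Rightarrow> complex" and f :: "'k \<Rightarrow> 'b \<Rightarrow> complex"
  assumes fin: "finite A" "finite B" "finite C"
    and f: "onb K B f" and unb: "\<And>k b. k \<in> K \<Longrightarrow> b \<in> B \<Longrightarrow> (cmod (f k b))\<^sup>2 = 1 / d" and d: "d > 0"
  defines "N \<equiv> \<lambda>k a c. \<Sum>b\<in>B. f k b * \<psi> a b c"
  shows "ent A (B \<times> C) (\<lambda>a y. \<psi> a (fst y) (snd y)) + ent C (A \<times> B) (\<lambda>c x. \<psi> (fst x) (snd x) c)
      + (\<Sum>a\<in>A. \<Sum>b\<in>B. \<Sum>c\<in>C. (cmod (\<psi> a b c))\<^sup>2) * ln d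
    \<le> (\<Sum>b\<in>B. ent A C (\<lambda>a c. \<psi> a b c)) + (\<Sum>k\<in>K. ent A C (N k))"
proof -
  have finK: "finite K" using onbD(1)[OF f] .
  define R where "R = gram A (B \<times> C) (\<lambda>a y. \<psi> a (fst y) (snd y))"
  define N' where "N' = (\<lambda>x c. N (fst x) (snd x) c)"
  \<comment> \<open>\<open>\<rho>\<close> is the state of AB with B in the coordinates
    \<open>f\<close>; \<open>\<sigma>\<close> is its pinching in the standard basis of B, written in
    the same coordinates.\<close>
  define \<rho> where "\<rho> = gram (K \<times> A) C N'"
  define \<sigma> where "\<sigma> = (\<lambda>x y. \<Sum>b\<in>B. f (fst x) b * cnj (f (fst y) b) * gram A C (\<lambda>a c. \<psi> a b c) (snd x) (snd y))"
  obtain r \<mu> where r: "spec A A R r \<mu>" unfolding R_def using gram_spec_exists[OF fin(1)] by blast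
  have "\<exists>m \<nu>. spec A A (gram A C (\<lambda>a c. \<psi> a b c)) m \<nu>" for b
    using gram_spec_exists[OF fin(1)] by metis
  then obtain m \<nu> where m: "\<And>b. spec A A (gram A C (\<lambda>a c. \<psi> a b c)) (m b) (\<nu> b)" by metis
  have "\<exists>w' \<nu>'. spec A A (gram A C (N k)) w' \<nu>'" for k
    using gram_spec_exists[OF fin(1)] by metis
  then obtain w' \<nu>' where w': "\<And>k. spec A A (gram A C (N k)) (w' k) (\<nu>' k)" by metis
  obtain w \<kappa> where w: "spec (K \<times> A) (K \<times> A) \<rho> w \<kappa>"
    unfolding \<rho>_def using gram_spec_exists[of "K \<times> A"] finK fin by blast
  define E where "E = (\<lambda>x y. f (fst y) (fst x) * m (fst x) (snd x) (snd y))"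
  have onbE: "onb (B \<times> A) (K \<times> A) E"
    unfolding E_def by (rule onb_sum_products[OF f specD(1)[OF m]])
  have E: "spec (B \<times> A) (K \<times> A) \<sigma> E (\<lambda>x. \<nu> (fst x) (snd x))"
  proof -
    have "\<sigma> (k,a) (l,a') = (\<Sum>x\<in>B \<times> A. complex_of_real (\<nu> (fst x) (snd x)) * E x (k,a) * cnj (E x (l,a')))"
      if "a \<in> A" "a' \<in> A" for k l a a'
    proof -
      have "\<sigma> (k,a) (l,a') = (\<Sum>b\<in>B. f k b * cnj (f l b) * (\<Sum>i\<in>A. complex_of_real (\<nu> b i) * m b i a * cnj (m b i a')))"
        unfolding \<sigma>_def by (intro sum.cong refl) (simp add: specD(2)[OF m] that)
      then show ?thesis unfolding E_def sum_Times by (simp add: sum_distrib_left mult_ac)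
    qed
    then show ?thesis unfolding spec_def using onbE by auto
  qed
  have block_\<rho>: "(\<lambda>a b. \<rho> (k,a) (k,b)) = gram A C (N k)" for k
    unfolding \<rho>_def N'_def gram_def by auto
  have Rsum: "R a a' = (\<Sum>b\<in>B. gram A C (\<lambda>a c. \<psi> a b c) a a')" for a a'
    unfolding R_def gram_def sum_Times by simp
  have block_\<sigma>: "\<sigma> (k,a) (k,a') = R a a' / d" if "k \<in> K" for k a a'
  proof -
    have "f k b * cnj (f k b) = complex_of_real (1 / d)" if "b \<in> B" for b
      using unb[OF \<open>k \<in> K\<close> that] by (metis complex_norm_square)
    then show ?thesis unfolding \<sigma>_def Rsum by (simp add: sum_divide_distrib)
  qed
  have rk: "spec A A (\<lambda>a a'. \<sigma> (k,a) (k,a')) r (\<lambda>j. \<mu> j / d)" if "k \<in> K" for k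
    unfolding spec_def block_\<sigma>[OF that]
    using specD[OF r] by (auto simp: sum_divide_distrib)
  have sesq_R: "sesq A R u u = of_real (\<Sum>b\<in>B. \<Sum>c\<in>C. (cmod (ip A u (\<lambda>a. \<psi> a b c)))\<^sup>2)" for u
    unfolding R_def sesq_gram sum_Times by simp
  \<comment> \<open>Pinching keeps the diagonal entries in a basis adapted to the blocks, hence tr
    \<rho> ln \<sigma> = tr \<sigma> ln \<sigma>.\<close>
  have mE: "Re (sesq (K \<times> A) \<rho> (E x) (E x)) = \<nu> (fst x) (snd x)" if x: "x \<in> B \<times> A" for x
  proof -
    obtain b j where bj: "x = (b, j)" "b \<in> B" "j \<in> A" using x by auto
    have "ip (K \<times> A) (E x) (\<lambda>y. N' y c) = ip A (m b j) (\<lambda>a. \<psi> a b c)" for c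
    proof -
      have "ip (K \<times> A) (E x) (\<lambda>y. N' y c)
          = (\<Sum>k\<in>K. \<Sum>a\<in>A. \<Sum>b'\<in>B. cnj (m b j a) * \<psi> a b' c * (cnj (f k b) * f k b'))"
        unfolding ip_def sum_Times bj(1) E_def N'_def N_def by (simp add: sum_distrib_left mult_ac)
      also have "\<dots> = (\<Sum>a\<in>A. \<Sum>k\<in>K. \<Sum>b'\<in>B. cnj (m b j a) * \<psi> a b' c * (cnj (f k b) * f k b'))"
        by (rule sum.swap)
      also have "\<dots> = (\<Sum>a\<in>A. \<Sum>b'\<in>B. \<Sum>k\<in>K. cnj (m b j a) * \<psi> a b' c * (cnj (f k b) * f k b'))"
        by (intro sum.cong refl sum.swap)
      also have "\<dots> = (\<Sum>a\<in>A. \<Sum>b'\<in>B. cnj (m b j a) * \<psi> a b' c * ip K (\<lambda>k. f k b) (\<lambda>k. f k b'))"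
        unfolding ip_def by (simp add: sum_distrib_left)
      also have "\<dots> = (\<Sum>a\<in>A. \<Sum>b'\<in>B. if b = b' then cnj (m b j a) * \<psi> a b' c else 0)"
        using onbD(3)[OF onb_transpose[OF f] bj(2)] by (intro sum.cong refl) simp
      finally show ?thesis unfolding ip_def using fin bj by simp
    qed
    then have "sesq (K \<times> A) \<rho> (E x) (E x) = sesq A (gram A C (\<lambda>a c. \<psi> a b c)) (m b j) (m b j)"
      unfolding \<rho>_def sesq_gram by simp
    then show ?thesis using sesq_eigen[OF m bj(3,3)] bj by simp
  qed
  define m' where "m' = (\<lambda>k j. Re (sesq A (gram A C (N k)) (r j) (r j)))"
  have m'0: "0 \<le> m' k j" for k j unfolding m'_def sesq_gram by (simp add: sum_nonneg)
  \<comment> \<open>The diagonal blocks of \<open>\<rho>\<close> add up to \<open>R\<close>, as the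
    trace over B is the same in every basis. Hence their cross terms with ln (R / d) assemble to the
    entropy of A and ln d.\<close>
  have m'sum: "(\<Sum>k\<in>K. m' k j) = \<mu> j" if j: "j \<in> A" for j
  proof -
    have N_ip: "ip A (r j) (\<lambda>a. N k a c) = ip B (\<lambda>b. cnj (f k b)) (\<lambda>b. ip A (r j) (\<lambda>a. \<psi> a b c))" for k c
      unfolding N_def ip_sum_right by (simp add: ip_def)
    have "(\<Sum>k\<in>K. m' k j) = (\<Sum>c\<in>C. \<Sum>k\<in>K. (cmod (ip A (r j) (\<lambda>a. N k a c)))\<^sup>2)"
      unfolding m'_def sesq_gram Re_complex_of_real by (rule sum.swap)
    also have "\<dots> = (\<Sum>c\<in>C. \<Sum>b\<in>B. (cmod (ip A (r j) (\<lambda>a. \<psi> a b c)))\<^sup>2)"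
      unfolding N_ip parseval_norm[OF onb_cnj[OF f]] ..
    also have "\<dots> = Re (sesq A R (r j) (r j))"
      unfolding sesq_R Re_complex_of_real by (rule sum.swap)
    also have "\<dots> = \<mu> j" using sesq_eigen[OF r j j] by simp
    finally show ?thesis .
  qed
  have \<mu>0: "0 \<le> \<mu> j" if "j \<in> A" for j
    by (rule gram_spec_nonneg[OF r[unfolded R_def] that])
  \<comment> \<open>For a unit vector, the right side is the sum of the entropies of the
    standard-basis outcomes minus S(C), and the left side is S(A) + ln d minus the entropies of the
    \<open>N k\<close>.\<close>
  have main: "(\<Sum>k\<in>K. (\<Sum>i\<in>A. \<nu>' k i * ln (\<nu>' k i)) - (\<Sum>j\<in>A. m' k j * ln (\<mu> j / d)))
    \<le> (\<Sum>i\<in>K \<times> A. \<kappa> i * ln (\<kappa> i))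
      - (\<Sum>j\<in>B \<times> A. Re (sesq (K \<times> A) \<rho> (E j) (E j)) * ln (\<nu> (fst j) (snd j)))"
    unfolding m'_def block_\<rho>[symmetric]
  proof (rule rel_entropy_block[OF finK fin(1) w E])
    show "spec A A (\<lambda>a b. \<rho> (k, a) (k, b)) (w' k) (\<nu>' k)" for k
      unfolding block_\<rho> by (rule w')
    show "spec A A (\<lambda>a b. \<sigma> (k, a) (k, b)) r (\<lambda>j. \<mu> j / d)" if "k \<in> K" for k
      by (rule rk[OF that])
    show "0 \<le> \<kappa> i" if "i \<in> K \<times> A" for i
      by (rule gram_spec_nonneg[OF w[unfolded \<rho>_def] that])
    show "0 \<le> \<nu> (fst j) (snd j)" if "j \<in> B \<times> A" for j
      using gram_spec_nonneg[OF m] that by auto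
    show "0 \<le> \<nu>' k i" if "i \<in> A" for k i
      by (rule gram_spec_nonneg[OF w' that])
    show "0 \<le> \<mu> j / d" if "j \<in> A" for j using \<mu>0[OF that] d by simp
    show "Re (sesq (K \<times> A) \<rho> (E j) (E j)) = 0" if "j \<in> B \<times> A" "\<nu> (fst j) (snd j) = 0" for j
      using mE that by simp
    show "Re (sesq A (\<lambda>a b. \<rho> (k, a) (k, b)) (r j) (r j)) = 0" if kj: "k \<in> K" "j \<in> A" "\<mu> j / d = 0" for k j
    proof -
      have "(\<Sum>k\<in>K. m' k j) = 0" using m'sum kj d by simp
      then have "m' k j = 0" using m'0 finK kj by (simp add: sum_nonneg_eq_0_iff)
      then show ?thesis unfolding m'_def block_\<rho> .
    qed
  qed
  have "(\<Sum>j\<in>B \<times> A. Re (sesq (K \<times> A) \<rho> (E j) (E j)) * ln (\<nu> (fst j) (snd j)))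
      = (\<Sum>j\<in>B \<times> A. \<nu> (fst j) (snd j) * ln (\<nu> (fst j) (snd j)))"
    using mE by (intro sum.cong refl) simp
  also have "\<dots> = - (\<Sum>b\<in>B. ent A C (\<lambda>a c. \<psi> a b c))"
    unfolding sum_Times ent_eq[OF fin(3) m] by (simp add: sum_negf)
  finally have 1: "(\<Sum>j\<in>B \<times> A. Re (sesq (K \<times> A) \<rho> (E j) (E j)) * ln (\<nu> (fst j) (snd j)))
      = - (\<Sum>b\<in>B. ent A C (\<lambda>a c. \<psi> a b c))" .
  \<comment> \<open>Purity identifies the entropy of AB with that of C, and tracing out B gives the
    same state of C in either basis.\<close>
  have "ent C (A \<times> B) (\<lambda>c x. \<psi> (fst x) (snd x) c) = ent C (K \<times> A) (\<lambda>c x. N' x c)"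
  proof (rule ent_cong_gram)
    fix c c'
    have "gram C (K \<times> A) (\<lambda>c x. N' x c) c c' = (\<Sum>a\<in>A. \<Sum>k\<in>K. N k a c * cnj (N k a c'))"
      unfolding gram_def sum_Times N'_def by (simp, rule sum.swap)
    also have "\<dots> = (\<Sum>a\<in>A. \<Sum>k\<in>K. cnj (ip B (\<lambda>b. cnj (f k b)) (\<lambda>b. \<psi> a b c')) * ip B (\<lambda>b. cnj (f k b)) (\<lambda>b. \<psi> a b c))"
      unfolding N_def ip_def by (simp add: mult_ac)
    also have "\<dots> = (\<Sum>a\<in>A. \<Sum>b\<in>B. \<psi> a b c * cnj (\<psi> a b c'))"
      by (simp only: parseval[OF onb_cnj[OF f]]) (simp add: ip_def mult_ac)
    finally show "gram C (A \<times> B) (\<lambda>c x. \<psi> (fst x) (snd x) c) c c' = gram C (K \<times> A) (\<lambda>c x. N' x c) c c'"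
      unfolding gram_def sum_Times by simp
  qed (use fin finK in auto)
  also have "\<dots> = ent (K \<times> A) C N'"
    by (rule ent_swap) (use fin finK in auto)
  finally have 2: "(\<Sum>i\<in>K \<times> A. \<kappa> i * ln (\<kappa> i)) = - ent C (A \<times> B) (\<lambda>c x. \<psi> (fst x) (snd x) c)"
    using ent_eq[OF fin(3) w[unfolded \<rho>_def]] by simp
  have tr: "(\<Sum>j\<in>A. \<mu> j) = (\<Sum>a\<in>A. \<Sum>b\<in>B. \<Sum>c\<in>C. (cmod (\<psi> a b c))\<^sup>2)"
  proof -
    have "complex_of_real (\<Sum>j\<in>A. \<mu> j) = (\<Sum>a\<in>A. R a a)" using trace_spec[OF r] by simp
    also have "\<dots> = complex_of_real (\<Sum>a\<in>A. \<Sum>b\<in>B. \<Sum>c\<in>C. (cmod (\<psi> a b c))\<^sup>2)"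
      unfolding R_def gram_def sum_Times of_real_sum complex_norm_square by simp
    finally show ?thesis unfolding of_real_eq_iff .
  qed
  have "(\<Sum>k\<in>K. \<Sum>j\<in>A. m' k j * ln (\<mu> j / d)) = (\<Sum>j\<in>A. \<mu> j * ln (\<mu> j / d))"
    by (subst sum.swap, intro sum.cong refl) (simp add: m'sum flip: sum_distrib_right)
  also have "\<dots> = (\<Sum>j\<in>A. \<mu> j * ln (\<mu> j) - \<mu> j * ln d)"
  proof (intro sum.cong refl)
    fix j assume "j \<in> A"
    then show "\<mu> j * ln (\<mu> j / d) = \<mu> j * ln (\<mu> j) - \<mu> j * ln d"
      using \<mu>0[of j] d by (cases "\<mu> j = 0") (simp_all add: ln_div right_diff_distrib)
  qed
  also have "\<dots> = - ent A (B \<times> C) (\<lambda>a y. \<psi> a (fst y) (snd y))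
      - (\<Sum>a\<in>A. \<Sum>b\<in>B. \<Sum>c\<in>C. (cmod (\<psi> a b c))\<^sup>2) * ln d"
    using ent_eq[OF _ r[unfolded R_def]] fin by (simp add: sum_subtractf tr flip: sum_distrib_right)
  finally have 3: "(\<Sum>k\<in>K. \<Sum>j\<in>A. m' k j * ln (\<mu> j / d)) = - ent A (B \<times> C) (\<lambda>a y. \<psi> a (fst y) (snd y))
      - (\<Sum>a\<in>A. \<Sum>b\<in>B. \<Sum>c\<in>C. (cmod (\<psi> a b c))\<^sup>2) * ln d" .
  have 4: "(\<Sum>k\<in>K. \<Sum>i\<in>A. \<nu>' k i * ln (\<nu>' k i)) = - (\<Sum>k\<in>K. ent A C (N k))"
    unfolding ent_eq[OF fin(3) w'] by (simp add: sum_negf)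
  show ?thesis using main unfolding 1 2 sum_subtractf 3 4 by linarith
qed

section \<open>Lower bound on the entanglement of assistance\<close>

text \<open>For slices \<open>g\<close> and \<open>h\<close> of a vector: tracing out B gives the
  same operator in every basis of B, so every measurement of B decomposes it.\<close>

lemma parseval_mult:
  assumes "onb K B f"
  shows "(\<Sum>k\<in>K. (\<Sum>b\<in>B. f k b * g b) * cnj (\<Sum>b\<in>B. f k b * h b)) = (\<Sum>b\<in>B. g b * cnj (h b))"
  using parseval[OF onb_cnj[OF assms], of h g] by (simp add: ip_def mult.commute)

text \<open>The Fourier matrix over a numbering of \<open>B\<close>. Distinct rows are orthogonal
  because the ratio of two distinct n-th roots of unity is an n-th root other than 1, whose
  geometric sum vanishes.\<close>

lemma unbiased_onb_exists:
  fixes B :: "'b set"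
  assumes "finite B" "B \<noteq> {}"
  obtains f :: "'b \<Rightarrow> 'b \<Rightarrow> complex"
    where "onb B B f" "\<And>k b. (cmod (f k b))\<^sup>2 = 1 / real (card B)"
proof -
  define n where "n = card B"
  have n: "n > 0" using assms by (simp add: n_def card_gt_0_iff)
  obtain h where h: "bij_betw h B {..<n}"
    using ex_bij_betw_finite_nat[OF assms(1)] unfolding n_def atLeast0LessThan by blast
  define w where "w = (\<lambda>k::nat. cis (2 * pi * real k / real n))"
  have w_inj: "inj_on w {..<n}" and w_root: "\<And>k. k < n \<Longrightarrow> w k ^ n = 1"
    using bij_betw_roots_unity[OF n] unfolding w_def bij_betw_def by auto
  have w1: "w k * cnj (w k) = 1" for k by (simp add: w_def cis_cnj cis_mult)
  have w_sym: "w k ^ l = w l ^ k" for k l by (simp add: w_def DeMoivre mult_ac)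
  define f where "f = (\<lambda>x y. w (h x) ^ (h y) / sqrt (real n))"
  have sq: "complex_of_real (sqrt (real n)) * complex_of_real (sqrt (real n)) = of_nat n"
    by (simp flip: of_real_mult)
  have ip: "ip B (f x) (f y) = (if x = y then 1 else 0)" if xy: "x \<in> B" "y \<in> B" for x y
  proof -
    define z where "z = cnj (w (h x)) * w (h y)"
    have hx: "h x < n" "h y < n" using h xy by (auto simp: bij_betw_def)
    have "ip B (f x) (f y) = (\<Sum>b\<in>B. z ^ h b / of_nat n)"
      unfolding ip_def f_def z_def by (simp add: power_mult_distrib sq)
    also have "\<dots> = (\<Sum>l<n. z ^ l / of_nat n)"
      by (rule sum.reindex_bij_betw[OF h])
    also have "\<dots> = (\<Sum>l<n. z ^ l) / of_nat n" by (simp add: sum_divide_distrib)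
    finally have *: "ip B (f x) (f y) = (\<Sum>l<n. z ^ l) / of_nat n" .
    show ?thesis
    proof (cases "x = y")
      case True
      then have "z = 1" using w1[of "h x"] by (simp add: z_def mult.commute)
      then show ?thesis using * True n by simp
    next
      case False
      then have "h x \<noteq> h y" using h xy by (auto simp: bij_betw_def inj_on_def)
      then have ne: "w (h x) \<noteq> w (h y)" using w_inj hx by (auto simp: inj_on_def)
      have "w (h x) * z = w (h y)" unfolding z_def using w1[of "h x"] by (simp flip: mult.assoc)
      then have "z \<noteq> 1" using ne by auto
      moreover have "z ^ n = 1"
        unfolding z_def by (simp add: power_mult_distrib w_root hx flip: complex_cnj_power)
      ultimately show ?thesis using * False by (simp add: geometric_sum)
    qed
  qed
  \<comment> \<open>The matrix is symmetric, so completeness is again orthonormality.\<close>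
  have f_sym: "f x y = f y x" for x y unfolding f_def by (simp add: w_sym)
  have "(\<Sum>i\<in>B. f i a * cnj (f i b)) = ip B (f b) (f a)" for a b
    unfolding ip_def by (intro sum.cong refl) (metis f_sym mult.commute)
  then have "onb B B f" unfolding onb_def using assms(1) ip by auto
  moreover have "(cmod (f k b))\<^sup>2 = 1 / real (card B)" for k b
    unfolding f_def n_def[symmetric] by (simp add: norm_divide norm_power w_def power_divide)
  ultimately show thesis by (rule that)
qed

text \<open>The squared norm; for the vector conditional on a measurement outcome, it is the
  probability of that outcome.\<close>

definition mass :: "'a set \<Rightarrow> 'c set \<Rightarrow> ('a \<Rightarrow> 'c \<Rightarrow> complex) \<Rightarrow> real" where
  "mass A C \<phi> = (\<Sum>a\<in>A. \<Sum>c\<in>C. (cmod (\<phi> a c))\<^sup>2)"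

text \<open>For a vector \<open>\<phi> = sqrt p *\<^sub>R \<psi>\<close> with \<open>\<psi>\<close> a unit vector, this is \<open>p\<close> times the
  entanglement entropy of \<open>\<psi>\<close>, in natural units.\<close>
definition eent :: "'a set \<Rightarrow> 'c set \<Rightarrow> ('a \<Rightarrow> 'c \<Rightarrow> complex) \<Rightarrow> real" where
  "eent A C \<phi> = ent A C \<phi> + mass A C \<phi> * ln (mass A C \<phi>)"

text \<open>The two decompositions of the state of \<open>AC\<close> come from measuring \<open>B\<close> in the Schmidt basis
  of \<open>B\<close> against \<open>AC\<close> and in a basis unbiased to it.\<close>
lemma assistance_lower_bound:
  fixes \<psi> :: "'a \<Rightarrow> 'b \<Rightarrow> 'c \<Rightarrow> complex"
  assumes fin: "finite A" "finite B" "finite C" and ne: "B \<noteq> {}"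
  obtains m n :: "'b \<Rightarrow> 'a \<Rightarrow> 'c \<Rightarrow> complex"
  where "\<And>a c a' c'. (\<Sum>b\<in>B. m b a c * cnj (m b a' c')) = (\<Sum>b\<in>B. \<psi> a b c * cnj (\<psi> a' b c'))"
    and "\<And>a c a' c'. (\<Sum>b\<in>B. n b a c * cnj (n b a' c')) = (\<Sum>b\<in>B. \<psi> a b c * cnj (\<psi> a' b c'))"
    and "ent A (B \<times> C) (\<lambda>a y. \<psi> a (fst y) (snd y)) + ent C (A \<times> B) (\<lambda>c x. \<psi> (fst x) (snd x) c)
        - ent B (A \<times> C) (\<lambda>b x. \<psi> (fst x) b (snd x))
        + mass A (B \<times> C) (\<lambda>a y. \<psi> a (fst y) (snd y)) * ln (mass A (B \<times> C) (\<lambda>a y. \<psi> a (fst y) (snd y)))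
      \<le> (\<Sum>b\<in>B. eent A C (m b)) + (\<Sum>b\<in>B. eent A C (n b))"
proof -
  define d where "d = real (card B)"
  have d: "d > 0" using fin ne by (simp add: d_def card_gt_0_iff)
  define T where "T = mass A (B \<times> C) (\<lambda>a y. \<psi> a (fst y) (snd y))"
  define G where "G = gram B (A \<times> C) (\<lambda>b x. \<psi> (fst x) b (snd x))"
  obtain e \<nu> where e: "spec B B G e \<nu>" unfolding G_def using gram_spec_exists[OF fin(2)] by blast
  \<comment> \<open>Projecting B onto \<open>e b\<close> conjugates its entries; the vectors
    \<open>m b\<close> are thus the Schmidt components of \<open>\<psi>\<close> on AC.\<close>
  define e' where "e' = (\<lambda>b b'. cnj (e b b'))"
  have e': "onb B B e'" unfolding e'_def by (rule onb_cnj[OF specD(1)[OF e]])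
  obtain f :: "'b \<Rightarrow> 'b \<Rightarrow> complex" where f: "onb B B f" "\<And>k b. (cmod (f k b))\<^sup>2 = 1 / d"
    using unbiased_onb_exists[OF fin(2) ne] unfolding d_def by blast
  define m where "m = (\<lambda>b a c. \<Sum>b'\<in>B. e' b b' * \<psi> a b' c)"
  define n where "n = (\<lambda>k a c. \<Sum>b\<in>B. f k b * m b a c)"
  have m: "(\<Sum>b\<in>B. m b a c * cnj (m b a' c')) = (\<Sum>b\<in>B. \<psi> a b c * cnj (\<psi> a' b c'))" for a c a' c'
    unfolding m_def by (rule parseval_mult[OF e'])
  have n: "(\<Sum>b\<in>B. n b a c * cnj (n b a' c')) = (\<Sum>b\<in>B. \<psi> a b c * cnj (\<psi> a' b c'))" for a c a' c'
    unfolding n_def parseval_mult[OF f(1)] m ..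
  \<comment> \<open>Since \<open>e\<close> diagonalizes the state of B, the components are
    orthogonal with the eigenvalues as squared norms. This makes the outcome entropy S(B) and
    removes the cross terms in \<open>mass_n\<close>.\<close>
  have m_orth: "(\<Sum>a\<in>A. \<Sum>c\<in>C. m b a c * cnj (m b' a c)) = (if b = b' then of_real (\<nu> b) else 0)"
    if "b \<in> B" "b' \<in> B" for b b'
  proof -
    have "(\<Sum>a\<in>A. \<Sum>c\<in>C. m b a c * cnj (m b' a c))
        = (\<Sum>a\<in>A. \<Sum>c\<in>C. \<Sum>i\<in>B. \<Sum>j\<in>B. cnj (e b i) * (\<psi> a i c * cnj (\<psi> a j c)) * e b' j)"
      unfolding m_def e'_def cnj_sum sum_product by (simp add: mult_ac)
    also have "\<dots> = (\<Sum>i\<in>B. \<Sum>j\<in>B. \<Sum>a\<in>A. \<Sum>c\<in>C. cnj (e b i) * (\<psi> a i c * cnj (\<psi> a j c)) * e b' j)"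
      by (rule sum_swap22)
    also have "\<dots> = sesq B G (e b) (e b')"
      unfolding sesq_def G_def gram_def sum_Times
      by (simp add: sum_distrib_left sum_distrib_right)
    finally show ?thesis using sesq_eigen[OF e that] by simp
  qed
  have mass_m: "mass A C (m b) = \<nu> b" if "b \<in> B" for b
  proof -
    have "complex_of_real (mass A C (m b)) = of_real (\<nu> b)"
      using m_orth[OF that that] unfolding mass_def of_real_sum complex_norm_square by simp
    then show ?thesis unfolding of_real_eq_iff .
  qed
  have T_alt: "T = (\<Sum>a\<in>A. \<Sum>b\<in>B. \<Sum>c\<in>C. (cmod (\<psi> a b c))\<^sup>2)"
    unfolding T_def mass_def sum_Times by simp
  have T_m: "T = (\<Sum>a\<in>A. \<Sum>b\<in>B. \<Sum>c\<in>C. (cmod (m b a c))\<^sup>2)"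
  proof -
    have "(\<Sum>b\<in>B. (cmod (m b a c))\<^sup>2) = (\<Sum>b\<in>B. (cmod (\<psi> a b c))\<^sup>2)" for a c
    proof -
      have "complex_of_real (\<Sum>b\<in>B. (cmod (m b a c))\<^sup>2) = complex_of_real (\<Sum>b\<in>B. (cmod (\<psi> a b c))\<^sup>2)"
        using m[of a c a c] unfolding of_real_sum complex_norm_square .
      then show ?thesis unfolding of_real_eq_iff .
    qed
    then have "(\<Sum>c\<in>C. \<Sum>b\<in>B. (cmod (m b a c))\<^sup>2) = (\<Sum>c\<in>C. \<Sum>b\<in>B. (cmod (\<psi> a b c))\<^sup>2)" for a
      by simp
    then have "(\<Sum>b\<in>B. \<Sum>c\<in>C. (cmod (m b a c))\<^sup>2) = (\<Sum>b\<in>B. \<Sum>c\<in>C. (cmod (\<psi> a b c))\<^sup>2)" for a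
      by (simp only: sum.swap[of _ C B])
    then show ?thesis unfolding T_alt by simp
  qed
  have T_nu: "T = (\<Sum>b\<in>B. \<nu> b)"
  proof -
    have "T = (\<Sum>b\<in>B. mass A C (m b))" unfolding T_m mass_def by (rule sum.swap)
    then show ?thesis using mass_m by simp
  qed
  have mass_n: "mass A C (n k) = T / d" if "k \<in> B" for k
  proof -
    have "complex_of_real (mass A C (n k)) = (\<Sum>a\<in>A. \<Sum>c\<in>C. n k a c * cnj (n k a c))"
      unfolding mass_def of_real_sum complex_norm_square ..
    also have "\<dots> = (\<Sum>a\<in>A. \<Sum>c\<in>C. \<Sum>i\<in>B. \<Sum>j\<in>B. f k i * cnj (f k j) * (m i a c * cnj (m j a c)))"
      unfolding n_def cnj_sum sum_product by (simp add: mult_ac)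
    also have "\<dots> = (\<Sum>i\<in>B. \<Sum>j\<in>B. \<Sum>a\<in>A. \<Sum>c\<in>C. f k i * cnj (f k j) * (m i a c * cnj (m j a c)))"
      by (rule sum_swap22)
    also have "\<dots> = (\<Sum>i\<in>B. \<Sum>j\<in>B. f k i * cnj (f k j) * (\<Sum>a\<in>A. \<Sum>c\<in>C. m i a c * cnj (m j a c)))"
      by (simp add: sum_distrib_left)
    also have "\<dots> = (\<Sum>i\<in>B. \<Sum>j\<in>B. if i = j then f k i * cnj (f k i) * of_real (\<nu> i) else 0)"
      by (intro sum.cong refl) (simp add: m_orth)
    also have "\<dots> = (\<Sum>i\<in>B. f k i * cnj (f k i) * of_real (\<nu> i))"
      using fin(2) by simp
    also have "\<dots> = (\<Sum>i\<in>B. complex_of_real (1 / d) * of_real (\<nu> i))"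
      unfolding complex_norm_square[symmetric] f(2) ..
    also have "\<dots> = complex_of_real (T / d)"
      unfolding T_nu by (simp add: sum_divide_distrib)
    finally show ?thesis unfolding of_real_eq_iff .
  qed
  \<comment> \<open>The entropic inequality is applied to \<open>\<psi>\<close> rewritten in its
    Schmidt basis, so that the standard-basis outcomes are the \<open>m b\<close>.\<close>
  have "ent A (B \<times> C) (\<lambda>a y. m (fst y) a (snd y)) + ent C (A \<times> B) (\<lambda>c x. m (snd x) (fst x) c) + T * ln d
      \<le> (\<Sum>b\<in>B. ent A C (m b)) + (\<Sum>k\<in>B. ent A C (n k))"
    using complementary_entropy[OF fin f(1) f(2) d, of "\<lambda>a b c. m b a c"] unfolding T_m n_def by simp
  moreover have "ent A (B \<times> C) (\<lambda>a y. m (fst y) a (snd y)) = ent A (B \<times> C) (\<lambda>a y. \<psi> a (fst y) (snd y))"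
  proof (rule ent_cong_gram)
    fix a a'
    have "(\<Sum>c\<in>C. \<Sum>b\<in>B. m b a c * cnj (m b a' c)) = (\<Sum>c\<in>C. \<Sum>b\<in>B. \<psi> a b c * cnj (\<psi> a' b c))"
      unfolding m ..
    then show "gram A (B \<times> C) (\<lambda>a y. m (fst y) a (snd y)) a a' = gram A (B \<times> C) (\<lambda>a y. \<psi> a (fst y) (snd y)) a a'"
      unfolding gram_def sum_Times fst_conv snd_conv by (simp only: sum.swap[of _ C B])
  qed (use fin in auto)
  moreover have "ent C (A \<times> B) (\<lambda>c x. m (snd x) (fst x) c) = ent C (A \<times> B) (\<lambda>c x. \<psi> (fst x) (snd x) c)"
    by (rule ent_cong_gram) (use fin in \<open>auto simp: gram_def sum_Times m\<close>)
  moreover have "(\<Sum>b\<in>B. eent A C (m b)) = (\<Sum>b\<in>B. ent A C (m b)) - ent B (A \<times> C) (\<lambda>b x. \<psi> (fst x) b (snd x))"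
    using ent_eq[OF _ e[unfolded G_def]] fin unfolding eent_def by (simp add: sum.distrib mass_m)
  moreover have "(\<Sum>b\<in>B. eent A C (n b)) = (\<Sum>b\<in>B. ent A C (n b)) + T * ln T - T * ln d"
  proof -
    have "(\<Sum>b\<in>B. eent A C (n b)) = (\<Sum>b\<in>B. ent A C (n b)) + d * (T / d * ln (T / d))"
      unfolding eent_def by (simp add: sum.distrib mass_n d_def)
    moreover have "T \<ge> 0" unfolding T_alt by (intro sum_nonneg) simp
    then have "d * (T / d * ln (T / d)) = T * ln T - T * ln d"
      using d by (cases "T = 0") (simp_all add: ln_div right_diff_distrib)
    ultimately show ?thesis by simp
  qed
  ultimately have "ent A (B \<times> C) (\<lambda>a y. \<psi> a (fst y) (snd y)) + ent C (A \<times> B) (\<lambda>c x. \<psi> (fst x) (snd x) c)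
        - ent B (A \<times> C) (\<lambda>b x. \<psi> (fst x) b (snd x)) + T * ln T
      \<le> (\<Sum>b\<in>B. eent A C (m b)) + (\<Sum>b\<in>B. eent A C (n b))" by linarith
  from that[OF m n this[unfolded T_def]] show thesis .
qed

section \<open>Matrices and von Neumann entropy\<close>

lemma ent_spec:
  assumes "finite V" "finite Y"
  obtains e \<mu> where "spec V V (gram V Y \<phi>) e \<mu>" "ent V Y \<phi> = - (\<Sum>i\<in>V. \<mu> i * ln (\<mu> i))"
    "\<And>i. i \<in> V \<Longrightarrow> 0 \<le> \<mu> i" "(\<Sum>i\<in>V. \<mu> i) = mass V Y \<phi>"
proof -
  obtain e \<mu> where e: "spec V V (gram V Y \<phi>) e \<mu>" using gram_spec_exists[OF assms(1)] by blast
  have "complex_of_real (mass V Y \<phi>) = (\<Sum>a\<in>V. gram V Y \<phi> a a)"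
    unfolding gram_def mass_def of_real_sum complex_norm_square ..
  then have "complex_of_real (\<Sum>i\<in>V. \<mu> i) = of_real (mass V Y \<phi>)"
    unfolding trace_spec[OF e] by simp
  then have "(\<Sum>i\<in>V. \<mu> i) = mass V Y \<phi>" unfolding of_real_eq_iff .
  with that[OF e ent_eq[OF assms(2) e] gram_spec_nonneg[OF e]] show thesis by blast
qed

text \<open>On the unit interval, -x ln x lies between 0 and 1. The crude upper bound suffices to
  make the supremum in the entanglement of assistance finite.\<close>

lemma ent_bounds:
  assumes fin: "finite V" "finite Y" and m: "mass V Y \<phi> = 1"
  shows "0 \<le> ent V Y \<phi>" "ent V Y \<phi> \<le> card V"
proof -
  obtain e \<mu> where s: "spec V V (gram V Y \<phi>) e \<mu>" "ent V Y \<phi> = - (\<Sum>i\<in>V. \<mu> i * ln (\<mu> i))"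
    "\<And>i. i \<in> V \<Longrightarrow> 0 \<le> \<mu> i" "(\<Sum>i\<in>V. \<mu> i) = mass V Y \<phi>" using ent_spec[OF fin] by blast
  have 1: "\<mu> i \<le> 1" if "i \<in> V" for i
    using member_le_sum[of i V \<mu>] s that fin m by auto
  have 2: "0 \<le> - (\<mu> i * ln (\<mu> i)) \<and> - (\<mu> i * ln (\<mu> i)) \<le> 1" if i: "i \<in> V" for i
  proof (cases "\<mu> i = 0")
    case False
    then have pos: "0 < \<mu> i" using s(3)[OF i] by simp
    have "- ln (\<mu> i) = ln (1 / \<mu> i)" using pos by (simp add: ln_div)
    also have "\<dots> \<le> 1 / \<mu> i - 1" using pos by (intro ln_le_minus_one) simp
    finally have "\<mu> i * - ln (\<mu> i) \<le> \<mu> i * (1 / \<mu> i - 1)" using pos by (intro mult_left_mono) auto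
    also have "\<dots> \<le> 1" using pos by (simp add: field_simps)
    finally have "- (\<mu> i * ln (\<mu> i)) \<le> 1" by simp
    moreover have "\<mu> i * ln (\<mu> i) \<le> 0" using pos 1[OF i] by (simp add: mult_nonneg_nonpos)
    ultimately show ?thesis by simp
  qed simp
  show "0 \<le> ent V Y \<phi>" unfolding s(2) sum_negf[symmetric] using 2 by (intro sum_nonneg) auto
  have "(\<Sum>i\<in>V. - (\<mu> i * ln (\<mu> i))) \<le> (\<Sum>i\<in>V. 1)" using 2 by (intro sum_mono) auto
  then show "ent V Y \<phi> \<le> card V" unfolding s(2) sum_negf[symmetric] by simp
qed

text \<open>Scaling the state by p multiplies its entropy by p and adds -p ln p, which the mass term
  p ln p of \<open>eent\<close> compensates.\<close>

lemma eent_scale: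
  assumes fin: "finite V" "finite Y" and m: "mass V Y \<phi> = 1" and p: "0 \<le> p"
  shows "eent V Y (\<lambda>x y. complex_of_real (sqrt p) * \<phi> x y) = p * ent V Y \<phi>"
proof -
  let ?\<phi> = "\<lambda>x y. complex_of_real (sqrt p) * \<phi> x y"
  obtain e \<mu> where s: "spec V V (gram V Y \<phi>) e \<mu>" "ent V Y \<phi> = - (\<Sum>i\<in>V. \<mu> i * ln (\<mu> i))"
    "\<And>i. i \<in> V \<Longrightarrow> 0 \<le> \<mu> i" "(\<Sum>i\<in>V. \<mu> i) = mass V Y \<phi>" using ent_spec[OF fin] by blast
  have sq: "complex_of_real (sqrt p) * complex_of_real (sqrt p) = of_real p"
    using p by (simp flip: of_real_mult)
  have "gram V Y ?\<phi> a b = of_real p * gram V Y \<phi> a b" for a b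
  proof -
    have "gram V Y ?\<phi> a b = (\<Sum>y\<in>Y. (complex_of_real (sqrt p) * complex_of_real (sqrt p)) * (\<phi> a y * cnj (\<phi> b y)))"
      unfolding gram_def by (simp add: mult_ac)
    then show ?thesis unfolding sq gram_def sum_distrib_left .
  qed
  then have "spec V V (gram V Y ?\<phi>) e (\<lambda>i. p * \<mu> i)"
    using s(1) unfolding spec_def by (simp add: sum_distrib_left mult_ac)
  then have 1: "ent V Y ?\<phi> = - (\<Sum>i\<in>V. p * \<mu> i * ln (p * \<mu> i))"
    by (rule ent_eq[OF fin(2)])
  have 2: "mass V Y ?\<phi> = p"
    using m p unfolding mass_def by (simp add: norm_mult power_mult_distrib flip: sum_distrib_left)
  show ?thesis
  proof (cases "p = 0")
    case True
    then show ?thesis unfolding eent_def 1 2 by simp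
  next
    case False
    then have p: "p > 0" using assms by simp
    have "(\<Sum>i\<in>V. p * \<mu> i * ln (p * \<mu> i)) = (\<Sum>i\<in>V. p * ln p * \<mu> i + p * (\<mu> i * ln (\<mu> i)))"
    proof (intro sum.cong refl)
      fix i assume "i \<in> V"
      then show "p * \<mu> i * ln (p * \<mu> i) = p * ln p * \<mu> i + p * (\<mu> i * ln (\<mu> i))"
        using p s(3)[of i] by (cases "\<mu> i = 0") (simp_all add: ln_mult algebra_simps)
    qed
    also have "\<dots> = p * ln p - p * ent V Y \<phi>"
      unfolding sum.distrib sum_distrib_left[symmetric] s(4) m s(2) by simp
    finally show ?thesis unfolding eent_def 1 2 by simp
  qed
qed

text \<open>This allows measurement outcomes of probability zero to stay in an ensemble.\<close>

lemma eent_mass_0: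
  assumes fin: "finite V" "finite Y" and m: "mass V Y \<phi> = 0"
  shows "eent V Y \<phi> = 0"
proof -
  obtain e \<mu> where s: "spec V V (gram V Y \<phi>) e \<mu>" "ent V Y \<phi> = - (\<Sum>i\<in>V. \<mu> i * ln (\<mu> i))"
    "\<And>i. i \<in> V \<Longrightarrow> 0 \<le> \<mu> i" "(\<Sum>i\<in>V. \<mu> i) = mass V Y \<phi>" using ent_spec[OF fin] by blast
  then have "\<forall>i\<in>V. \<mu> i = 0" using fin m by (simp add: sum_nonneg_eq_0_iff)
  then show ?thesis unfolding eent_def s(2) m by simp
qed

section \<open>Matrices, unitaries and the functional calculus\<close>

lemma mat_adjoint_index:
  fixes A :: "complex mat"
  assumes "A \<in> carrier_mat n m" "i < m" "j < n"
  shows "mat_adjoint A $$ (i, j) = cnj (A $$ (j, i))"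
  using assms unfolding mat_adjoint_def by (simp add: mat_of_rows_index)

lemma mat_adjoint_carrier:
  fixes A :: "complex mat"
  shows "A \<in> carrier_mat n m \<Longrightarrow> mat_adjoint A \<in> carrier_mat m n"
  unfolding mat_adjoint_def by (intro carrier_matI) simp_all

lemma unitary_diag_index:
  assumes U: "U \<in> carrier_mat n n" and ab: "a < n" "b < n"
  shows "(U * mat_diag n g * mat_adjoint U) $$ (a, b) = (\<Sum>i<n. g i * U $$ (a, i) * cnj (U $$ (b, i)))"
proof -
  have "(U * mat_diag n g * mat_adjoint U) $$ (a, b)
      = (\<Sum>i<n. (U * mat_diag n g) $$ (a, i) * mat_adjoint U $$ (i, b))"
    unfolding mat_diag_mult_right[OF U] using U ab mat_adjoint_carrier[OF U]
    by (simp add: scalar_prod_def atLeast0LessThan)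
  also have "\<dots> = (\<Sum>i<n. g i * U $$ (a, i) * cnj (U $$ (b, i)))"
    unfolding mat_diag_mult_right[OF U]
    using ab by (intro sum.cong refl) (simp add: mat_adjoint_index[OF U])
  finally show ?thesis .
qed

lemma unitary_mat_iff_onb:
  assumes U: "U \<in> carrier_mat n n"
  shows "unitary_mat n U \<longleftrightarrow> onb {..<n} {..<n} (\<lambda>i a. U $$ (a, i))"
proof -
  have 1: "(U * mat_adjoint U) $$ (a, b) = (\<Sum>i<n. U $$ (a, i) * cnj (U $$ (b, i)))" if "a < n" "b < n" for a b
    using unitary_diag_index[OF U that, of "\<lambda>_. 1"] U by simp
  have 2: "(mat_adjoint U * U) $$ (i, j) = ip {..<n} (\<lambda>a. U $$ (a, i)) (\<lambda>a. U $$ (a, j))" if "i < n" "j < n" for i j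
    using U that mat_adjoint_carrier[OF U]
    by (simp add: scalar_prod_def atLeast0LessThan ip_def mat_adjoint_index[OF U])
  have c: "U * mat_adjoint U \<in> carrier_mat n n" "mat_adjoint U * U \<in> carrier_mat n n"
    using U mat_adjoint_carrier[OF U] by auto
  have eq1: "M = 1\<^sub>m n \<longleftrightarrow> (\<forall>a<n. \<forall>b<n. M $$ (a, b) = (if a = b then 1 else 0))"
    if "M \<in> carrier_mat n n" for M :: "complex mat"
    using that by (auto intro!: eq_matI)
  show ?thesis unfolding unitary_mat_def onb_def eq1[OF c(1)] eq1[OF c(2)] using U by (auto simp: 1 2)
qed

text \<open>\<open>mat_fun\<close> chooses an unknown diagonalization. One exists by the spectral
  theorem, and whichever is chosen is a spectral decomposition of the reduced state, from which
  \<open>ent\<close> can be evaluated. Division by ln 2 passes from natural units to bits.\<close>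

lemma von_neumann_entropy_gram:
  assumes R: "R \<in> carrier_mat n n" and Y: "finite Y"
    and Rg: "\<And>a b. a < n \<Longrightarrow> b < n \<Longrightarrow> R $$ (a, b) = gram {..<n} Y \<phi> a b"
  shows "von_neumann_entropy R = ent {..<n} Y \<phi> / ln 2"
proof -
  have dim: "dim_row R = n" using R by simp
  obtain e \<mu> where e: "spec {..<n} {..<n} (gram {..<n} Y \<phi>) e \<mu>"
    using gram_spec_exists[of "{..<n}"] by blast
  define U where "U = mat n n (\<lambda>(a, i). e i a)"
  have U: "U \<in> carrier_mat n n" by (simp add: U_def)
  have "onb {..<n} {..<n} (\<lambda>i a. U $$ (a, i)) = onb {..<n} {..<n} e"
    unfolding onb_def ip_def by (simp add: U_def)
  then have uU: "unitary_mat n U" using unitary_mat_iff_onb[OF U] specD(1)[OF e] by simp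
  have RU: "R = U * mat_diag n (\<lambda>i. complex_of_real (\<mu> i)) * mat_adjoint U"
  proof (rule eq_matI)
    fix a b assume "a < dim_row (U * mat_diag n (\<lambda>i. complex_of_real (\<mu> i)) * mat_adjoint U)"
      "b < dim_col (U * mat_diag n (\<lambda>i. complex_of_real (\<mu> i)) * mat_adjoint U)"
    then have "a < n" "b < n" using U mat_adjoint_carrier[OF U] by auto
    then show "R $$ (a, b) = (U * mat_diag n (\<lambda>i. complex_of_real (\<mu> i)) * mat_adjoint U) $$ (a, b)"
      using specD(2)[OF e, of a b] Rg unitary_diag_index[OF U] by (simp add: U_def)
  qed (use R U mat_adjoint_carrier[OF U] in auto)
  have "\<exists>V \<nu>. unitary_mat (dim_row R) V \<and>
      R = V * mat_diag (dim_row R) (\<lambda>i. complex_of_real (\<nu> i)) * mat_adjoint V \<and>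
      mat_fun (log 2) R = V * mat_diag (dim_row R) (\<lambda>i. complex_of_real (log 2 (\<nu> i))) * mat_adjoint V"
    unfolding mat_fun_def dim by (rule someI_ex) (use uU RU in blast)
  then obtain V \<nu> where V: "unitary_mat n V"
    "R = V * mat_diag n (\<lambda>i. complex_of_real (\<nu> i)) * mat_adjoint V"
    "mat_fun (log 2) R = V * mat_diag n (\<lambda>i. complex_of_real (log 2 (\<nu> i))) * mat_adjoint V"
    unfolding dim by blast
  have Vc: "V \<in> carrier_mat n n" "mat_adjoint V * V = 1\<^sub>m n" using V(1) by (auto simp: unitary_mat_def)
  have oV: "onb {..<n} {..<n} (\<lambda>i a. V $$ (a, i))" using unitary_mat_iff_onb[OF Vc(1)] V(1) by simp
  note Vs = mat_adjoint_carrier[OF Vc(1)]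
  have RV: "spec {..<n} {..<n} (gram {..<n} Y \<phi>) (\<lambda>i a. V $$ (a, i)) \<nu>"
    unfolding spec_def using oV Rg unitary_diag_index[OF Vc(1)] V(2) by auto
  \<comment> \<open>Reassociation that exposes the adjoint of \<open>V\<close> times
    \<open>V\<close>, which is the identity.\<close>
  have alg: "(M * D * L) * (M * D' * L) = M * (D * ((L * M) * (D' * L)))"
    if "M \<in> carrier_mat n n" "D \<in> carrier_mat n n" "L \<in> carrier_mat n n" "D' \<in> carrier_mat n n"
    for M D L D' :: "complex mat"
    using that by (simp add: assoc_mult_mat[of _ n n _ n _ n] mult_carrier_mat[of _ n n _ n])
  have "R * mat_fun (log 2) R
      = V * (mat_diag n (\<lambda>i. complex_of_real (\<nu> i)) * ((mat_adjoint V * V) * (mat_diag n (\<lambda>i. complex_of_real (log 2 (\<nu> i))) * mat_adjoint V)))"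
    unfolding V(3) by (subst V(2), rule alg) (use Vc Vs in auto)
  also have "\<dots> = V * mat_diag n (\<lambda>i. complex_of_real (\<nu> i * log 2 (\<nu> i))) * mat_adjoint V"
  proof -
    have "mat_diag n (\<lambda>i. complex_of_real (\<nu> i)) * ((mat_adjoint V * V) * (mat_diag n (\<lambda>i. complex_of_real (log 2 (\<nu> i))) * mat_adjoint V))
        = (mat_diag n (\<lambda>i. complex_of_real (\<nu> i)) * mat_diag n (\<lambda>i. complex_of_real (log 2 (\<nu> i)))) * mat_adjoint V"
      unfolding Vc(2) using Vs
      by (simp add: assoc_mult_mat[of _ n n _ n _ n] mult_carrier_mat[of _ n n _ n]
          left_mult_one_mat[of _ n n] del: mat_diag_diag)
    then show ?thesis using Vc Vs by (simp add: assoc_mult_mat[of _ n n _ n _ n])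
  qed
  finally have RB: "R * mat_fun (log 2) R = V * mat_diag n (\<lambda>i. complex_of_real (\<nu> i * log 2 (\<nu> i))) * mat_adjoint V" .
  have "spec {..<n} {..<n} (\<lambda>a b. (R * mat_fun (log 2) R) $$ (a, b)) (\<lambda>i a. V $$ (a, i)) (\<lambda>i. \<nu> i * log 2 (\<nu> i))"
    unfolding spec_def RB using oV unitary_diag_index[OF Vc(1)] by simp
  from trace_spec[OF this]
  have "mat_trace (R * mat_fun (log 2) R) = of_real (\<Sum>i<n. \<nu> i * log 2 (\<nu> i))"
    unfolding mat_trace_def using R by simp
  then have "von_neumann_entropy R = - (\<Sum>i<n. \<nu> i * log 2 (\<nu> i))"
    unfolding von_neumann_entropy_def by simp
  also have "\<dots> = ent {..<n} Y \<phi> / ln 2"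
    unfolding ent_eq[OF Y RV] by (simp add: log_def sum_divide_distrib)
  finally show ?thesis .
qed

section \<open>Product indices and coefficient arrays of vectors\<close>

lemma mult_add_less:
  fixes x y m n :: nat
  assumes "x < m" "y < n"
  shows "x * n + y < m * n"
proof -
  have "x * n + y < Suc x * n" using assms by simp
  also have "\<dots> \<le> m * n" using assms by (intro mult_le_mono1) simp
  finally show ?thesis .
qed

lemma sum_lessThan_mult: "(\<Sum>y<m * n. g y) = (\<Sum>b<m. \<Sum>c<n. g (b * n + c :: nat))"
proof -
  have "(\<Sum>y<m * n. g y) = (\<Sum>b<m. \<Sum>y\<in>{b * n..<b * n + n}. g y)"
    by (rule sum.nat_group[symmetric])
  also have "\<dots> = (\<Sum>b<m. \<Sum>c<n. g (b * n + c))"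
    using sum.shift_bounds_nat_ivl[of g 0 "_ * n" n] by (simp add: atLeast0LessThan add.commute)
  finally show ?thesis .
qed

definition amp :: "nat \<Rightarrow> complex vec \<Rightarrow> nat \<Rightarrow> nat \<Rightarrow> complex" where
  "amp dY v x y = v $ (x * dY + y)"

lemma entanglement_entropy_ent:
  assumes "v \<in> carrier_vec (dX * dY)"
  shows "entanglement_entropy dX dY v = ent {..<dX} {..<dY} (amp dY v) / ln 2"
  unfolding entanglement_entropy_def
  by (rule von_neumann_entropy_gram)
    (use assms in \<open>auto simp: partial_trace_snd_def ketbra_def gram_def amp_def mult_add_less\<close>)

lemma mass_amp:
  assumes "v \<in> carrier_vec (dX * dY)"
  shows "complex_of_real (mass {..<dX} {..<dY} (amp dY v)) = v \<bullet>c v"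
  using assms unfolding mass_def amp_def of_real_sum complex_norm_square
  by (simp add: scalar_prod_def atLeast0LessThan sum_lessThan_mult mult_add_less)

section \<open>Ensembles\<close>

text \<open>The kernel identities say that \<open>m\<close> and \<open>n\<close> decompose the
  reduced operator on AC, and \<open>m'\<close> and \<open>n'\<close> the one on AB. They are
  unnormalized, so that the families belonging to the different vectors of an ensemble can be
  joined.\<close>

lemma pure_polygamy:
  fixes \<psi> :: "'a \<Rightarrow> 'b \<Rightarrow> 'c \<Rightarrow> complex"
  assumes fin: "finite A" "finite B" "finite C" and ne: "B \<noteq> {}" "C \<noteq> {}"
  obtains m n :: "'b \<Rightarrow> 'a \<Rightarrow> 'c \<Rightarrow> complex" and m' n' :: "'c \<Rightarrow> 'a \<Rightarrow> 'b \<Rightarrow> complex"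
  where "\<And>a c a' c'. (\<Sum>b\<in>B. m b a c * cnj (m b a' c')) = (\<Sum>b\<in>B. \<psi> a b c * cnj (\<psi> a' b c'))"
    and "\<And>a c a' c'. (\<Sum>b\<in>B. n b a c * cnj (n b a' c')) = (\<Sum>b\<in>B. \<psi> a b c * cnj (\<psi> a' b c'))"
    and "\<And>a b a' b'. (\<Sum>c\<in>C. m' c a b * cnj (m' c a' b')) = (\<Sum>c\<in>C. \<psi> a b c * cnj (\<psi> a' b' c))"
    and "\<And>a b a' b'. (\<Sum>c\<in>C. n' c a b * cnj (n' c a' b')) = (\<Sum>c\<in>C. \<psi> a b c * cnj (\<psi> a' b' c))"
    and "2 * eent A (B \<times> C) (\<lambda>a y. \<psi> a (fst y) (snd y))
      \<le> (\<Sum>b\<in>B. eent A C (m b)) + (\<Sum>b\<in>B. eent A C (n b)) + (\<Sum>c\<in>C. eent A B (m' c)) + (\<Sum>c\<in>C. eent A B (n' c))"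
proof -
  define \<psi>' where "\<psi>' = (\<lambda>a c b. \<psi> a b c)"
  obtain m n :: "'b \<Rightarrow> 'a \<Rightarrow> 'c \<Rightarrow> complex" where mn:
    "\<And>a c a' c'. (\<Sum>b\<in>B. m b a c * cnj (m b a' c')) = (\<Sum>b\<in>B. \<psi> a b c * cnj (\<psi> a' b c'))"
    "\<And>a c a' c'. (\<Sum>b\<in>B. n b a c * cnj (n b a' c')) = (\<Sum>b\<in>B. \<psi> a b c * cnj (\<psi> a' b c'))"
    "ent A (B \<times> C) (\<lambda>a y. \<psi> a (fst y) (snd y)) + ent C (A \<times> B) (\<lambda>c x. \<psi> (fst x) (snd x) c)
        - ent B (A \<times> C) (\<lambda>b x. \<psi> (fst x) b (snd x))
        + mass A (B \<times> C) (\<lambda>a y. \<psi> a (fst y) (snd y)) * ln (mass A (B \<times> C) (\<lambda>a y. \<psi> a (fst y) (snd y)))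
      \<le> (\<Sum>b\<in>B. eent A C (m b)) + (\<Sum>b\<in>B. eent A C (n b))"
    using assistance_lower_bound[OF fin ne(1), of \<psi>] by blast
  obtain m' n' :: "'c \<Rightarrow> 'a \<Rightarrow> 'b \<Rightarrow> complex" where mn':
    "\<And>a c a' c'. (\<Sum>b\<in>C. m' b a c * cnj (m' b a' c')) = (\<Sum>b\<in>C. \<psi>' a b c * cnj (\<psi>' a' b c'))"
    "\<And>a c a' c'. (\<Sum>b\<in>C. n' b a c * cnj (n' b a' c')) = (\<Sum>b\<in>C. \<psi>' a b c * cnj (\<psi>' a' b c'))"
    "ent A (C \<times> B) (\<lambda>a y. \<psi>' a (fst y) (snd y)) + ent B (A \<times> C) (\<lambda>c x. \<psi>' (fst x) (snd x) c)
        - ent C (A \<times> B) (\<lambda>b x. \<psi>' (fst x) b (snd x))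
        + mass A (C \<times> B) (\<lambda>a y. \<psi>' a (fst y) (snd y)) * ln (mass A (C \<times> B) (\<lambda>a y. \<psi>' a (fst y) (snd y)))
      \<le> (\<Sum>b\<in>C. eent A B (m' b)) + (\<Sum>b\<in>C. eent A B (n' b))"
    using assistance_lower_bound[OF fin(1,3,2) ne(2), of \<psi>'] by blast
  have 1: "ent A (C \<times> B) (\<lambda>a y. \<psi>' a (fst y) (snd y)) = ent A (B \<times> C) (\<lambda>a y. \<psi> a (fst y) (snd y))"
    by (rule ent_cong_gram) (use fin in \<open>auto simp: gram_def sum_Times \<psi>'_def intro: sum.swap\<close>)
  have 2: "mass A (C \<times> B) (\<lambda>a y. \<psi>' a (fst y) (snd y)) = mass A (B \<times> C) (\<lambda>a y. \<psi> a (fst y) (snd y))"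
    unfolding mass_def sum_Times \<psi>'_def fst_conv snd_conv by (intro sum.cong refl sum.swap)
  \<comment> \<open>\<open>x\<close>, \<open>y\<close>, \<open>z\<close> are the entropies of A, C
    and B, and \<open>w\<close> is the mass term; exchanging B and C flips the sign of
    \<open>y - z\<close>.\<close>
  have lin: "2 * (x + w) \<le> p + q" if "x + y - z + w \<le> p" "x + z - y + w \<le> q" for x y z w p q :: real
    using that by (simp add: algebra_simps)
  have "2 * eent A (B \<times> C) (\<lambda>a y. \<psi> a (fst y) (snd y))
      \<le> (\<Sum>b\<in>B. eent A C (m b)) + (\<Sum>b\<in>B. eent A C (n b)) + (\<Sum>c\<in>C. eent A B (m' c)) + (\<Sum>c\<in>C. eent A B (n' c))"
    using lin[OF mn(3) mn'(3)[unfolded 1 2, unfolded \<psi>'_def]]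
    unfolding eent_def[of A "B \<times> C"] by (simp add: add.assoc)
  from that[OF mn(1,2) mn'(1,2)[unfolded \<psi>'_def] this] show thesis .
qed

text \<open>A pure-state decomposition in which the weights are absorbed into the vectors; unlike
  \<open>pure_decomposition\<close>, it may contain zero vectors.\<close>
definition ensemble :: "nat \<Rightarrow> nat \<Rightarrow> complex mat \<Rightarrow> 's set \<Rightarrow> ('s \<Rightarrow> nat \<Rightarrow> nat \<Rightarrow> complex) \<Rightarrow> bool" where
  "ensemble dX dY \<rho> S \<phi> \<longleftrightarrow> finite S \<and> \<rho> \<in> carrier_mat (dX * dY) (dX * dY) \<and>
     (\<Sum>s\<in>S. mass {..<dX} {..<dY} (\<phi> s)) = 1 \<and>
     (\<forall>x<dX. \<forall>y<dY. \<forall>x'<dX. \<forall>y'<dY.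
        \<rho> $$ (x * dY + y, x' * dY + y') = (\<Sum>s\<in>S. \<phi> s x y * cnj (\<phi> s x' y')))"

definition assist_values :: "nat \<Rightarrow> nat \<Rightarrow> complex mat \<Rightarrow> real set" where
  "assist_values dX dY \<rho> = {(\<Sum>i<m. p i * entanglement_entropy dX dY (\<psi> i)) | m p \<psi>.
     pure_decomposition (dX * dY) \<rho> m p \<psi>}"

lemma entanglement_of_assistance_Sup: "entanglement_of_assistance dX dY \<rho> = Sup (assist_values dX dY \<rho>)"
  unfolding entanglement_of_assistance_def assist_values_def ..

lemma pure_decomposition_unit:
  assumes "pure_decomposition (dX * dY) \<rho> m p \<psi>" "i < m"
  shows "mass {..<dX} {..<dY} (amp dY (\<psi> i)) = 1" "0 \<le> p i" "\<psi> i \<in> carrier_vec (dX * dY)"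
proof -
  show c: "\<psi> i \<in> carrier_vec (dX * dY)" and "0 \<le> p i"
    using assms unfolding pure_decomposition_def by auto
  have "complex_of_real (mass {..<dX} {..<dY} (amp dY (\<psi> i))) = 1"
    unfolding mass_amp[OF c] using assms unfolding pure_decomposition_def by auto
  then show "mass {..<dX} {..<dY} (amp dY (\<psi> i)) = 1" by simp
qed

lemma assist_values_bounds:
  assumes "v \<in> assist_values dX dY \<rho>"
  shows "0 \<le> v" "v \<le> dX / ln 2"
proof -
  obtain m p \<psi> where d: "pure_decomposition (dX * dY) \<rho> m p \<psi>"
    and v: "v = (\<Sum>i<m. p i * entanglement_entropy dX dY (\<psi> i))"
    using assms unfolding assist_values_def by blast
  note u = pure_decomposition_unit[OF d]
  have e: "0 \<le> entanglement_entropy dX dY (\<psi> i) \<and> entanglement_entropy dX dY (\<psi> i) \<le> dX / ln 2" if "i < m" for i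
    using ent_bounds[OF _ _ u(1)[OF that]] unfolding entanglement_entropy_ent[OF u(3)[OF that]]
    by (simp add: divide_right_mono)
  show "0 \<le> v" unfolding v using e u(2) by (intro sum_nonneg) simp
  have "v \<le> (\<Sum>i<m. p i * (dX / ln 2))"
    unfolding v using e u(2) by (intro sum_mono mult_left_mono) auto
  also have "\<dots> = dX / ln 2"
    using d unfolding pure_decomposition_def by (simp flip: sum_distrib_right sum_divide_distrib)
  finally show "v \<le> dX / ln 2" .
qed

lemma ensemble_of_decomposition:
  assumes d: "pure_decomposition (dX * dY) \<rho> m p \<psi>"
  defines "\<phi> \<equiv> \<lambda>i x y. complex_of_real (sqrt (p i)) * amp dY (\<psi> i) x y"
  shows "ensemble dX dY \<rho> {..<m} \<phi>"
    and "(\<Sum>i<m. p i * entanglement_entropy dX dY (\<psi> i)) = (\<Sum>i<m. eent {..<dX} {..<dY} (\<phi> i)) / ln 2"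
proof -
  note u = pure_decomposition_unit[OF d]
  have sq: "complex_of_real (sqrt (p i)) * complex_of_real (sqrt (p i)) = of_real (p i)" if "i < m" for i
    using u(2)[OF that] by (simp flip: of_real_mult)
  have mass: "mass {..<dX} {..<dY} (\<phi> i) = p i" if "i < m" for i
  proof -
    have "mass {..<dX} {..<dY} (\<phi> i) = p i * mass {..<dX} {..<dY} (amp dY (\<psi> i))"
      unfolding mass_def \<phi>_def using u(2)[OF that]
      by (simp add: norm_mult power_mult_distrib sum_distrib_left)
    then show ?thesis using u(1)[OF that] by simp
  qed
  have "\<rho> $$ (x * dY + y, x' * dY + y') = (\<Sum>i<m. \<phi> i x y * cnj (\<phi> i x' y'))"
    if xy: "x < dX" "y < dY" "x' < dX" "y' < dY" for x y x' y'
  proof -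
    have "\<rho> $$ (x * dY + y, x' * dY + y')
        = (\<Sum>i<m. complex_of_real (p i) * ketbra (\<psi> i) $$ (x * dY + y, x' * dY + y'))"
      using d xy mult_add_less unfolding pure_decomposition_def by simp
    also have "\<dots> = (\<Sum>i<m. \<phi> i x y * cnj (\<phi> i x' y'))"
    proof (intro sum.cong refl)
      fix i assume "i \<in> {..<m}"
      then have i: "i < m" by simp
      have "ketbra (\<psi> i) $$ (x * dY + y, x' * dY + y') = amp dY (\<psi> i) x y * cnj (amp dY (\<psi> i) x' y')"
        using u(3)[OF i] xy mult_add_less by (simp add: ketbra_def amp_def)
      then show "complex_of_real (p i) * ketbra (\<psi> i) $$ (x * dY + y, x' * dY + y') = \<phi> i x y * cnj (\<phi> i x' y')"
        unfolding \<phi>_def sq[OF i, symmetric] by simp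
    qed
    finally show ?thesis .
  qed
  then show "ensemble dX dY \<rho> {..<m} \<phi>"
    using d mass unfolding ensemble_def pure_decomposition_def by simp
  show "(\<Sum>i<m. p i * entanglement_entropy dX dY (\<psi> i)) = (\<Sum>i<m. eent {..<dX} {..<dY} (\<phi> i)) / ln 2"
    unfolding sum_divide_distrib
  proof (intro sum.cong refl)
    fix i assume "i \<in> {..<m}"
    then have i: "i < m" by simp
    show "p i * entanglement_entropy dX dY (\<psi> i) = eent {..<dX} {..<dY} (\<phi> i) / ln 2"
      unfolding \<phi>_def eent_scale[OF _ _ u(1,2)[OF i], simplified] entanglement_entropy_ent[OF u(3)[OF i]] by simp
  qed
qed

text \<open>Vectors of zero mass are discarded, the others are normalized and numbered. The
  discarded ones change neither the operator nor the sum, so a genuine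
  \<open>pure_decomposition\<close> with the same value results.\<close>

lemma ensemble_assist_value:
  assumes e: "ensemble dX dY \<rho> S \<phi>"
  shows "(\<Sum>s\<in>S. eent {..<dX} {..<dY} (\<phi> s)) / ln 2 \<in> assist_values dX dY \<rho>"
proof -
  let ?M = "\<lambda>s. mass {..<dX} {..<dY} (\<phi> s)"
  have fin: "finite S" and \<rho>: "\<rho> \<in> carrier_mat (dX * dY) (dX * dY)" and m1: "(\<Sum>s\<in>S. ?M s) = 1"
    and ent: "\<And>x y x' y'. x < dX \<Longrightarrow> y < dY \<Longrightarrow> x' < dX \<Longrightarrow> y' < dY \<Longrightarrow>
        \<rho> $$ (x * dY + y, x' * dY + y') = (\<Sum>s\<in>S. \<phi> s x y * cnj (\<phi> s x' y'))"
    using e unfolding ensemble_def by auto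
  have M0: "0 \<le> ?M s" for s unfolding mass_def by (intro sum_nonneg) simp
  define S' where "S' = {s\<in>S. ?M s \<noteq> 0}"
  define k where "k = card S'"
  have finS': "finite S'" using fin by (simp add: S'_def)
  obtain h where h: "bij_betw h {..<k} S'"
    using ex_bij_betw_nat_finite[OF finS'] unfolding k_def atLeast0LessThan by blast
  have hS: "h i \<in> S" "?M (h i) > 0" if "i < k" for i
  proof -
    have "h i \<in> S'" using h that by (auto simp: bij_betw_def)
    then show "h i \<in> S" "?M (h i) > 0" using M0[of "h i"] by (auto simp: S'_def)
  qed
  have reidx: "(\<Sum>s\<in>S. g s) = (\<Sum>i<k. g (h i))" if "\<And>s. s \<in> S \<Longrightarrow> ?M s = 0 \<Longrightarrow> g s = 0"
    for g :: "_ \<Rightarrow> 'x::comm_monoid_add"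
  proof -
    have "(\<Sum>s\<in>S. g s) = (\<Sum>s\<in>S'. g s)"
      using fin that by (intro sum.mono_neutral_right) (auto simp: S'_def)
    then show ?thesis using sum.reindex_bij_betw[OF h, of g] by simp
  qed
  define p where "p = (\<lambda>i. ?M (h i))"
  define \<psi> where "\<psi> = (\<lambda>i. vec (dX * dY) (\<lambda>r. \<phi> (h i) (r div dY) (r mod dY) / complex_of_real (sqrt (p i))))"
  have \<psi>c: "\<psi> i \<in> carrier_vec (dX * dY)" for i by (simp add: \<psi>_def)
  have amp: "amp dY (\<psi> i) x y = \<phi> (h i) x y / complex_of_real (sqrt (p i))" if "x < dX" "y < dY" for i x y
    unfolding amp_def \<psi>_def using that mult_add_less[OF that] by simp
  have unit: "mass {..<dX} {..<dY} (amp dY (\<psi> i)) = 1" if "i < k" for i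
  proof -
    have "mass {..<dX} {..<dY} (amp dY (\<psi> i)) = ?M (h i) / p i"
      unfolding mass_def[of _ _ "amp dY (\<psi> i)"] mass_def[of _ _ "\<phi> (h i)"] sum_divide_distrib
      using hS(2)[OF that] by (intro sum.cong refl) (simp add: amp norm_divide power_divide p_def)
    then show ?thesis using hS(2)[OF that] by (simp add: p_def)
  qed
  have rescale: "complex_of_real (sqrt (p i)) * amp dY (\<psi> i) x y = \<phi> (h i) x y"
    if "i < k" "x < dX" "y < dY" for i x y
    using amp[OF that(2,3), of i] hS(2)[OF that(1)] by (simp add: p_def)
  have zero: "\<phi> s x y = 0" if "s \<in> S" "?M s = 0" "x < dX" "y < dY" for s x y
  proof -
    have "(\<Sum>c<dY. (cmod (\<phi> s x c))\<^sup>2) = 0"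
      using that(2,3) unfolding mass_def by (subst (asm) sum_nonneg_eq_0_iff) (auto intro: sum_nonneg)
    then show ?thesis using that(4) by (subst (asm) sum_nonneg_eq_0_iff) auto
  qed
  have dec: "pure_decomposition (dX * dY) \<rho> k p \<psi>"
    unfolding pure_decomposition_def
  proof (intro conjI allI impI)
    show "0 \<le> p i" for i unfolding p_def by (rule M0)
    show "(\<Sum>i<k. p i) = 1" unfolding p_def m1[symmetric] by (rule reidx[symmetric])
    show "\<psi> i \<in> carrier_vec (dX * dY)" for i by (rule \<psi>c)
    show "\<psi> i \<bullet>c \<psi> i = 1" if "i < k" for i
      unfolding mass_amp[OF \<psi>c, symmetric] using unit[OF that] by simp
    show "\<rho> = mat (dX * dY) (dX * dY) (\<lambda>(r, c). \<Sum>i<k. complex_of_real (p i) * ketbra (\<psi> i) $$ (r, c))"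
    proof (rule eq_matI)
      fix r c assume "r < dim_row (mat (dX * dY) (dX * dY) (\<lambda>(r, c). \<Sum>i<k. complex_of_real (p i) * ketbra (\<psi> i) $$ (r, c)))"
        "c < dim_col (mat (dX * dY) (dX * dY) (\<lambda>(r, c). \<Sum>i<k. complex_of_real (p i) * ketbra (\<psi> i) $$ (r, c)))"
      then have rc: "r < dX * dY" "c < dX * dY" by auto
      then have Y: "dY > 0" by (cases dY) auto
      define x y x' y' where "x = r div dY" "y = r mod dY" "x' = c div dY" "y' = c mod dY"
      note xy_def = this
      have xy: "x < dX" "y < dY" "x' < dX" "y' < dY" "r = x * dY + y" "c = x' * dY + y'"
        using rc Y unfolding xy_def by (auto simp: less_mult_imp_div_less)
      have "\<rho> $$ (r, c) = (\<Sum>s\<in>S. \<phi> s x y * cnj (\<phi> s x' y'))"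
        unfolding xy(5,6) by (rule ent) (use xy in auto)
      also have "\<dots> = (\<Sum>i<k. \<phi> (h i) x y * cnj (\<phi> (h i) x' y'))"
        by (rule reidx) (use zero xy in auto)
      also have "\<dots> = (\<Sum>i<k. complex_of_real (p i) * ketbra (\<psi> i) $$ (r, c))"
      proof (intro sum.cong refl)
        fix i assume "i \<in> {..<k}"
        then have i: "i < k" by simp
        have sq: "complex_of_real (sqrt (p i)) * complex_of_real (sqrt (p i)) = of_real (p i)"
          using M0 by (simp add: p_def flip: of_real_mult)
        have "ketbra (\<psi> i) $$ (r, c) = amp dY (\<psi> i) x y * cnj (amp dY (\<psi> i) x' y')"
          using \<psi>c[of i] rc by (simp add: ketbra_def amp_def flip: xy(5,6))
        then show "\<phi> (h i) x y * cnj (\<phi> (h i) x' y') = complex_of_real (p i) * ketbra (\<psi> i) $$ (r, c)"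
          unfolding rescale[OF i xy(1,2), symmetric] rescale[OF i xy(3,4), symmetric] sq[symmetric] by simp
      qed
      finally show "\<rho> $$ (r, c) = mat (dX * dY) (dX * dY) (\<lambda>(r, c). \<Sum>i<k. complex_of_real (p i) * ketbra (\<psi> i) $$ (r, c)) $$ (r, c)"
        using rc by simp
    qed (use \<rho> in auto)
  qed
  have "(\<Sum>s\<in>S. eent {..<dX} {..<dY} (\<phi> s)) = (\<Sum>i<k. eent {..<dX} {..<dY} (\<phi> (h i)))"
    by (rule reidx) (simp add: eent_mass_0)
  also have "\<dots> = (\<Sum>i<k. eent {..<dX} {..<dY} (\<lambda>x y. complex_of_real (sqrt (p i)) * amp dY (\<psi> i) x y))"
  proof (intro sum.cong refl)
    fix i assume "i \<in> {..<k}"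
    then have b: "\<phi> (h i) x y = complex_of_real (sqrt (p i)) * amp dY (\<psi> i) x y" if "x < dX" "y < dY" for x y
      using rescale that by simp
    have "ent {..<dX} {..<dY} (\<phi> (h i)) = ent {..<dX} {..<dY} (\<lambda>x y. complex_of_real (sqrt (p i)) * amp dY (\<psi> i) x y)"
      by (rule ent_cong_gram) (auto simp: gram_def b)
    moreover have "mass {..<dX} {..<dY} (\<phi> (h i)) = mass {..<dX} {..<dY} (\<lambda>x y. complex_of_real (sqrt (p i)) * amp dY (\<psi> i) x y)"
      unfolding mass_def by (simp add: b)
    ultimately show "eent {..<dX} {..<dY} (\<phi> (h i)) = eent {..<dX} {..<dY} (\<lambda>x y. complex_of_real (sqrt (p i)) * amp dY (\<psi> i) x y)"
      unfolding eent_def by simp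
  qed
  finally have "(\<Sum>s\<in>S. eent {..<dX} {..<dY} (\<phi> s)) / ln 2 = (\<Sum>i<k. p i * entanglement_entropy dX dY (\<psi> i))"
    unfolding ensemble_of_decomposition(2)[OF dec] by simp
  then show ?thesis unfolding assist_values_def using dec by blast
qed

lemma ensemble_le_assistance:
  assumes "ensemble dX dY \<rho> S \<phi>"
  shows "(\<Sum>s\<in>S. eent {..<dX} {..<dY} (\<phi> s)) / ln 2 \<le> entanglement_of_assistance dX dY \<rho>"
  unfolding entanglement_of_assistance_Sup
  by (rule cSup_upper[OF ensemble_assist_value[OF assms]])
    (rule bdd_aboveI, erule assist_values_bounds(2))

lemma assistance_nonneg:
  assumes "ensemble dX dY \<rho> S \<phi>"
  shows "0 \<le> entanglement_of_assistance dX dY \<rho>"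
  using assist_values_bounds(1)[OF ensemble_assist_value[OF assms]] ensemble_le_assistance[OF assms] by simp

text \<open>The given ensemble shows that the supremum is over a nonempty set; the bound is then
  checked on ensembles indexed by an initial segment, the shape that decompositions provide.\<close>

lemma assistance_le:
  assumes "ensemble dX dY \<rho> S \<phi>"
    and "\<And>m (\<phi> :: nat \<Rightarrow> _). ensemble dX dY \<rho> {..<m} \<phi> \<Longrightarrow> (\<Sum>i<m. eent {..<dX} {..<dY} (\<phi> i)) / ln 2 \<le> K"
  shows "entanglement_of_assistance dX dY \<rho> \<le> K"
  unfolding entanglement_of_assistance_Sup
proof (rule cSup_least)
  show "assist_values dX dY \<rho> \<noteq> {}" using ensemble_assist_value[OF assms(1)] by blast
  fix v assume "v \<in> assist_values dX dY \<rho>"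
  then obtain m p \<psi> where d: "pure_decomposition (dX * dY) \<rho> m p \<psi>"
    and v: "v = (\<Sum>i<m. p i * entanglement_entropy dX dY (\<psi> i))"
    unfolding assist_values_def by blast
  show "v \<le> K" unfolding v ensemble_of_decomposition(2)[OF d]
    by (rule assms(2)[OF ensemble_of_decomposition(1)[OF d]])
qed

section \<open>Polygamy for three parties\<close>

lemma eent_nested:
  fixes dA dB dC :: nat
  shows "eent {..<dA} {..<dB * dC} \<phi> = eent {..<dA} ({..<dB} \<times> {..<dC}) (\<lambda>a y. \<phi> a (fst y * dC + snd y))"
proof -
  have "ent {..<dA} {..<dB * dC} \<phi> = ent {..<dA} ({..<dB} \<times> {..<dC}) (\<lambda>a y. \<phi> a (fst y * dC + snd y))"
    by (rule ent_cong_gram) (auto simp: gram_def sum_Times sum_lessThan_mult)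
  moreover have "mass {..<dA} {..<dB * dC} \<phi> = mass {..<dA} ({..<dB} \<times> {..<dC}) (\<lambda>a y. \<phi> a (fst y * dC + snd y))"
    by (simp add: mass_def sum_Times sum_lessThan_mult)
  ultimately show ?thesis by (simp add: eent_def)
qed

lemma mass_eq_of_kernel:
  assumes "\<And>a y. a < dA \<Longrightarrow> y < dY \<Longrightarrow> (\<Sum>k\<in>K. F k a y * cnj (F k a y)) = (\<Sum>l\<in>L. G l a y * cnj (G l a y))"
  shows "(\<Sum>k\<in>K. mass {..<dA} {..<dY} (F k)) = (\<Sum>l\<in>L. mass {..<dA} {..<dY} (G l))"
proof -
  have sw: "(\<Sum>k\<in>M. mass {..<dA} {..<dY} (H k)) = (\<Sum>a<dA. \<Sum>y<dY. \<Sum>k\<in>M. (cmod (H k a y))\<^sup>2)" for M and H :: "_ \<Rightarrow> _"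
    unfolding mass_def by (subst sum.swap, intro sum.cong refl sum.swap)
  have "(\<Sum>k\<in>K. (cmod (F k a y))\<^sup>2) = (\<Sum>l\<in>L. (cmod (G l a y))\<^sup>2)" if "a < dA" "y < dY" for a y
  proof -
    have "complex_of_real (\<Sum>k\<in>K. (cmod (F k a y))\<^sup>2) = complex_of_real (\<Sum>l\<in>L. (cmod (G l a y))\<^sup>2)"
      unfolding of_real_sum complex_norm_square by (rule assms[OF that])
    then show ?thesis unfolding of_real_eq_iff .
  qed
  then show ?thesis unfolding sw by simp
qed

text \<open>As relations between matrices, this notion and \<open>trace_out_middle\<close> fit both
  an explicitly built matrix and \<open>reduced_AB\<close>, which occur side by side in the
  induction over the parties.\<close>

definition trace_out_last :: "nat \<Rightarrow> nat \<Rightarrow> nat \<Rightarrow> complex mat \<Rightarrow> complex mat \<Rightarrow> bool" where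
  "trace_out_last dA dB dC \<rho> \<rho>' \<longleftrightarrow> \<rho>' \<in> carrier_mat (dA * dB) (dA * dB) \<and>
     (\<forall>a<dA. \<forall>b<dB. \<forall>a'<dA. \<forall>b'<dB. \<rho>' $$ (a * dB + b, a' * dB + b') =
        (\<Sum>c<dC. \<rho> $$ (a * (dB * dC) + (b * dC + c), a' * (dB * dC) + (b' * dC + c))))"

definition trace_out_middle :: "nat \<Rightarrow> nat \<Rightarrow> nat \<Rightarrow> complex mat \<Rightarrow> complex mat \<Rightarrow> bool" where
  "trace_out_middle dA dB dC \<rho> \<rho>' \<longleftrightarrow> \<rho>' \<in> carrier_mat (dA * dC) (dA * dC) \<and>
     (\<forall>a<dA. \<forall>c<dC. \<forall>a'<dA. \<forall>c'<dC. \<rho>' $$ (a * dC + c, a' * dC + c') =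
        (\<Sum>b<dB. \<rho> $$ (a * (dB * dC) + (b * dC + c), a' * (dB * dC) + (b * dC + c'))))"

text \<open>Tracing out C splits each vector into its slices at \<open>c\<close>. Hypothesis
  \<open>F\<close> permits any other family with the same kernel in their place, in particular those
  of \<open>pure_polygamy\<close>.\<close>

lemma ensemble_trace_out_last:
  assumes e: "ensemble dA (dB * dC) \<rho> S \<phi>" and t: "trace_out_last dA dB dC \<rho> \<rho>'"
    and F: "\<And>s a b a' b'. s \<in> S \<Longrightarrow> (\<Sum>c<dC. F s c a b * cnj (F s c a' b'))
      = (\<Sum>c<dC. \<phi> s a (b * dC + c) * cnj (\<phi> s a' (b' * dC + c)))"
  shows "ensemble dA dB \<rho>' (S \<times> {..<dC}) (\<lambda>x. F (fst x) (snd x))"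
proof -
  have "(\<Sum>s\<in>S \<times> {..<dC}. mass {..<dA} {..<dB} (F (fst s) (snd s)))
      = (\<Sum>s\<in>S. \<Sum>c<dC. mass {..<dA} {..<dB} (\<lambda>a b. \<phi> s a (b * dC + c)))"
    unfolding sum_Times fst_conv snd_conv
    by (intro sum.cong refl mass_eq_of_kernel F)
  also have "\<dots> = (\<Sum>s\<in>S. mass {..<dA} {..<dB * dC} (\<phi> s))"
    unfolding mass_def sum_lessThan_mult
    by (rule sum.cong[OF refl], subst sum.swap, rule sum.cong[OF refl], rule sum.swap)
  finally have m: "(\<Sum>s\<in>S \<times> {..<dC}. mass {..<dA} {..<dB} (F (fst s) (snd s))) = 1"
    using e unfolding ensemble_def by simp
  have "\<rho>' $$ (a * dB + b, a' * dB + b') = (\<Sum>x\<in>S \<times> {..<dC}. F (fst x) (snd x) a b * cnj (F (fst x) (snd x) a' b'))"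
    if "a < dA" "b < dB" "a' < dA" "b' < dB" for a b a' b'
  proof -
    have "\<rho>' $$ (a * dB + b, a' * dB + b')
        = (\<Sum>c<dC. \<rho> $$ (a * (dB * dC) + (b * dC + c), a' * (dB * dC) + (b' * dC + c)))"
      using t that unfolding trace_out_last_def by blast
    also have "\<dots> = (\<Sum>c<dC. \<Sum>s\<in>S. \<phi> s a (b * dC + c) * cnj (\<phi> s a' (b' * dC + c)))"
      using e that mult_add_less unfolding ensemble_def by (intro sum.cong refl) simp
    also have "\<dots> = (\<Sum>s\<in>S. \<Sum>c<dC. F s c a b * cnj (F s c a' b'))"
      by (subst sum.swap) (simp add: F)
    finally show ?thesis unfolding sum_Times by simp
  qed
  with m e t show ?thesis unfolding ensemble_def trace_out_last_def by simp
qed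

lemma ensemble_trace_out_middle:
  assumes e: "ensemble dA (dB * dC) \<rho> S \<phi>" and t: "trace_out_middle dA dB dC \<rho> \<rho>'"
    and F: "\<And>s a c a' c'. s \<in> S \<Longrightarrow> (\<Sum>b<dB. F s b a c * cnj (F s b a' c'))
      = (\<Sum>b<dB. \<phi> s a (b * dC + c) * cnj (\<phi> s a' (b * dC + c')))"
  shows "ensemble dA dC \<rho>' (S \<times> {..<dB}) (\<lambda>x. F (fst x) (snd x))"
proof -
  have "(\<Sum>s\<in>S \<times> {..<dB}. mass {..<dA} {..<dC} (F (fst s) (snd s)))
      = (\<Sum>s\<in>S. \<Sum>b<dB. mass {..<dA} {..<dC} (\<lambda>a c. \<phi> s a (b * dC + c)))"
    unfolding sum_Times fst_conv snd_conv
    by (intro sum.cong refl mass_eq_of_kernel F)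
  also have "\<dots> = (\<Sum>s\<in>S. mass {..<dA} {..<dB * dC} (\<phi> s))"
    unfolding mass_def sum_lessThan_mult
    by (rule sum.cong[OF refl], rule sum.swap)
  finally have m: "(\<Sum>s\<in>S \<times> {..<dB}. mass {..<dA} {..<dC} (F (fst s) (snd s))) = 1"
    using e unfolding ensemble_def by simp
  have "\<rho>' $$ (a * dC + c, a' * dC + c') = (\<Sum>x\<in>S \<times> {..<dB}. F (fst x) (snd x) a c * cnj (F (fst x) (snd x) a' c'))"
    if "a < dA" "c < dC" "a' < dA" "c' < dC" for a c a' c'
  proof -
    have "\<rho>' $$ (a * dC + c, a' * dC + c')
        = (\<Sum>b<dB. \<rho> $$ (a * (dB * dC) + (b * dC + c), a' * (dB * dC) + (b * dC + c')))"
      using t that unfolding trace_out_middle_def by blast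
    also have "\<dots> = (\<Sum>b<dB. \<Sum>s\<in>S. \<phi> s a (b * dC + c) * cnj (\<phi> s a' (b * dC + c')))"
      using e that mult_add_less unfolding ensemble_def by (intro sum.cong refl) simp
    also have "\<dots> = (\<Sum>s\<in>S. \<Sum>b<dB. F s b a c * cnj (F s b a' c'))"
      by (subst sum.swap) (simp add: F)
    finally show ?thesis unfolding sum_Times by simp
  qed
  with m e t show ?thesis unfolding ensemble_def trace_out_middle_def by simp
qed

text \<open>An arbitrary ensemble of the whole state is refined vector by vector. Each of the four
  refined families is an ensemble of a reduced state; two of them for each reduced state match the
  factor 2 in \<open>pure_polygamy\<close>.\<close>

lemma assistance_subadditive:
  assumes e: "ensemble dA (dB * dC) \<rho> S0 \<phi>0"
    and tB: "trace_out_last dA dB dC \<rho> \<rho>B" and tC: "trace_out_middle dA dB dC \<rho> \<rho>C"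
  shows "entanglement_of_assistance dA (dB * dC) \<rho>
    \<le> entanglement_of_assistance dA dB \<rho>B + entanglement_of_assistance dA dC \<rho>C"
proof (rule assistance_le[OF e])
  fix k and \<phi> :: "nat \<Rightarrow> nat \<Rightarrow> nat \<Rightarrow> complex"
  assume \<phi>: "ensemble dA (dB * dC) \<rho> {..<k} \<phi>"
  have "(\<Sum>s<k. mass {..<dA} {..<dB * dC} (\<phi> s)) = 1" using \<phi> unfolding ensemble_def by simp
  \<comment> \<open>Total mass 1 excludes factors of dimension zero, as \<open>pure_polygamy\<close>
    requires.\<close>
  then have "dB * dC \<noteq> 0" unfolding mass_def by (cases "dB * dC = 0") auto
  then have ne: "{..<dB} \<noteq> {}" "{..<dC} \<noteq> {}" by auto
  define P where "P = (\<lambda>i (m, n, m', n').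
    (\<forall>a c a' c'. (\<Sum>b<dB. m b a c * cnj (m b a' c')) = (\<Sum>b<dB. \<phi> i a (b * dC + c) * cnj (\<phi> i a' (b * dC + c')))) \<and>
    (\<forall>a c a' c'. (\<Sum>b<dB. n b a c * cnj (n b a' c')) = (\<Sum>b<dB. \<phi> i a (b * dC + c) * cnj (\<phi> i a' (b * dC + c')))) \<and>
    (\<forall>a b a' b'. (\<Sum>c<dC. m' c a b * cnj (m' c a' b')) = (\<Sum>c<dC. \<phi> i a (b * dC + c) * cnj (\<phi> i a' (b' * dC + c)))) \<and>
    (\<forall>a b a' b'. (\<Sum>c<dC. n' c a b * cnj (n' c a' b')) = (\<Sum>c<dC. \<phi> i a (b * dC + c) * cnj (\<phi> i a' (b' * dC + c)))) \<and>
    2 * eent {..<dA} {..<dB * dC} (\<phi> i)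
      \<le> (\<Sum>b<dB. eent {..<dA} {..<dC} (m b)) + (\<Sum>b<dB. eent {..<dA} {..<dC} (n b))
        + (\<Sum>c<dC. eent {..<dA} {..<dB} (m' c)) + (\<Sum>c<dC. eent {..<dA} {..<dB} (n' c)))"
  have "\<exists>q. P i q" for i
  proof -
    obtain m n m' n' where
      "\<And>a c a' c'. (\<Sum>b<dB. m b a c * cnj (m b a' c')) = (\<Sum>b<dB. \<phi> i a (b * dC + c) * cnj (\<phi> i a' (b * dC + c')))"
      "\<And>a c a' c'. (\<Sum>b<dB. n b a c * cnj (n b a' c')) = (\<Sum>b<dB. \<phi> i a (b * dC + c) * cnj (\<phi> i a' (b * dC + c')))"
      "\<And>a b a' b'. (\<Sum>c<dC. m' c a b * cnj (m' c a' b')) = (\<Sum>c<dC. \<phi> i a (b * dC + c) * cnj (\<phi> i a' (b' * dC + c)))"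
      "\<And>a b a' b'. (\<Sum>c<dC. n' c a b * cnj (n' c a' b')) = (\<Sum>c<dC. \<phi> i a (b * dC + c) * cnj (\<phi> i a' (b' * dC + c)))"
      "2 * eent {..<dA} ({..<dB} \<times> {..<dC}) (\<lambda>a y. \<phi> i a (fst y * dC + snd y))
      \<le> (\<Sum>b<dB. eent {..<dA} {..<dC} (m b)) + (\<Sum>b<dB. eent {..<dA} {..<dC} (n b))
        + (\<Sum>c<dC. eent {..<dA} {..<dB} (m' c)) + (\<Sum>c<dC. eent {..<dA} {..<dB} (n' c))"
      using pure_polygamy[where A = "{..<dA}" and \<psi> = "\<lambda>a b c. \<phi> i a (b * dC + c)",
          OF finite_lessThan finite_lessThan finite_lessThan ne]
      by blast
    then have "P i (m, n, m', n')" unfolding P_def eent_nested by simp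
    then show ?thesis by blast
  qed
  then obtain q where q: "\<And>i. P i (q i)" by metis
  define m n m' n' where "m = (\<lambda>i. fst (q i))" and "n = (\<lambda>i. fst (snd (q i)))"
    and "m' = (\<lambda>i. fst (snd (snd (q i))))" and "n' = (\<lambda>i. snd (snd (snd (q i))))"
  have "q i = (m i, n i, m' i, n' i)" for i by (simp add: m_def n_def m'_def n'_def)
  then have P: "P i (m i, n i, m' i, n' i)" for i using q[of i] by simp
  define EB where "EB = entanglement_of_assistance dA dB \<rho>B"
  define EC where "EC = entanglement_of_assistance dA dC \<rho>C"
  have l2: "ln (2::real) > 0" by simp
  have "ensemble dA dC \<rho>C ({..<k} \<times> {..<dB}) (\<lambda>x. m (fst x) (snd x))"
    by (rule ensemble_trace_out_middle[OF \<phi> tC]) (use P in \<open>simp add: P_def\<close>)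
  from ensemble_le_assistance[OF this]
  have 1: "(\<Sum>i<k. \<Sum>b<dB. eent {..<dA} {..<dC} (m i b)) \<le> EC * ln 2"
    using l2 unfolding EC_def sum_Times by (simp add: pos_divide_le_eq)
  have "ensemble dA dC \<rho>C ({..<k} \<times> {..<dB}) (\<lambda>x. n (fst x) (snd x))"
    by (rule ensemble_trace_out_middle[OF \<phi> tC]) (use P in \<open>simp add: P_def\<close>)
  from ensemble_le_assistance[OF this]
  have 2: "(\<Sum>i<k. \<Sum>b<dB. eent {..<dA} {..<dC} (n i b)) \<le> EC * ln 2"
    using l2 unfolding EC_def sum_Times by (simp add: pos_divide_le_eq)
  have "ensemble dA dB \<rho>B ({..<k} \<times> {..<dC}) (\<lambda>x. m' (fst x) (snd x))"
    by (rule ensemble_trace_out_last[OF \<phi> tB]) (use P in \<open>simp add: P_def\<close>)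
  from ensemble_le_assistance[OF this]
  have 3: "(\<Sum>i<k. \<Sum>c<dC. eent {..<dA} {..<dB} (m' i c)) \<le> EB * ln 2"
    using l2 unfolding EB_def sum_Times by (simp add: pos_divide_le_eq)
  have "ensemble dA dB \<rho>B ({..<k} \<times> {..<dC}) (\<lambda>x. n' (fst x) (snd x))"
    by (rule ensemble_trace_out_last[OF \<phi> tB]) (use P in \<open>simp add: P_def\<close>)
  from ensemble_le_assistance[OF this]
  have 4: "(\<Sum>i<k. \<Sum>c<dC. eent {..<dA} {..<dB} (n' i c)) \<le> EB * ln 2"
    using l2 unfolding EB_def sum_Times by (simp add: pos_divide_le_eq)
  have "2 * (\<Sum>i<k. eent {..<dA} {..<dB * dC} (\<phi> i))
      \<le> (\<Sum>i<k. (\<Sum>b<dB. eent {..<dA} {..<dC} (m i b)) + (\<Sum>b<dB. eent {..<dA} {..<dC} (n i b))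
        + (\<Sum>c<dC. eent {..<dA} {..<dB} (m' i c)) + (\<Sum>c<dC. eent {..<dA} {..<dB} (n' i c)))"
    unfolding sum_distrib_left using P by (intro sum_mono) (simp add: P_def)
  also have "\<dots> \<le> 2 * ((EB + EC) * ln 2)"
    unfolding sum.distrib using add_mono[OF add_mono[OF 1 2] add_mono[OF 3 4]] by (simp add: algebra_simps)
  finally show "(\<Sum>i<k. eent {..<dA} {..<dB * dC} (\<phi> i)) / ln 2
      \<le> entanglement_of_assistance dA dB \<rho>B + entanglement_of_assistance dA dC \<rho>C"
    using l2 unfolding EB_def EC_def by (simp add: pos_divide_le_eq)
qed

text \<open>Eigenvectors scaled by the square roots of the eigenvalues form an ensemble, so the
  supremum defining the entanglement of assistance is over a nonempty set.\<close>

lemma density_operator_ensemble: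
  assumes "density_operator (dX * dY) \<rho>"
  obtains e \<mu> where "ensemble dX dY \<rho> {..<dX * dY} (\<lambda>i x y. complex_of_real (sqrt (\<mu> i)) * e i (x * dY + y))"
proof -
  let ?n = "dX * dY"
  have \<rho>: "\<rho> \<in> carrier_mat ?n ?n" "mat_adjoint \<rho> = \<rho>" "mat_trace \<rho> = 1"
    and psd: "\<And>v. v \<in> carrier_vec ?n \<Longrightarrow> 0 \<le> Re ((\<rho> *\<^sub>v v) \<bullet>c v)"
    using assms unfolding density_operator_def positive_semidefinite_def by auto
  define X where "X = (\<lambda>a b. \<rho> $$ (a, b))"
  have "X b a = cnj (X a b)" if "a \<in> {..<?n}" "b \<in> {..<?n}" for a b
    using mat_adjoint_index[OF \<rho>(1), of b a] that unfolding \<rho>(2) X_def by simp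
  then obtain e \<mu> where e: "spec {..<?n} {..<?n} X e \<mu>"
    using spectral_theorem[of "{..<?n}" X] by blast
  have "0 \<le> Re (sesq {..<?n} X u u)" for u
  proof -
    have "sesq {..<?n} X u u = (\<rho> *\<^sub>v vec ?n u) \<bullet>c vec ?n u"
      using \<rho>(1) unfolding sesq_def X_def
      by (simp add: scalar_prod_def atLeast0LessThan sum_distrib_right sum_distrib_left mult_ac)
    then show ?thesis using psd by simp
  qed
  then have \<mu>: "0 \<le> \<mu> i" if "i < ?n" for i using spec_nonneg[OF e] that by simp
  define \<phi> where "\<phi> = (\<lambda>i x y. complex_of_real (sqrt (\<mu> i)) * e i (x * dY + y))"
  have "mass {..<dX} {..<dY} (\<phi> i) = \<mu> i" if "i < ?n" for i
  proof -
    have "mass {..<dX} {..<dY} (\<phi> i) = \<mu> i * (\<Sum>x<dX. \<Sum>y<dY. (cmod (e i (x * dY + y)))\<^sup>2)"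
      unfolding mass_def \<phi>_def using \<mu>[OF that]
      by (simp add: norm_mult power_mult_distrib sum_distrib_left)
    then show ?thesis using onb_unit[OF specD(1)[OF e], of i] that by (simp add: sum_lessThan_mult)
  qed
  moreover have "complex_of_real (\<Sum>i<?n. \<mu> i) = 1"
    using \<rho>(1,3) unfolding trace_spec[OF e, symmetric] mat_trace_def X_def by simp
  then have "(\<Sum>i<?n. \<mu> i) = 1" by (metis of_real_eq_1_iff)
  moreover have "\<rho> $$ (x * dY + y, x' * dY + y') = (\<Sum>i<?n. \<phi> i x y * cnj (\<phi> i x' y'))"
    if "x < dX" "y < dY" "x' < dX" "y' < dY" for x y x' y'
  proof -
    have "\<phi> i x y * cnj (\<phi> i x' y') = of_real (\<mu> i) * e i (x * dY + y) * cnj (e i (x' * dY + y'))" if "i < ?n" for i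
    proof -
      have "complex_of_real (sqrt (\<mu> i)) * complex_of_real (sqrt (\<mu> i)) = of_real (\<mu> i)"
        using \<mu>[OF that] by (simp flip: of_real_mult)
      then show ?thesis unfolding \<phi>_def by (simp add: mult_ac)
    qed
    then show ?thesis
      using specD(2)[OF e, of "x * dY + y" "x' * dY + y'"] that mult_add_less unfolding X_def by simp
  qed
  ultimately have "ensemble dX dY \<rho> {..<?n} \<phi>" using \<rho>(1) unfolding ensemble_def by simp
  then show thesis unfolding \<phi>_def by (rule that)
qed

section \<open>Polygamy for many parties\<close>

lemma joint_index_last:
  assumes "b < dB N"
  shows "joint_index (Suc N) dB N (a * dB N + b) l 0 = a * (\<Prod>k<Suc N. dB k) + (l * dB N + b)"
proof -
  have "{N<..<Suc N} = {}" by auto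
  then show ?thesis using assms by (simp add: joint_index_def algebra_simps)
qed

text \<open>The last party is the least significant digit of the index: adjoining it multiplies the
  old index by \<open>dB N\<close> and adds the new digit, which joins the block \<open>s\<close> of
  parties after \<open>j\<close>.\<close>

lemma joint_index_Suc:
  assumes "j < N"
  shows "joint_index (Suc N) dB j r l (s * dB N + u) = joint_index N dB j r l s * dB N + u"
proof -
  have "{j<..<Suc N} = insert N {j<..<N}" using assms by auto
  then have "(\<Prod>k\<in>{j<..<Suc N}. dB k) = (\<Prod>k\<in>{j<..<N}. dB k) * dB N"
    by (simp add: mult.commute)
  then show ?thesis by (simp add: joint_index_def algebra_simps)
qed

lemma joint_index_less:
  assumes j: "j < N" and r: "r < dA * dB j" and l: "l < (\<Prod>k<j. dB k)" and s: "s < (\<Prod>k\<in>{j<..<N}. dB k)"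
  shows "joint_index N dB j r l s < dA * (\<Prod>k<N. dB k)"
proof -
  have d: "dB j > 0" using r by (cases "dB j") auto
  have "r div dB j * (\<Prod>k<j. dB k) + l < dA * (\<Prod>k<j. dB k)"
    using r l by (intro mult_add_less less_mult_imp_div_less)
  then have "(r div dB j * (\<Prod>k<j. dB k) + l) * dB j + r mod dB j < dA * (\<Prod>k<j. dB k) * dB j"
    using d by (rule mult_add_less[OF _ mod_less_divisor])
  then have "joint_index N dB j r l s < dA * (\<Prod>k<j. dB k) * dB j * (\<Prod>k\<in>{j<..<N}. dB k)"
    unfolding joint_index_def using s by (rule mult_add_less)
  moreover have "{..<N} = {..<j} \<union> {j} \<union> {j<..<N}" using j by auto
  then have "(\<Prod>k<N. dB k) = (\<Prod>k<j. dB k) * dB j * (\<Prod>k\<in>{j<..<N}. dB k)"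
    by (simp add: prod.union_disjoint disjoint_iff)
  ultimately show ?thesis by (simp add: mult.assoc)
qed

lemma reduced_AB_single:
  assumes "\<rho> \<in> carrier_mat (dA * dB 0) (dA * dB 0)"
  shows "reduced_AB 1 dA dB \<rho> 0 = \<rho>"
proof (rule eq_matI)
  fix r c assume rc: "r < dim_row \<rho>" "c < dim_col \<rho>"
  have "{0<..<Suc 0} = {}" by auto
  then show "reduced_AB 1 dA dB \<rho> 0 $$ (r, c) = \<rho> $$ (r, c)"
    using assms rc by (simp add: reduced_AB_def joint_index_def)
qed (use assms in \<open>auto simp: reduced_AB_def\<close>)

text \<open>The last party is split off in each step: the three-party bound is applied to A, all
  earlier B taken together, and the last B.\<close>

lemma assistance_polygamy:
  assumes "ensemble dA (\<Prod>k<Suc N. dB k) \<rho> S \<phi>"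
  shows "entanglement_of_assistance dA (\<Prod>k<Suc N. dB k) \<rho>
      \<le> (\<Sum>j<Suc N. entanglement_of_assistance dA (dB j) (reduced_AB (Suc N) dA dB \<rho> j))
    \<and> (\<forall>j<Suc N. 0 \<le> entanglement_of_assistance dA (dB j) (reduced_AB (Suc N) dA dB \<rho> j))"
proof -
  \<comment> \<open>The index set is moved to the naturals because the induction step passes to an
    ensemble over a product set, whose type differs from that of \<open>S\<close>.\<close>
  have "\<exists>(S :: nat set) \<phi>. ensemble dA (\<Prod>k<Suc N. dB k) \<rho> S \<phi>"
    using ensemble_assist_value[OF assms] ensemble_of_decomposition(1) unfolding assist_values_def by blast
  then show ?thesis
  proof (induction N arbitrary: \<rho>)
    case 0
    then obtain S :: "nat set" and \<phi> where e: "ensemble dA (dB 0) \<rho> S \<phi>" by auto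
    then have "reduced_AB 1 dA dB \<rho> 0 = \<rho>" by (intro reduced_AB_single) (simp add: ensemble_def)
    then show ?case using assistance_nonneg[OF e] by simp
  next
    case (Suc N)
    define N' where "N' = Suc N"
    define D where "D = (\<Prod>k<N'. dB k)"
    define d where "d = dB N'"
    have Dd: "(\<Prod>k<Suc N'. dB k) = D * d" by (simp add: D_def d_def)
    obtain S :: "nat set" and \<phi> where e: "ensemble dA (D * d) \<rho> S \<phi>"
      using Suc.prems unfolding N'_def[symmetric] Dd by blast
    \<comment> \<open>The last party is traced out; as it is the least significant digit, the
      remaining index is the quotient by \<open>d\<close>.\<close>
    define \<rho>' where "\<rho>' = mat (dA * D) (dA * D) (\<lambda>(r, c). \<Sum>s<d. \<rho> $$ (r * d + s, c * d + s))"
    have t: "trace_out_last dA D d \<rho> \<rho>'"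
      unfolding trace_out_last_def \<rho>'_def
      by (auto simp: mult_add_less add_mult_distrib mult.assoc add.assoc)
    have t': "trace_out_middle dA D d \<rho> (reduced_AB (Suc N') dA dB \<rho> N')"
    proof -
      have em: "{N'<..<Suc N'} = {}" by auto
      have "reduced_AB (Suc N') dA dB \<rho> N' $$ (a * d + c, a' * d + c')
          = (\<Sum>b<D. \<rho> $$ (a * (D * d) + (b * d + c), a' * (D * d) + (b * d + c')))"
        if ac: "a < dA" "c < d" "a' < dA" "c' < d" for a c a' c'
      proof -
        have "reduced_AB (Suc N') dA dB \<rho> N' $$ (a * d + c, a' * d + c')
            = (\<Sum>b<D. \<rho> $$ (joint_index (Suc N') dB N' (a * dB N' + c) b 0, joint_index (Suc N') dB N' (a' * dB N' + c') b 0))"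
          using ac mult_add_less[of a dA c d] mult_add_less[of a' dA c' d]
          unfolding reduced_AB_def em by (simp add: D_def d_def)
        then show ?thesis
          unfolding joint_index_last[of c dB N', OF ac(2)[unfolded d_def]]
            joint_index_last[of c' dB N', OF ac(4)[unfolded d_def]] Dd
          by (simp add: d_def)
      qed
      then show ?thesis unfolding trace_out_middle_def by (auto simp: reduced_AB_def d_def)
    qed
    \<comment> \<open>The sum over the digits after \<open>j\<close> splits into the last digit,
      already summed in \<open>\<rho>'\<close>, and the others.\<close>
    have red: "reduced_AB (Suc N') dA dB \<rho> j = reduced_AB N' dA dB \<rho>' j" if j: "j < N'" for j
    proof (rule eq_matI)
      fix r c assume rc: "r < dim_row (reduced_AB N' dA dB \<rho>' j)" "c < dim_col (reduced_AB N' dA dB \<rho>' j)"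
      then have rc: "r < dA * dB j" "c < dA * dB j" by (auto simp: reduced_AB_def)
      have "{j<..<Suc N'} = insert N' {j<..<N'}" using j by auto
      then have P: "(\<Prod>k\<in>{j<..<Suc N'}. dB k) = (\<Prod>k\<in>{j<..<N'}. dB k) * d"
        by (simp add: d_def mult.commute)
      have "reduced_AB (Suc N') dA dB \<rho> j $$ (r, c)
          = (\<Sum>l<(\<Prod>k<j. dB k). \<Sum>s<(\<Prod>k\<in>{j<..<N'}. dB k). \<Sum>u<d.
              \<rho> $$ (joint_index N' dB j r l s * d + u, joint_index N' dB j c l s * d + u))"
        using rc unfolding reduced_AB_def P sum_lessThan_mult by (simp add: d_def joint_index_Suc[OF j])
      also have "\<dots> = reduced_AB N' dA dB \<rho>' j $$ (r, c)"
        using rc joint_index_less[OF j]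
        unfolding reduced_AB_def[of N'] \<rho>'_def D_def by simp
      finally show "reduced_AB (Suc N') dA dB \<rho> j $$ (r, c) = reduced_AB N' dA dB \<rho>' j $$ (r, c)" .
    qed (auto simp: reduced_AB_def)
    have e': "ensemble dA D \<rho>' (S \<times> {..<d}) (\<lambda>x a b. \<phi> (fst x) a (b * d + snd x))"
      using ensemble_trace_out_last[OF e t, of "\<lambda>s c a b. \<phi> s a (b * d + c)"] by simp
    have e'': "ensemble dA d (reduced_AB (Suc N') dA dB \<rho> N') (S \<times> {..<D}) (\<lambda>x a c. \<phi> (fst x) a (snd x * d + c))"
      using ensemble_trace_out_middle[OF e t', of "\<lambda>s b a c. \<phi> s a (b * d + c)"] by simp
    have "\<exists>(S :: nat set) \<phi>. ensemble dA D \<rho>' S \<phi>"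
      using ensemble_assist_value[OF e'] ensemble_of_decomposition(1) unfolding assist_values_def by blast
    from Suc.IH[of \<rho>'] this
    have IH: "entanglement_of_assistance dA D \<rho>'
        \<le> (\<Sum>j<N'. entanglement_of_assistance dA (dB j) (reduced_AB N' dA dB \<rho>' j))"
      "\<forall>j<N'. 0 \<le> entanglement_of_assistance dA (dB j) (reduced_AB N' dA dB \<rho>' j)"
      unfolding N'_def[symmetric] D_def[symmetric] by auto
    have "entanglement_of_assistance dA (\<Prod>k<Suc N'. dB k) \<rho>
        \<le> entanglement_of_assistance dA D \<rho>' + entanglement_of_assistance dA d (reduced_AB (Suc N') dA dB \<rho> N')"
      unfolding Dd by (rule assistance_subadditive[OF e t t'])
    also have "\<dots> \<le> (\<Sum>j<Suc N'. entanglement_of_assistance dA (dB j) (reduced_AB (Suc N') dA dB \<rho> j))"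
      using IH(1) by (simp add: red d_def)
    finally have "entanglement_of_assistance dA (\<Prod>k<Suc N'. dB k) \<rho>
        \<le> (\<Sum>j<Suc N'. entanglement_of_assistance dA (dB j) (reduced_AB (Suc N') dA dB \<rho> j))" .
    moreover have "0 \<le> entanglement_of_assistance dA (dB j) (reduced_AB (Suc N') dA dB \<rho> j)" if "j < Suc N'" for j
      using that IH(2) assistance_nonneg[OF e''] by (cases "j = N'") (auto simp: red d_def)
    ultimately show ?case unfolding N'_def by blast
  qed
qed

section \<open>Powers of sums\<close>

lemma one_plus_powr_le:
  fixes t \<beta> :: real
  assumes "0 \<le> t" "t \<le> 1" "0 < \<beta>" "\<beta> \<le> 1"
  shows "(1 + t) powr \<beta> \<le> 1 + \<beta> * t powr \<beta>"
proof -
  \<comment> \<open>The function of \<open>t\<close> vanishes at 0, and its derivative \<beta> -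
    \<beta> (1 + x)^(\<beta> - 1) is nonnegative because the exponent is at most 0.\<close>
  have "1 + \<beta> * 0 - (1 + 0) powr \<beta> \<le> 1 + \<beta> * t - (1 + t) powr \<beta>"
  proof (rule DERIV_nonneg_imp_nondecreasing[where f = "\<lambda>t. 1 + \<beta> * t - (1 + t) powr \<beta>", OF assms(1)])
    fix x :: real assume x: "0 \<le> x" "x \<le> t"
    have "((\<lambda>t. 1 + \<beta> * t - (1 + t) powr \<beta>) has_real_derivative \<beta> - \<beta> * (1 + x) powr (\<beta> - 1)) (at x)"
      using x by (auto intro!: derivative_eq_intros)
    moreover have "(1 + x) powr (\<beta> - 1) \<le> (1 + x) powr 0" using x assms by (intro powr_mono) auto
    then have "0 \<le> \<beta> - \<beta> * (1 + x) powr (\<beta> - 1)" using x assms by (simp add: mult_le_cancel_left1)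
    ultimately show "\<exists>y. ((\<lambda>t. 1 + \<beta> * t - (1 + t) powr \<beta>) has_real_derivative y) (at x) \<and> 0 \<le> y" by blast
  qed
  then have "(1 + t) powr \<beta> \<le> 1 + \<beta> * t" by simp
  also have "t \<le> t powr \<beta>"
    using assms powr_mono'[of \<beta> 1 t] by (cases "t = 0") auto
  then have "1 + \<beta> * t \<le> 1 + \<beta> * t powr \<beta>" using assms by (simp add: mult_left_mono)
  finally show ?thesis .
qed

text \<open>By homogeneity this is the previous inequality at t = s / x.\<close>

lemma add_powr_le:
  fixes x s \<beta> :: real
  assumes "0 \<le> s" "s \<le> x" "0 < \<beta>" "\<beta> \<le> 1"
  shows "(x + s) powr \<beta> \<le> x powr \<beta> + \<beta> * s powr \<beta>"
proof (cases "x = 0")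
  case False
  then have x: "x > 0" using assms by simp
  have "x + s = x * (1 + s / x)" using x by (simp add: distrib_left)
  then have "(x + s) powr \<beta> = x powr \<beta> * (1 + s / x) powr \<beta>"
    using x assms by (simp add: powr_mult)
  also have "\<dots> \<le> x powr \<beta> * (1 + \<beta> * (s / x) powr \<beta>)"
    using x assms by (intro mult_left_mono one_plus_powr_le) auto
  also have "\<dots> = x powr \<beta> + \<beta> * s powr \<beta>"
    using x assms by (simp add: powr_divide field_simps)
  finally show ?thesis .
qed (use assms in auto)

text \<open>The leading term dominates the sum of the later ones, so splitting it off puts one
  factor \<beta> on the tail. The tail satisfies the same hypotheses, and the factors accumulate to
  the powers of \<beta>.\<close>

lemma sum_powr_le:
  fixes x :: "nat \<Rightarrow> real" and \<beta> :: real
  assumes "0 < \<beta>" "\<beta> \<le> 1" "\<And>j. j < N \<Longrightarrow> 0 \<le> x j"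
    and "\<And>i. i + 1 < N \<Longrightarrow> (\<Sum>j = i + 1..<N. x j) \<le> x i"
  shows "(\<Sum>j<N. x j) powr \<beta> \<le> (\<Sum>j<N. \<beta> ^ j * x j powr \<beta>)"
  using assms(3,4)
proof (induction N arbitrary: x)
  case 0
  then show ?case by simp
next
  case (Suc N)
  define s where "s = (\<Sum>j<N. x (Suc j))"
  have s0: "0 \<le> s" unfolding s_def using Suc.prems(1) by (intro sum_nonneg) auto
  have sx: "s \<le> x 0"
  proof (cases "N = 0")
    case False
    then have "(\<Sum>j = 0 + 1..<Suc N. x j) \<le> x 0" by (intro Suc.prems(2)) simp
    then show ?thesis unfolding s_def by (simp add: sum.shift_bounds_Suc_ivl atLeast0LessThan del: sum.op_ivl_Suc)
  qed (use Suc.prems in \<open>simp add: s_def\<close>)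
  have IH: "s powr \<beta> \<le> (\<Sum>j<N. \<beta> ^ j * x (Suc j) powr \<beta>)"
    unfolding s_def
  proof (rule Suc.IH)
    show "0 \<le> x (Suc j)" if "j < N" for j using Suc.prems(1) that by simp
    show "(\<Sum>j = i + 1..<N. x (Suc j)) \<le> x (Suc i)" if "i + 1 < N" for i
      using Suc.prems(2)[of "Suc i"] that by (simp add: sum.shift_bounds_Suc_ivl del: sum.op_ivl_Suc)
  qed
  have "(\<Sum>j<Suc N. x j) powr \<beta> = (x 0 + s) powr \<beta>"
    unfolding s_def by (simp add: sum.lessThan_Suc_shift del: sum.lessThan_Suc)
  also have "\<dots> \<le> x 0 powr \<beta> + \<beta> * s powr \<beta>" by (rule add_powr_le[OF s0 sx assms(1,2)])
  also have "\<dots> \<le> x 0 powr \<beta> + \<beta> * (\<Sum>j<N. \<beta> ^ j * x (Suc j) powr \<beta>)"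
    using IH assms(1) by simp
  also have "\<dots> = (\<Sum>j<Suc N. \<beta> ^ j * x j powr \<beta>)"
    by (simp add: sum.lessThan_Suc_shift sum_distrib_left mult.assoc del: sum.lessThan_Suc)
  finally show ?case .
qed

theorem theorem2:
  fixes \<beta> :: real and N dA :: nat and dB :: "nat \<Rightarrow> nat" and \<rho> :: "complex mat"
  assumes "0 \<le> \<beta>" and "\<beta> \<le> 1" and "1 \<le> N"
    and "density_operator (dA * (\<Prod>k<N. dB k)) \<rho>"
    and "\<And>i. i + 1 < N \<Longrightarrow>
           entanglement_of_assistance dA (dB i) (reduced_AB N dA dB \<rho> i)
             \<ge> (\<Sum>j = i + 1..<N. entanglement_of_assistance dA (dB j) (reduced_AB N dA dB \<rho> j))"
  shows "rpow (entanglement_of_assistance dA (\<Prod>k<N. dB k) \<rho>) \<beta>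
           \<le> (\<Sum>j<N. \<beta> ^ j * rpow (entanglement_of_assistance dA (dB j) (reduced_AB N dA dB \<rho> j)) \<beta>)"
proof -
  define E where "E = (\<lambda>j. entanglement_of_assistance dA (dB j) (reduced_AB N dA dB \<rho> j))"
  obtain M where M: "N = Suc M" using assms(3) by (cases N) auto
  obtain e \<mu> where e: "ensemble dA (\<Prod>k<N. dB k) \<rho> {..<dA * (\<Prod>k<N. dB k)}
      (\<lambda>i x y. complex_of_real (sqrt (\<mu> i)) * e i (x * (\<Prod>k<N. dB k) + y))"
    using density_operator_ensemble[OF assms(4)] by blast
  have poly: "entanglement_of_assistance dA (\<Prod>k<N. dB k) \<rho> \<le> (\<Sum>j<N. E j)"
    and nn: "\<And>j. j < N \<Longrightarrow> 0 \<le> E j"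
    using assistance_polygamy[OF e[unfolded M]] unfolding E_def M by auto
  show ?thesis
  proof (cases "\<beta> = 0")
    case True
    \<comment> \<open>At \<beta> = 0 every \<open>rpow\<close> is 1, and the summand j = 0, with
      coefficient 0^0 = 1, already reaches the left side.\<close>
    have "(1::real) = \<beta> ^ 0 * 1" by simp
    also have "\<dots> \<le> (\<Sum>j<N. \<beta> ^ j * 1)"
      using assms(1,3) by (intro member_le_sum) auto
    finally show ?thesis using True by (simp add: rpow_def)
  next
    case False
    then have \<beta>: "0 < \<beta>" using assms(1) by simp
    have "entanglement_of_assistance dA (\<Prod>k<N. dB k) \<rho> powr \<beta> \<le> (\<Sum>j<N. E j) powr \<beta>"
      using poly assistance_nonneg[OF e] assms(1) by (intro powr_mono2)
    also have "\<dots> \<le> (\<Sum>j<N. \<beta> ^ j * E j powr \<beta>)"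
      by (rule sum_powr_le[OF \<beta> assms(2) nn]) (use assms(5) in \<open>simp_all add: E_def\<close>)
    finally show ?thesis using False by (simp add: rpow_def E_def)
  qed
qed

end
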